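(* Let $(c,\mathbf{u},p)$ be a smooth solution of the system $$\rho\frac{Dc}{Dt}=\nabla\cdot(\mathcal{M}\nabla\tilde\mu),\qquad \tilde\mu=\lambda_c\frac{dG}{dc}-\frac{\lambda_c\gamma^2}{\rho}\nabla\cdot(\rho\nabla c)+\alpha p,\qquad \frac{D\rho}{Dt}+\rho\nabla\cdot\mathbf{u}=0,$$ $$\rho\frac{D\mathbf{u}}{Dt}=\nabla\cdot(2\eta\boldsymbol{D}_\eta)+\nabla(\lambda\nabla\cdot\mathbf{u})-\nabla p-\nabla\cdot(\lambda_c\gamma^2\rho\,\nabla c\otimes\nabla c)$$ in $\Omega$, with the boundary conditions on $\partial\Omega$ $$\frac{D_\Gamma c}{Dt}=-\mathcal{M}_\Gamma L(c),\qquad \nabla\tilde\mu\cdot\mathbf{n}=0,\qquad \mathbf{u}\cdot\mathbf{n}=0,\qquad u^s_{\tau_i}=\beta_\Gamma^{-1}\bigl(-(\mathbf{n}\cdot\boldsymbol{\sigma}_\eta\cdot\boldsymbol{\tau}_i)+L(c)\,\partial_{\tau_i}c\bigr),\quad i=1,2,$$ where $L(c)=\rho\lambda_c\gamma^2\partial_n c+\frac{df_w}{dc}$ and $\boldsymbol{\sigma}_\eta=2\eta\boldsymbol{D}_\eta+\lambda(\nabla\cdot\mathbf{u})I-pI$. Then $$\frac{d}{dt}\left\{\int_\Omega\frac{\rho|\mathbf{u}|^2}{2}\,d\mathbf{x}+\int_\Omega\lambda_c\rho\Bigl(G(c)+\frac{\gamma^2}{2}|\nabla c|^2\Bigr)d\mathbf{x}+\int_{\partial\Omega_w}f_w(c)\,dS\right\}$$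 $$=-\int_\Omega2\eta|\boldsymbol{D}_\eta|^2d\mathbf{x}-\int_\Omega\lambda|\nabla\cdot\mathbf{u}|^2d\mathbf{x}-\int_\Omega\mathcal{M}|\nabla\tilde\mu|^2d\mathbf{x}-\int_{\partial\Omega_w}\Bigl(\mathcal{M}_\Gamma|L(c)|^2+\beta_\Gamma|\mathbf{u}^s|^2\Bigr)dS.$$
   Context: $\Omega$ is a bounded domain with outward unit normal $\mathbf{n}$ on $\partial\Omega$. The solid wall $\partial\Omega_w$ is the whole boundary, $\partial\Omega_w=\partial\Omega$, and it is fixed. $\boldsymbol{\tau}_i$ denote orthonormal tangent vectors to $\partial\Omega$ (two in space dimension three, one in dimension two), $\partial_{\tau_i}=\boldsymbol{\tau}_i\cdot\nabla$, $\partial_n=\mathbf{n}\cdot\nabla$. The unknowns are the mass fraction $c(\mathbf{x},t)$ of phase 1, the mass-averaged velocity $\mathbf{u}(\mathbf{x},t)$ and the pressure $p(\mathbf{x},t)$. The mixture density is $\rho=\rho(c)>0$ given by $\frac1\rho=\frac{c}{\rho_1}+\frac{1-c}{\rho_2}$ with constant pure-phase densities $\rho_1,\rho_2>0$, and $\alpha=-\frac{1}{\rho^2}\frac{d\rho}{dc}=\frac{\rho_2-\rho_1}{\rho_1\rho_2}$. $\frac{D}{Dt}=\partial_t+\mathbf{u}\cdot\nabla$ is the material derivative; $\nabla_\Gamma=\nabla-\mathbf{n}(\mathbf{n}\cdot\nabla)$ is the surface gradient; $\frac{D_\Gamma c}{Dt}=\partial_tc+\mathbf{u}\cdot\nabla_\Gamma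 c$. The slip velocity is $\mathbf{u}^s=\mathbf{u}_\tau=\mathbf{u}-(\mathbf{u}\cdot\mathbf{n})\mathbf{n}$ (since the wall is fixed), with components $u^s_{\tau_i}=\mathbf{u}^s\cdot\boldsymbol{\tau}_i$. $\boldsymbol{D}_\eta=\frac12(\nabla\mathbf{u}+(\nabla\mathbf{u})^T)$, and $|\boldsymbol{D}_\eta|$ is its Frobenius norm. $G(c)=\frac14c^2(1-c)^2$ and $f_w(c)=-\frac\sigma2\cos(\theta_s)\sin\bigl(\frac{(2c-1)\pi}{2}\bigr)$, with constants $\sigma$ (surface tension), $\theta_s$ (static contact angle), $\lambda_c$ (mixing energy density), $\gamma$ (capillary width). $\eta(c)$ and $\lambda(c)$ are the Lamé (viscosity) coefficients, $\mathcal{M}$ and $\mathcal{M}_\Gamma$ are the bulk and wall mobility coefficients, and $\beta_\Gamma(c)>0$ is the wall friction coefficient; here $\frac1{\eta(c)}=\frac{c}{\eta_1}+\frac{1-c}{\eta_2}$ and $\frac1{\beta_\Gamma(c)}=\frac{c}{\beta_{\Gamma_1}}+\frac{1-c}{\beta_{\Gamma_2}}$ with positive constants $\eta_i,\beta_{\Gamma_i}$. *)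

theory Defs
  imports "HOL-Analysis.Analysis"
begin

section \<open>Smoothness\<close>

fun Ck_on :: "nat \<Rightarrow> 'a::real_normed_vector set \<Rightarrow> ('a \<Rightarrow> 'b::real_normed_vector) \<Rightarrow> bool" where
  "Ck_on 0 W f \<longleftrightarrow> continuous_on W f"
| "Ck_on (Suc k) W f \<longleftrightarrow>
     (\<forall>x\<in>W. f differentiable (at x)) \<and> (\<forall>v. Ck_on k W (\<lambda>x. frechet_derivative f (at x) v))"

text \<open>Smoothness on an arbitrary set \<open>A\<close> (e.g. a closed one) means smoothness on an open
  neighbourhood of \<open>A\<close>. In this way the derivatives at boundary points of a domain
  are ordinary Frechet derivatives.\<close>

definition smooth_on :: "'a::real_normed_vector set \<Rightarrow> ('a \<Rightarrow> 'b::real_normed_vector) \<Rightarrow> bool" where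
  "smooth_on A f \<longleftrightarrow> (\<exists>W. open W \<and> A \<subseteq> W \<and> (\<forall>k. Ck_on k W f))"


section \<open>Differential operators\<close>

definition grad :: "(real^'n \<Rightarrow> real) \<Rightarrow> real^'n \<Rightarrow> real^'n" where
  "grad f x = (\<chi> i. frechet_derivative f (at x) (axis i 1))"

definition divergence :: "(real^'n \<Rightarrow> real^'n) \<Rightarrow> real^'n \<Rightarrow> real" where
  "divergence F x = (\<Sum>i\<in>UNIV. grad (\<lambda>y. F y $ i) x $ i)"

text \<open>\<open>(div T)\<^sub>j = \<Sum>\<^sub>i \<partial>\<^sub>i T\<^sub>i\<^sub>j\<close>; it is only applied to symmetric tensors.\<close>

definition tensor_div :: "(real^'n \<Rightarrow> real^'n^'n) \<Rightarrow> real^'n \<Rightarrow> real^'n" where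
  "tensor_div T x = (\<chi> j. divergence (\<lambda>y. column j (T y)) x)"

definition outer :: "real^'n \<Rightarrow> real^'n \<Rightarrow> real^'n^'n" where
  "outer a b = (\<chi> i j. a $ i * b $ j)"

definition strain :: "(real^'n \<Rightarrow> real^'n) \<Rightarrow> real^'n \<Rightarrow> real^'n^'n" where
  "strain u x = (1/2) *\<^sub>R (matrix (frechet_derivative u (at x))
                        + transpose (matrix (frechet_derivative u (at x))))"

text \<open>Material derivative \<open>\<partial>\<^sub>t + u \<cdot> \<nabla>\<close> of a scalar and of a vector field.\<close>

definition mat_deriv ::
  "(real \<Rightarrow> real^'n \<Rightarrow> real^'n) \<Rightarrow> (real \<Rightarrow> real^'n \<Rightarrow> real) \<Rightarrow> real \<Rightarrow> real^'n \<Rightarrow> real" where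
  "mat_deriv u f t x = deriv (\<lambda>s. f s x) t + u t x \<bullet> grad (f t) x"

definition mat_deriv_vec ::
  "(real \<Rightarrow> real^'n \<Rightarrow> real^'n) \<Rightarrow> (real \<Rightarrow> real^'n \<Rightarrow> real^'n) \<Rightarrow> real \<Rightarrow> real^'n \<Rightarrow> real^'n" where
  "mat_deriv_vec u F t x =
     vector_derivative (\<lambda>s. F s x) (at t) + frechet_derivative (F t) (at x) (u t x)"

text \<open>Surface gradient with respect to a unit normal vector \<open>\<nu>\<close>, and the surface material
  derivative built from it.\<close>

definition surf_grad :: "real^'n \<Rightarrow> (real^'n \<Rightarrow> real) \<Rightarrow> real^'n \<Rightarrow> real^'n" where
  "surf_grad \<nu> f x = grad f x - (\<nu> \<bullet> grad f x) *\<^sub>R \<nu>"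

definition surf_mat_deriv ::
  "(real^'n \<Rightarrow> real^'n) \<Rightarrow> (real \<Rightarrow> real^'n \<Rightarrow> real^'n) \<Rightarrow> (real \<Rightarrow> real^'n \<Rightarrow> real)
     \<Rightarrow> real \<Rightarrow> real^'n \<Rightarrow> real" where
  "surf_mat_deriv n u f t x = deriv (\<lambda>s. f s x) t + u t x \<bullet> surf_grad (n x) (f t) x"


section \<open>Domains with \<open>C\<^sup>1\<close> boundary, outward normal, surface measure\<close>

text \<open>A function of the \<open>CARD('n) - 1\<close> coordinates other than \<open>k\<close> is represented as a function
  on the whole space that does not depend on the \<open>k\<close>-th coordinate.\<close>

definition graph_fun :: "'n \<Rightarrow> (real^'n \<Rightarrow> real) \<Rightarrow> bool" where
  "graph_fun k g \<longleftrightarrow> Ck_on 1 UNIV g \<and> (\<forall>x y. (\<forall>i. i \<noteq> k \<longrightarrow> x $ i = y $ i) \<longrightarrow> g x = g y)"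

text \<open>Inside \<open>U\<close> the set \<open>\<Omega>\<close> lies above (\<open>s = 1\<close>: \<open>x\<^sub>k > g\<close>) or below
  (\<open>s = -1\<close>: \<open>x\<^sub>k < - g\<close>) a \<open>C\<^sup>1\<close> graph: the usual definition of a \<open>C\<^sup>1\<close> boundary,
  up to relabelling and reorienting the coordinate axes.\<close>

definition domain_chart ::
  "(real^'n) set \<Rightarrow> (real^'n) set \<Rightarrow> 'n \<Rightarrow> real \<Rightarrow> (real^'n \<Rightarrow> real) \<Rightarrow> bool" where
  "domain_chart \<Omega> U k s g \<longleftrightarrow>
     open U \<and> s \<in> {1, -1} \<and> graph_fun k g \<and> \<Omega> \<inter> U = {x \<in> U. s * x $ k > g x}"

definition C1_domain :: "(real^'n) set \<Rightarrow> bool" where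
  "C1_domain \<Omega> \<longleftrightarrow> open \<Omega> \<and> connected \<Omega> \<and> \<Omega> \<noteq> {} \<and>
     (\<forall>z\<in>frontier \<Omega>. \<exists>U k s g. z \<in> U \<and> domain_chart \<Omega> U k s g)"

text \<open>Near a boundary point, \<open>\<Omega> = {\<phi> < 0}\<close> with \<open>\<phi> x = g x - s x\<^sub>k\<close>, and the outward unit normal
  is \<open>\<nabla>\<phi> / |\<nabla>\<phi>|\<close>; it does not depend on the chart.\<close>

definition outward_unit_normal :: "(real^'n) set \<Rightarrow> (real^'n \<Rightarrow> real^'n) \<Rightarrow> bool" where
  "outward_unit_normal \<Omega> n \<longleftrightarrow>
     (\<forall>z\<in>frontier \<Omega>. \<forall>U k s g. z \<in> U \<and> domain_chart \<Omega> U k s g \<longrightarrow>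
        n z = (let v = grad g z - s *\<^sub>R axis k 1 in (1 / norm v) *\<^sub>R v))"

definition graph_point :: "'n \<Rightarrow> (real^'n \<Rightarrow> real) \<Rightarrow> ('n \<Rightarrow> real) \<Rightarrow> real^'n" where
  "graph_point k g w = (\<chi> i. if i = k then g (\<chi> j. if j = k then 0 else w j) else w i)"

text \<open>\<open>S\<close> is the surface measure of the \<open>C\<^sup>1\<close> hypersurface \<open>\<Gamma>\<close>: it is carried by \<open>\<Gamma>\<close>, and on every
  graph \<open>x\<^sub>k = g\<close> contained in \<open>\<Gamma>\<close> it is given by the area element
  \<open>dS = sqrt (1 + |\<nabla>g|\<^sup>2) dx'\<close>, where \<open>dx'\<close> is Lebesgue measure in the coordinates other than
  \<open>k\<close>. For a compact \<open>C\<^sup>1\<close> hypersurface these properties determine exactly one measure, the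
  \<open>CARD('n) - 1\<close>-dimensional Hausdorff measure on \<open>\<Gamma>\<close>.\<close>

definition surface_measure :: "(real^'n) set \<Rightarrow> (real^'n) measure \<Rightarrow> bool" where
  "surface_measure \<Gamma> S \<longleftrightarrow>
     sets S = sets borel \<and> emeasure S (- \<Gamma>) = 0 \<and>
     (\<forall>U k g. open U \<and> graph_fun k g \<and> \<Gamma> \<inter> U = {x \<in> U. x $ k = g x} \<longrightarrow>
        (\<forall>A\<in>sets borel. A \<subseteq> \<Gamma> \<inter> U \<longrightarrow>
           emeasure S A =
             (\<integral>\<^sup>+ w. ennreal (sqrt (1 + (norm (grad g (graph_point k g w)))\<^sup>2))
                     * indicator A (graph_point k g w)
              \<partial>(PiM (UNIV - {k}) (\<lambda>_. lborel)))))"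

text \<open>At each boundary point, \<open>\<tau> 1, \<dots>, \<tau> (CARD('n) - 1)\<close> is an orthonormal basis of the
  tangent space; no continuity in the point is required (in general there is no global
  continuous frame).\<close>

definition tangent_frame ::
  "(real^'n) set \<Rightarrow> (real^'n \<Rightarrow> real^'n) \<Rightarrow> (nat \<Rightarrow> real^'n \<Rightarrow> real^'n) \<Rightarrow> bool" where
  "tangent_frame \<Gamma> n \<tau> \<longleftrightarrow>
     (\<forall>x\<in>\<Gamma>. \<forall>i\<in>{1..<CARD('n)}. \<tau> i x \<bullet> n x = 0 \<and>
        (\<forall>j\<in>{1..<CARD('n)}. \<tau> i x \<bullet> \<tau> j x = (if i = j then 1 else 0)))"


section \<open>Constitutive functions\<close>

text \<open>\<open>1 / q(c) = c / q\<^sub>1 + (1 - c) / q\<^sub>2\<close>\<close>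

definition mixture :: "real \<Rightarrow> real \<Rightarrow> real \<Rightarrow> real" where
  "mixture q1 q2 c = 1 / (c / q1 + (1 - c) / q2)"

definition double_well :: "real \<Rightarrow> real" where
  "double_well c = (1/4) * c\<^sup>2 * (1 - c)\<^sup>2"

definition wall_energy :: "real \<Rightarrow> real \<Rightarrow> real \<Rightarrow> real" where
  "wall_energy \<sigma> \<theta>s c = - (\<sigma>/2) * cos \<theta>s * sin ((2 * c - 1) * pi / 2)"

definition density_coeff :: "real \<Rightarrow> real \<Rightarrow> real" where
  "density_coeff \<rho>1 \<rho>2 = (\<rho>2 - \<rho>1) / (\<rho>1 * \<rho>2)"

lemma density_coeff_eq:
  assumes "\<rho>1 > 0" "\<rho>2 > 0" "mixture \<rho>1 \<rho>2 c > 0"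
  shows "density_coeff \<rho>1 \<rho>2 = - (1 / (mixture \<rho>1 \<rho>2 c)\<^sup>2) * deriv (mixture \<rho>1 \<rho>2) c"
proof -
  define d where "d = c / \<rho>1 + (1 - c) / \<rho>2"
  have d: "d \<noteq> 0"
    using assms(3) by (auto simp: mixture_def d_def)
  have "((\<lambda>r. 1 / (r / \<rho>1 + (1 - r) / \<rho>2)) has_real_derivative
          - (1 / \<rho>1 - 1 / \<rho>2) / d\<^sup>2) (at c)"
    using d assms(1,2) unfolding d_def
    by (auto intro!: derivative_eq_intros simp: power2_eq_square)
  then have "deriv (mixture \<rho>1 \<rho>2) c = - (1 / \<rho>1 - 1 / \<rho>2) / d\<^sup>2"
    unfolding mixture_def by (rule DERIV_imp_deriv)
  moreover have "mixture \<rho>1 \<rho>2 c = 1 / d"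
    by (simp add: mixture_def d_def)
  ultimately have "- (1 / (mixture \<rho>1 \<rho>2 c)\<^sup>2) * deriv (mixture \<rho>1 \<rho>2) c = 1 / \<rho>1 - 1 / \<rho>2"
    using d by (simp add: power_divide)
  also have "\<dots> = density_coeff \<rho>1 \<rho>2"
    using assms(1,2) by (simp add: density_coeff_def diff_frac_eq)
  finally show ?thesis ..
qed

end

(* The energy density e = rho (|u|^2/2 + lambda_c (G(c) + gamma^2/2 |grad c|^2)) satisfies a local
   balance: its time derivative is the divergence of the flux
     M mu grad mu + lambda_c gamma^2 rho (d_t c) grad c + 2 eta D u + (lambda div u - p - e) u
   minus the bulk dissipation.  The capillary stress cancels against the commutator of D/Dt with the
   gradient, and the pressure work cancels because mass conservation reads div u = alpha rho Dc/Dt.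
   On the wall only L d_t c + n . (2 eta D u) - f_w' d_t c survives of the normal flux, and the two
   wall conditions turn this, together with the wall energy, into the boundary dissipation.

   The divergence theorem for C^1 domains is obtained by cutting the integrand off to balls that lie in
   the domain or in a boundary chart; in a chart the shear x + phi(x) e_k straightens the boundary
   and preserves Lebesgue measure, so that Fubini and the one-dimensional fundamental theorem apply. *)
theory Submission
  imports Defs
begin

section \<open>Calculus of continuously differentiable functions\<close>

text \<open>All fields are read as functions of one space-time point on a common open set
  \<open>W\<close> around \<open>I \<times> closure \<Omega>\<close>. There the exchange of time
  derivative and gradient is symmetry of second derivatives, and the balance is an identity between
  directional derivatives at a point. The equations hold in the open domain only, smoothness near
  its closure: the balance is used inside, while the flux still has boundary values. The flux comes
  from testing the phase equation with mu and the momentum equation with u; its term with d_t c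
  comes from varying the gradient energy in time. The geometric obstacle is that the boundary is
  only C^1: the slope of a chart is continuous and cannot be differentiated. After the shear it
  remains as a weight, which is harmless because it is constant along the axis over which one
  integrates. The surface measure is known only through its values on subsets of graphs, so its
  finiteness and all surface integrals have to be derived from these. The tangent frame may jump
  from point to point and is therefore used pointwise only.\<close>

abbreviation pd :: "'a::real_normed_vector \<Rightarrow> ('a \<Rightarrow> 'b::real_normed_vector) \<Rightarrow> 'a \<Rightarrow> 'b" where
  "pd v f x \<equiv> frechet_derivative f (at x) v"

lemma pd_eqI: "(f has_derivative f') (at x) \<Longrightarrow> pd v f x = f' v"
  using frechet_derivative_at by metis

lemma has_derivative_pd: "f differentiable (at x) \<Longrightarrow> (f has_derivative (\<lambda>v. pd v f x)) (at x)"
  by (simp add: frechet_derivative_works)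

lemma pd_cong_open:
  assumes "open W" "x \<in> W" "\<And>y. y \<in> W \<Longrightarrow> f y = g y" "f differentiable (at x)"
  shows "pd v f x = pd v g x"
  using frechet_derivative_transform_within_open[of f x W g] assms by simp

lemma differentiable_cong_open:
  assumes "open W" "x \<in> W" "\<And>y. y \<in> W \<Longrightarrow> f y = g y" "f differentiable (at x)"
  shows "g differentiable (at x)"
  using assms has_derivative_transform_within_open unfolding differentiable_def by metis

text \<open>Openness of \<open>W\<close> lets a pointwise equality pass to the derivatives. The
  closure rules below compute the derivative of a compound expression and substitute it through this
  lemma.\<close>

lemma Ck_on_cong:
  assumes "open W" "\<And>x. x \<in> W \<Longrightarrow> f x = g x" "Ck_on k W f"
  shows "Ck_on k W g"
  using assms(2,3)
proof (induction k arbitrary: f g)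
  case 0
  then show ?case using continuous_on_cong[of W W f g] by simp
next
  case (Suc k)
  have d: "f differentiable (at x)" if "x \<in> W" for x
    using Suc.prems(2) that by simp
  have "g differentiable (at x)" if "x \<in> W" for x
    using differentiable_cong_open[OF assms(1) that] Suc.prems(1) d[OF that] by blast
  moreover have "Ck_on k W (pd v g)" for v
  proof (rule Suc.IH)
    show "Ck_on k W (pd v f)" using Suc.prems(2) by simp
    show "pd v f x = pd v g x" if "x \<in> W" for x
      using pd_cong_open[OF assms(1) that] Suc.prems(1) d[OF that] by blast
  qed
  ultimately show ?case by simp
qed

lemma Ck_on_subset: "Ck_on k W f \<Longrightarrow> V \<subseteq> W \<Longrightarrow> Ck_on k V f"
  by (induction k arbitrary: f) (auto intro: continuous_on_subset)

text \<open>Regularity on open sets is local; this glues a localised function to its extension by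
  zero in the divergence theorem.\<close>

lemma Ck_on_Un:
  assumes "open A" "open B"
  shows "Ck_on k A f \<Longrightarrow> Ck_on k B f \<Longrightarrow> Ck_on k (A \<union> B) f"
  by (induction k arbitrary: f) (auto intro: continuous_on_open_Un assms)

lemma Ck_on_Suc_imp: "Ck_on (Suc k) W f \<Longrightarrow> Ck_on k W f"
proof (induction k arbitrary: f)
  case 0
  then show ?case
    by (auto intro!: continuous_at_imp_continuous_on differentiable_imp_continuous_within)
next
  case (Suc k)
  then show ?case by simp
qed

lemma Ck_on_imp_continuous_on: "Ck_on k W f \<Longrightarrow> continuous_on W f"
  by (induction k) (use Ck_on_Suc_imp in auto)

lemma Ck_on_imp_differentiable: "Ck_on k W f \<Longrightarrow> 0 < k \<Longrightarrow> x \<in> W \<Longrightarrow> f differentiable (at x)"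
  by (cases k) auto

lemma Ck_on_const: "Ck_on k W (\<lambda>x. a)"
  by (induction k arbitrary: a) auto

lemma Ck_on_bounded_linear_comp:
  assumes "open W" "bounded_linear l"
  shows "Ck_on k W f \<Longrightarrow> Ck_on k W (\<lambda>x. l (f x))"
proof (induction k arbitrary: f)
  case 0
  then show ?case using assms(2) by (auto intro: bounded_linear.continuous_on)
next
  case (Suc k)
  have d: "((\<lambda>x. l (f x)) has_derivative (\<lambda>v. l (pd v f x))) (at x)" if "x \<in> W" for x
    using Suc.prems that by (intro bounded_linear.has_derivative[OF assms(2)] has_derivative_pd) simp
  have "Ck_on k W (pd v (\<lambda>x. l (f x)))" for v
    by (rule Ck_on_cong[OF assms(1) _ Suc.IH[of "pd v f"]]) (use Suc.prems pd_eqI[OF d] in auto)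
  then show ?case using d by (auto simp: differentiable_def)
qed

lemma Ck_on_add:
  assumes "open W"
  shows "Ck_on k W f \<Longrightarrow> Ck_on k W g \<Longrightarrow> Ck_on k W (\<lambda>x. f x + g x)"
proof (induction k arbitrary: f g)
  case 0
  then show ?case by (auto intro: continuous_on_add)
next
  case (Suc k)
  have d: "((\<lambda>x. f x + g x) has_derivative (\<lambda>v. pd v f x + pd v g x)) (at x)" if "x \<in> W" for x
    using Suc.prems that by (intro has_derivative_add has_derivative_pd) simp_all
  have "Ck_on k W (pd v (\<lambda>x. f x + g x))" for v
    by (rule Ck_on_cong[OF assms(1) _ Suc.IH[of "pd v f" "pd v g"]]) (use Suc.prems pd_eqI[OF d] in auto)
  then show ?case using d by (auto simp: differentiable_def)
qed

lemma Ck_on_mult: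
  fixes f g :: "'a::real_normed_vector \<Rightarrow> real"
  assumes "open W"
  shows "Ck_on k W f \<Longrightarrow> Ck_on k W g \<Longrightarrow> Ck_on k W (\<lambda>x. f x * g x)"
proof (induction k arbitrary: f g)
  case 0
  then show ?case by (auto intro: continuous_on_mult)
next
  case (Suc k)
  have d: "((\<lambda>x. f x * g x) has_derivative (\<lambda>v. f x * pd v g x + pd v f x * g x)) (at x)"
    if "x \<in> W" for x
    using Suc.prems that by (intro has_derivative_mult has_derivative_pd) simp_all
  \<comment> \<open>Each of the two products keeps one undifferentiated factor;
    \<open>Ck_on_Suc_imp\<close> lowers its order to that of the induction hypothesis.\<close>
  have "Ck_on k W (pd v (\<lambda>x. f x * g x))" for v
    by (rule Ck_on_cong[OF assms(1) _ Ck_on_add[OF assms Suc.IH[of f "pd v g"] Suc.IH[of "pd v f" g]]])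
       (use Suc.prems Ck_on_Suc_imp pd_eqI[OF d] in auto)
  then show ?case using d by (auto simp: differentiable_def)
qed

lemma Ck_on_uminus:
  assumes "open W" "Ck_on k W f"
  shows "Ck_on k W (\<lambda>x. - f x)"
  using Ck_on_bounded_linear_comp[OF assms(1) bounded_linear_minus[OF bounded_linear_ident] assms(2)] .

lemma Ck_on_diff:
  assumes "open W" "Ck_on k W f" "Ck_on k W g"
  shows "Ck_on k W (\<lambda>x. f x - g x)"
  using Ck_on_add[OF assms(1,2) Ck_on_uminus[OF assms(1,3)]] by simp

lemma Ck_on_sum:
  assumes "open W" "\<And>i. i \<in> A \<Longrightarrow> Ck_on k W (f i)"
  shows "Ck_on k W (\<lambda>x. \<Sum>i\<in>A. f i x)"
  using assms(2) by (induction A rule: infinite_finite_induct) (auto intro: Ck_on_const Ck_on_add assms)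

text \<open>The outer function is scalar, so the chain rule yields the product of
  \<open>pd 1 h (f x)\<close> and \<open>pd v f x\<close>. The induction replaces \<open>h\<close>
  by its derivative, and \<open>Ck_on_mult\<close> closes each stage.\<close>

lemma Ck_on_compose_real:
  fixes h :: "real \<Rightarrow> real" and f :: "'a::real_normed_vector \<Rightarrow> real"
  assumes "open W" "\<And>x. x \<in> W \<Longrightarrow> f x \<in> V"
  shows "Ck_on k V h \<Longrightarrow> Ck_on k W f \<Longrightarrow> Ck_on k W (\<lambda>x. h (f x))"
proof (induction k arbitrary: h)
  case 0
  then show ?case using assms(2) by (auto intro!: continuous_on_compose2[of V h W f])
next
  case (Suc k)
  have d: "((\<lambda>x. h (f x)) has_derivative (\<lambda>v. pd 1 h (f x) * pd v f x)) (at x)" if "x \<in> W" for x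
  proof -
    have "((\<lambda>x. h (f x)) has_derivative (\<lambda>v. pd (pd v f x) h (f x))) (at x)"
      using Suc.prems assms(2) that by (intro has_derivative_compose[OF has_derivative_pd has_derivative_pd]) auto
    moreover have "(\<lambda>v. pd (pd v f x) h (f x)) = (\<lambda>v. pd 1 h (f x) * pd v f x)"
    proof
      fix v
      show "pd (pd v f x) h (f x) = pd 1 h (f x) * pd v f x"
        using linear_frechet_derivative[of h "at (f x)"] Suc.prems(1) assms(2)[OF that]
        linear_scale[of "frechet_derivative h (at (f x))" "pd v f x" 1] by simp
    qed
    ultimately show ?thesis by (rule has_derivative_eq_rhs)
  qed
  have "Ck_on k W (pd v (\<lambda>x. h (f x)))" for v
    by (rule Ck_on_cong[OF assms(1) _ Ck_on_mult[OF assms(1) Suc.IH[of "pd 1 h"], of "pd v f"]])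
       (use Suc.prems Ck_on_Suc_imp pd_eqI[OF d] in auto)
  then show ?case using d by (auto simp: differentiable_def)
qed

text \<open>The derivative of \<open>inverse\<close> is a product of copies of
  \<open>inverse\<close>, so each order of regularity yields the next.\<close>

lemma Ck_on_inverse: "Ck_on k (- {0}) (inverse :: real \<Rightarrow> real)"
proof (induction k)
  case 0
  then show ?case by (auto intro: continuous_intros)
next
  case (Suc k)
  have d: "(inverse has_derivative (\<lambda>v. - (inverse x * v * inverse x))) (at x)"
    if "x \<noteq> (0::real)" for x
    using that by (rule has_derivative_inverse')
  have "Ck_on k (- {0}) (pd v (inverse :: real \<Rightarrow> real))" for v :: real
  proof (rule Ck_on_cong)
    show "Ck_on k (- {0}) (\<lambda>x::real. - (inverse x * v * inverse x))"
      by (intro Ck_on_uminus Ck_on_mult Suc.IH Ck_on_const) auto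
    show "- (inverse x * v * inverse x) = pd v inverse x" if "x \<in> - {0}" for x
      using pd_eqI[OF d] that by auto
  qed auto
  then show ?case using d by (auto simp: differentiable_def)
qed

lemma Ck_on_divide:
  fixes f g :: "'a::real_normed_vector \<Rightarrow> real"
  assumes "open W" "Ck_on k W f" "Ck_on k W g" "\<And>x. x \<in> W \<Longrightarrow> g x \<noteq> 0"
  shows "Ck_on k W (\<lambda>x. f x / g x)"
  unfolding divide_inverse
  by (intro Ck_on_mult assms Ck_on_compose_real[OF _ _ Ck_on_inverse]) (use assms in auto)

lemma Ck_on_power:
  fixes f :: "'a::real_normed_vector \<Rightarrow> real"
  assumes "open W" "Ck_on k W f"
  shows "Ck_on k W (\<lambda>x. f x ^ m)"
  by (induction m) (auto intro: Ck_on_const Ck_on_mult assms)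

section \<open>Symmetry of second derivatives\<close>

lemma line_has_real_derivative:
  fixes f :: "'a::real_normed_vector \<Rightarrow> real"
  assumes "f differentiable (at (q + s *\<^sub>R v))"
  shows "((\<lambda>s. f (q + s *\<^sub>R v)) has_real_derivative pd v f (q + s *\<^sub>R v)) (at s)"
proof -
  have "((\<lambda>s. f (q + s *\<^sub>R v)) has_derivative (\<lambda>r. pd (r *\<^sub>R v) f (q + s *\<^sub>R v))) (at s)"
    by (rule has_derivative_compose[where f = "\<lambda>s. q + s *\<^sub>R v" and f' = "\<lambda>r. r *\<^sub>R v"
          and g = f and g' = "frechet_derivative f (at (q + s *\<^sub>R v))"])
       (use has_derivative_pd[OF assms] in \<open>auto intro!: derivative_eq_intros\<close>)
  moreover have "pd (r *\<^sub>R v) f (q + s *\<^sub>R v) = pd v f (q + s *\<^sub>R v) * r" for r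
    using linear_scale[OF linear_frechet_derivative[OF assms], of r v] by (simp add: mult.commute)
  ultimately show ?thesis by (simp add: has_field_derivative_def)
qed

text \<open>The mean value theorem is used twice: along \<open>v\<close> for the difference of
  \<open>f\<close> across the step along \<open>w\<close>, then along \<open>w\<close> for
  \<open>pd v f\<close>.\<close>

lemma second_difference:
  fixes f :: "'a::real_normed_vector \<Rightarrow> real"
  assumes C2: "Ck_on (Suc (Suc 0)) (ball x r) f" and h: "0 < h" "h * (norm v + norm w) < r"
  obtains p where "dist p x \<le> h * (norm v + norm w)"
    "f (x + h *\<^sub>R v + h *\<^sub>R w) - f (x + h *\<^sub>R v) - f (x + h *\<^sub>R w) + f x = h\<^sup>2 * pd w (pd v f) p"
proof -
  have near: "dist (x + a *\<^sub>R v + b *\<^sub>R w) x \<le> h * (norm v + norm w)"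
    if "0 \<le> a" "a \<le> h" "0 \<le> b" "b \<le> h" for a b
  proof -
    have "norm (a *\<^sub>R v + b *\<^sub>R w) \<le> a * norm v + b * norm w"
      using that norm_triangle_ineq[of "a *\<^sub>R v" "b *\<^sub>R w"] by simp
    also have "\<dots> \<le> h * norm v + h * norm w"
      using that by (intro add_mono mult_right_mono) auto
    finally show ?thesis by (simp add: dist_norm algebra_simps)
  qed
  have inb: "x + a *\<^sub>R v + b *\<^sub>R w \<in> ball x r" if "0 \<le> a" "a \<le> h" "0 \<le> b" "b \<le> h" for a b
    using near[OF that] h(2) by (simp add: dist_commute)
  define g where "g s = f (x + h *\<^sub>R w + s *\<^sub>R v) - f (x + s *\<^sub>R v)" for s
  have "(g has_real_derivative pd v f (x + h *\<^sub>R w + s *\<^sub>R v) - pd v f (x + s *\<^sub>R v)) (at s)"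
    if "0 \<le> s" "s \<le> h" for s
    unfolding g_def using inb[of s h] inb[of s 0] that h(1) C2
    by (intro DERIV_diff line_has_real_derivative) (auto simp: algebra_simps)
  then obtain s where s: "0 < s" "s < h"
    "g h - g 0 = h * (pd v f (x + h *\<^sub>R w + s *\<^sub>R v) - pd v f (x + s *\<^sub>R v))"
    using MVT2[of 0 h g "\<lambda>s. pd v f (x + h *\<^sub>R w + s *\<^sub>R v) - pd v f (x + s *\<^sub>R v)"] h(1) by auto
  have "((\<lambda>b. pd v f (x + s *\<^sub>R v + b *\<^sub>R w)) has_real_derivative
      pd w (pd v f) (x + s *\<^sub>R v + b *\<^sub>R w)) (at b)" if "0 \<le> b" "b \<le> h" for b
    using inb[of s b] s that C2 by (intro line_has_real_derivative) auto
  then obtain b where b: "0 < b" "b < h" "pd v f (x + s *\<^sub>R v + h *\<^sub>R w) - pd v f (x + s *\<^sub>R v)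
      = h * pd w (pd v f) (x + s *\<^sub>R v + b *\<^sub>R w)"
    using MVT2[of 0 h "\<lambda>b. pd v f (x + s *\<^sub>R v + b *\<^sub>R w)"
      "\<lambda>b. pd w (pd v f) (x + s *\<^sub>R v + b *\<^sub>R w)"] h(1) by auto
  have "g h - g 0 = h\<^sup>2 * pd w (pd v f) (x + s *\<^sub>R v + b *\<^sub>R w)"
    using s(3) b(3) by (simp add: power2_eq_square add.commute add.left_commute)
  then show thesis
    using that[OF near[of s b]] s b by (simp add: g_def add.commute add.left_commute)
qed

text \<open>The second difference is symmetric in \<open>v\<close> and \<open>w\<close>. Dividing by
  the square of the step therefore gives equal mixed derivatives at two points that both tend to
  \<open>x\<close>, and continuity concludes.\<close>

theorem pd_commute:
  fixes f :: "'a::real_normed_vector \<Rightarrow> real"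
  assumes W: "open W" "x \<in> W" and C2: "Ck_on (Suc (Suc 0)) W f"
  shows "pd v (pd w f) x = pd w (pd v f) x"
proof -
  obtain r where r: "0 < r" "ball x r \<subseteq> W" using W openE by blast
  \<comment> \<open>The summand 1 keeps \<open>N\<close> positive even when both directions vanish;
    the offset \<open>m + 2\<close> below makes \<open>r / real (m + 2)\<close> smaller than
    \<open>r\<close> already for \<open>m = 0\<close>.\<close>
  define N where "N = norm v + norm w + 1"
  have N: "N > 0" by (simp add: N_def add_nonneg_pos)
  define h where "h m = r / (N * real (m + 2))" for m :: nat
  have h: "0 < h m" "h m * (norm v + norm w) < r" for m
  proof -
    show 0: "0 < h m" using r N by (simp add: h_def)
    have "h m * (norm v + norm w) \<le> h m * N" using 0 by (simp add: N_def)
    also have "\<dots> = r / real (m + 2)" using N by (simp add: h_def)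
    also have "\<dots> < r" using r by (simp add: divide_less_eq)
    finally show "h m * (norm v + norm w) < r" .
  qed
  have h0: "(\<lambda>m. h m * (norm v + norm w)) \<longlonglongrightarrow> 0"
  proof -
    have "(\<lambda>m. r / N * (norm v + norm w) * (1 / real (m + 2))) \<longlonglongrightarrow> r / N * (norm v + norm w) * 0"
      by (intro tendsto_intros LIMSEQ_ignore_initial_segment lim_1_over_n)
    then show ?thesis by (simp add: h_def mult.commute)
  qed
  have C2': "Ck_on (Suc (Suc 0)) (ball x r) f" using C2 r(2) Ck_on_subset by blast
  have "\<exists>p. dist p x \<le> h m * (norm v + norm w) \<and>
     f (x + h m *\<^sub>R v + h m *\<^sub>R w) - f (x + h m *\<^sub>R v) - f (x + h m *\<^sub>R w) + f x = (h m)\<^sup>2 * pd w (pd v f) p" for m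
    using second_difference[OF C2' h[of m]] by metis
  then obtain p where p: "\<And>m. dist (p m) x \<le> h m * (norm v + norm w)"
    "\<And>m. f (x + h m *\<^sub>R v + h m *\<^sub>R w) - f (x + h m *\<^sub>R v) - f (x + h m *\<^sub>R w) + f x = (h m)\<^sup>2 * pd w (pd v f) (p m)"
    by metis
  have "\<exists>p. dist p x \<le> h m * (norm w + norm v) \<and>
     f (x + h m *\<^sub>R w + h m *\<^sub>R v) - f (x + h m *\<^sub>R w) - f (x + h m *\<^sub>R v) + f x = (h m)\<^sup>2 * pd v (pd w f) p" for m
    using second_difference[OF C2' h(1)[of m], of w v] h(2)[of m] by (metis add.commute)
  then obtain q where q: "\<And>m. dist (q m) x \<le> h m * (norm w + norm v)"
    "\<And>m. f (x + h m *\<^sub>R w + h m *\<^sub>R v) - f (x + h m *\<^sub>R w) - f (x + h m *\<^sub>R v) + f x = (h m)\<^sup>2 * pd v (pd w f) (q m)"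
    by metis
  have eq: "pd w (pd v f) (p m) = pd v (pd w f) (q m)" for m
  proof -
    have "(h m)\<^sup>2 * pd w (pd v f) (p m) = (h m)\<^sup>2 * pd v (pd w f) (q m)"
      using p(2)[of m] q(2)[of m] by (simp add: algebra_simps)
    then show ?thesis using h(1)[of m] by simp
  qed
  have "p \<longlonglongrightarrow> x"
    by (subst tendsto_dist_iff, rule Lim_null_comparison[OF _ h0]) (use p(1) in simp)
  moreover have "q \<longlonglongrightarrow> x"
    by (subst tendsto_dist_iff, rule Lim_null_comparison[OF _ h0]) (use q(1) in \<open>simp add: add.commute\<close>)
  moreover have cont: "isCont (pd a (pd b f)) x" for a b
  proof -
    have "continuous_on W (pd a (pd b f))" using C2 by simp
    then show ?thesis using continuous_on_interior[of W "pd a (pd b f)" x] W by (simp add: interior_open)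
  qed
  ultimately have "(\<lambda>m. pd w (pd v f) (p m)) \<longlonglongrightarrow> pd w (pd v f) x"
    "(\<lambda>m. pd v (pd w f) (q m)) \<longlonglongrightarrow> pd v (pd w f) x"
    by (auto intro: isCont_tendsto_compose[OF cont])
  then show ?thesis unfolding eq by (metis LIMSEQ_unique)
qed


section \<open>Integrals depending on a parameter\<close>

text \<open>Boundedness comes from the compact \<open>K\<close>, finite measure from
  \<open>A\<close>. With \<open>K\<close> the closure of the domain this serves the open domain
  under Lebesgue measure and the boundary under surface measure.\<close>

lemma set_integrable_continuous_compact:
  fixes f :: "'a::metric_space \<Rightarrow> real"
  assumes M: "sets M = sets borel" "emeasure M A < \<infinity>" and A: "A \<in> sets borel" "A \<subseteq> K"
    and K: "compact K" and f: "continuous_on K f"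
  shows "set_integrable M A f"
proof -
  have "bounded (f ` K)" using compact_continuous_image[OF f K] compact_imp_bounded by blast
  then obtain B where B: "\<And>x. x \<in> K \<Longrightarrow> \<bar>f x\<bar> \<le> B" unfolding bounded_iff by auto
  have "(\<lambda>x. indicator A x *\<^sub>R f x) \<in> borel_measurable borel"
    using borel_measurable_continuous_on_indicator[OF A(1) continuous_on_subset[OF f A(2)]] .
  then have m: "(\<lambda>x. indicator A x *\<^sub>R f x) \<in> borel_measurable M"
    using measurable_cong_sets[OF M(1)] by blast
  show ?thesis unfolding set_integrable_def
    by (rule integrableI_bounded_set[OF _ m, of A B]) (use M A B in \<open>auto intro!: AE_I2\<close>)
qed

text \<open>Dominated convergence for difference quotients. The mean value inequality bounds them by
  the maximum of \<open>f'\<close> on a compact cylinder \<open>cball t e \<times> K\<close>, and a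
  constant is integrable because \<open>A\<close> has finite measure.\<close>

lemma has_real_derivative_set_lebesgue_integral:
  fixes f f' :: "real \<Rightarrow> 'a::metric_space \<Rightarrow> real"
  assumes M: "sets M = sets borel" "emeasure M A < \<infinity>" and A: "A \<in> sets borel" "A \<subseteq> K"
    and K: "compact K" and J: "open J" "t \<in> J"
    and f: "\<And>s. s \<in> J \<Longrightarrow> continuous_on K (f s)"
    and f': "continuous_on (J \<times> K) (\<lambda>(s, x). f' s x)"
    and der: "\<And>s x. s \<in> J \<Longrightarrow> x \<in> A \<Longrightarrow> ((\<lambda>s. f s x) has_real_derivative f' s x) (at s)"
  shows "((\<lambda>s. LINT x:A|M. f s x) has_real_derivative (LINT x:A|M. f' t x)) (at t)"
proof -
  obtain e where e: "0 < e" "cball t e \<subseteq> J" using J open_contains_cball by blast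
  have "compact (cball t e \<times> K)" using K by (simp add: compact_Times)
  moreover have "continuous_on (cball t e \<times> K) (\<lambda>(s, x). f' s x)"
    using f' by (rule continuous_on_subset) (use e in auto)
  ultimately have "bounded ((\<lambda>(s, x). f' s x) ` (cball t e \<times> K))"
    using compact_continuous_image compact_imp_bounded by blast
  then obtain B where "\<forall>y\<in>(\<lambda>(s, x). f' s x) ` (cball t e \<times> K). norm y \<le> B"
    unfolding bounded_iff by blast
  then have B: "\<bar>f' s x\<bar> \<le> B" if "s \<in> cball t e" "x \<in> K" for s x
    using that by fastforce
  have intf: "set_integrable M A (f s)" if "s \<in> J" for s
    by (rule set_integrable_continuous_compact[OF M A K f[OF that]])
  have slice: "continuous_on K (f' s)" if "s \<in> J" for s
  proof -
    have "continuous_on K (\<lambda>x. (\<lambda>(s, x). f' s x) (s, x))"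
      by (rule continuous_on_compose2[OF f']) (use that in \<open>auto intro!: continuous_intros\<close>)
    then show ?thesis by simp
  qed
  have intf': "set_integrable M A (f' s)" if "s \<in> J" for s
    by (rule set_integrable_continuous_compact[OF M A K slice[OF that]])
  define q where "q s x = (f s x - f t x) / (s - t)" for s x
  have qB: "\<bar>q s x\<bar> \<le> B" if "s \<in> ball t e - {t}" "x \<in> A" for s x
  proof -
    have "norm (f s x - f t x) \<le> B * norm (s - t)"
    proof (rule field_differentiable_bound[of "cball t e" "\<lambda>s. f s x" "\<lambda>s. f' s x"])
      show "((\<lambda>s. f s x) has_real_derivative f' z x) (at z within cball t e)" if "z \<in> cball t e" for z
        using der[of z x] e that \<open>x \<in> A\<close> by (blast intro: has_field_derivative_at_within)
    qed (use that B A e in \<open>auto simp: mem_ball\<close>)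
    then show ?thesis using that by (simp add: q_def abs_divide divide_le_eq)
  qed
  have q_int: "set_integrable M A (q s)" if "s \<in> ball t e" for s
    unfolding q_def using that e J by (intro set_integrable_divide set_integral_diff intf) auto
  \<comment> \<open>The limit is tested along sequences avoiding \<open>t\<close>, the form in which
    dominated convergence applies.\<close>
  have quot: "((\<lambda>s. LINT x:A|M. q s x) \<longlongrightarrow> (LINT x:A|M. f' t x)) (at t within ball t e)"
    unfolding tendsto_at_iff_sequentially comp_def
  proof (intro allI impI)
    fix X assume X: "\<forall>i. X i \<in> ball t e - {t}" "X \<longlonglongrightarrow> t"
    show "(\<lambda>i. LINT x:A|M. q (X i) x) \<longlonglongrightarrow> (LINT x:A|M. f' t x)"
      unfolding set_lebesgue_integral_def
    proof (rule integral_dominated_convergence[where w = "\<lambda>x. B * indicator A x"])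
      show "(\<lambda>x. indicator A x *\<^sub>R f' t x) \<in> borel_measurable M"
        using intf'[OF J(2)] unfolding set_integrable_def by simp
      show "(\<lambda>x. indicator A x *\<^sub>R q (X i) x) \<in> borel_measurable M" for i
        using q_int[of "X i"] X unfolding set_integrable_def by auto
      show "integrable M (\<lambda>x. B * indicator A x)"
        using M A by (intro integrable_mult_right integrable_real_indicator) auto
      have "(\<lambda>i. indicator A x *\<^sub>R q (X i) x) \<longlonglongrightarrow> indicator A x *\<^sub>R f' t x" for x
      proof (cases "x \<in> A")
        case True
        have "((\<lambda>s. q s x) \<longlongrightarrow> f' t x) (at t)"
          using der[OF J(2) True] unfolding q_def has_field_derivative_iff .
        then have "(\<lambda>i. q (X i) x) \<longlonglongrightarrow> f' t x"
          using X unfolding tendsto_at_iff_sequentially comp_def by blast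
        then show ?thesis using True by simp
      qed simp
      then show "AE x in M. (\<lambda>i. indicator A x *\<^sub>R q (X i) x) \<longlonglongrightarrow> indicator A x *\<^sub>R f' t x" by simp
      show "AE x in M. norm (indicator A x *\<^sub>R q (X i) x) \<le> B * indicator A x" for i
        using qB[of "X i"] X by (auto intro!: AE_I2 simp: indicator_def)
    qed
  qed
  have "((\<lambda>s. ((LINT x:A|M. f s x) - (LINT x:A|M. f t x)) / (s - t)) \<longlongrightarrow> (LINT x:A|M. f' t x))
    (at t within ball t e)"
  proof (rule Lim_transform_within[OF quot zero_less_one])
    fix s assume "s \<in> ball t e"
    then have "s \<in> J" using e by auto
    then show "(LINT x:A|M. q s x) = ((LINT x:A|M. f s x) - (LINT x:A|M. f t x)) / (s - t)"
      unfolding q_def by (simp add: set_integral_diff intf J)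
  qed
  then show ?thesis
    using e at_within_open[of t "ball t e"] by (simp add: has_field_derivative_iff)
qed


section \<open>Integration along one coordinate\<close>

text \<open>A point \<open>w\<close> of the product over \<open>UNIV - {k}\<close> carries no
  information at \<open>k\<close>; that entry is overwritten, so transverse coordinates and height
  together make a vector.\<close>

definition insert_coord :: "'n \<Rightarrow> real \<Rightarrow> ('n \<Rightarrow> real) \<Rightarrow> real^'n" where
  "insert_coord k y w = (\<chi> j. if j = k then y else w j)"

lemma insert_coord_nth [simp]: "insert_coord k y w $ j = (if j = k then y else w j)"
  by (simp add: insert_coord_def)

lemma insert_coord_add: "insert_coord k y w + a *\<^sub>R axis k 1 = insert_coord k (y + a) w"
  by (simp add: vec_eq_iff axis_def)

lemma graph_point_eq: "graph_point k g w = insert_coord k (g (insert_coord k 0 w)) w"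
  by (simp add: graph_point_def insert_coord_def)

lemma measurable_vec_lambda [measurable]:
  assumes "\<And>i. (\<lambda>x. f x i) \<in> borel_measurable N"
  shows "(\<lambda>x. (\<chi> i. f x i) :: real^'n) \<in> borel_measurable N"
  unfolding borel_measurable_euclidean_space[where 'c = "real^'n"]
proof
  fix b :: "real^'n" assume "b \<in> Basis"
  then obtain i where "b = axis i 1" by (auto simp: Basis_vec_def)
  then show "(\<lambda>x. (\<chi> i. f x i) \<bullet> b) \<in> borel_measurable N"
    using assms[of i] by (simp add: inner_axis)
qed

lemma measurable_insert_coord [measurable]:
  "(\<lambda>(w, y). insert_coord k y w :: real^'n) \<in> Pi\<^sub>M (UNIV - {k}) (\<lambda>_. lborel) \<Otimes>\<^sub>M lborel \<rightarrow>\<^sub>M borel"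
  unfolding insert_coord_def split_beta'
proof (rule measurable_vec_lambda)
  fix i
  show "(\<lambda>x. if i = k then snd x else fst x i)
      \<in> borel_measurable (Pi\<^sub>M (UNIV - {k}) (\<lambda>_. lborel :: real measure) \<Otimes>\<^sub>M (lborel :: real measure))"
  proof (cases "i = k")
    case False
    then have [measurable]: "(\<lambda>w. w i) \<in> borel_measurable (Pi\<^sub>M (UNIV - {k}) (\<lambda>_. lborel :: real measure))"
      using measurable_component_singleton[of i "UNIV - {k}" "\<lambda>_. lborel :: real measure"] by simp
    show ?thesis using False by simp
  qed simp
qed

lemma measurable_insert_coord' [measurable]:
  "insert_coord k y \<in> Pi\<^sub>M (UNIV - {k}) (\<lambda>_. lborel) \<rightarrow>\<^sub>M (borel :: (real^'n) measure)"
proof -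
  have "(\<lambda>w. (\<lambda>(w, y). insert_coord k y w :: real^'n) (w, y)) \<in> Pi\<^sub>M (UNIV - {k}) (\<lambda>_. lborel) \<rightarrow>\<^sub>M borel"
    by (rule measurable_compose[OF measurable_Pair2' measurable_insert_coord]) simp
  then show ?thesis by simp
qed

text \<open>Lebesgue measure is characterised by its values on boxes, and the preimage of a box is a
  product of intervals.\<close>

lemma lborel_eq_distr_PiM:
  "(lborel :: (real^'n) measure) = distr (Pi\<^sub>M UNIV (\<lambda>_. lborel)) borel (\<lambda>w. \<chi> i. w i)"
proof (rule lborel_eqI)
  interpret product_sigma_finite "\<lambda>_::'n. lborel :: real measure" ..
  fix l r :: "real^'n" assume le: "\<And>b. b \<in> Basis \<Longrightarrow> l \<bullet> b \<le> r \<bullet> b"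
  have lei: "l $ i \<le> r $ i" for i using le[of "axis i 1"] by (simp add: inner_axis)
  have [measurable]: "(\<lambda>w. \<chi> i. w i) \<in> Pi\<^sub>M UNIV (\<lambda>_. lborel) \<rightarrow>\<^sub>M (borel :: (real^'n) measure)"
    by (rule measurable_vec_lambda) measurable
  have "emeasure (distr (Pi\<^sub>M UNIV (\<lambda>_. lborel)) borel (\<lambda>w. \<chi> i. w i)) (box l r)
      = emeasure (Pi\<^sub>M UNIV (\<lambda>_. lborel)) (Pi\<^sub>E UNIV (\<lambda>i. {l $ i <..< r $ i}))"
    by (subst emeasure_distr)
       (auto intro!: arg_cong[where f = "emeasure _"] simp: mem_box_cart space_PiM PiE_def Pi_def)
  also have "\<dots> = (\<Prod>i\<in>UNIV. emeasure lborel {l $ i <..< r $ i})"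
    by (rule emeasure_PiM) auto
  also have "\<dots> = (\<Prod>i\<in>UNIV. ennreal ((r - l) $ i))"
    using lei by simp
  also have "\<dots> = ennreal (\<Prod>i\<in>UNIV. (r - l) $ i)"
    using lei by (intro prod_ennreal) simp
  also have "(\<Prod>i\<in>UNIV. (r - l) $ i) = (\<Prod>b\<in>Basis. (r - l) \<bullet> b)"
  proof -
    have B: "(Basis :: (real^'n) set) = range (\<lambda>i. axis i 1)" by (auto simp: Basis_vec_def)
    have inj: "inj (\<lambda>i. axis i 1 :: real^'n)" by (auto simp: inj_on_def axis_eq_axis)
    show ?thesis unfolding B prod.reindex[OF inj] by (simp add: inner_axis)
  qed
  finally show "emeasure (distr (Pi\<^sub>M UNIV (\<lambda>_. lborel)) borel (\<lambda>w. \<chi> i. w i)) (box l r)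
    = (\<Prod>b\<in>Basis. (r - l) \<bullet> b)" .
qed simp

lemma fun_upd_eq_insert_coord: "(\<chi> i. (w(k := y)) i) = insert_coord k y w"
  by (simp add: vec_eq_iff)

lemma nn_integral_insert_coord:
  fixes f :: "real^'n \<Rightarrow> ennreal"
  assumes [measurable]: "f \<in> borel_measurable borel"
  shows "(\<integral>\<^sup>+x. f x \<partial>lborel) = (\<integral>\<^sup>+w. \<integral>\<^sup>+y. f (insert_coord k y w) \<partial>lborel \<partial>(Pi\<^sub>M (UNIV - {k}) (\<lambda>_. lborel)))"
proof -
  interpret product_sigma_finite "\<lambda>_::'n. lborel :: real measure" ..
  have m [measurable]: "(\<lambda>w. \<chi> i. w i) \<in> Pi\<^sub>M UNIV (\<lambda>_. lborel) \<rightarrow>\<^sub>M (borel :: (real^'n) measure)"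
    by (rule measurable_vec_lambda) measurable
  have U: "insert k (UNIV - {k}) = UNIV" by auto
  have "(\<integral>\<^sup>+x. f x \<partial>lborel) = (\<integral>\<^sup>+w. f (\<chi> i. w i) \<partial>(Pi\<^sub>M (insert k (UNIV - {k})) (\<lambda>_. lborel)))"
    unfolding U by (subst lborel_eq_distr_PiM, subst nn_integral_distr) auto
  also have "\<dots> = (\<integral>\<^sup>+w. \<integral>\<^sup>+y. f (\<chi> i. (w(k := y)) i) \<partial>lborel \<partial>(Pi\<^sub>M (UNIV - {k}) (\<lambda>_. lborel)))"
    by (rule product_nn_integral_insert) (auto simp: U)
  finally show ?thesis unfolding fun_upd_eq_insert_coord .
qed

lemma integral_insert_coord:
  fixes f :: "real^'n \<Rightarrow> real"
  assumes "integrable lborel f"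
  shows "(\<integral>x. f x \<partial>lborel) = (\<integral>w. \<integral>y. f (insert_coord k y w) \<partial>lborel \<partial>(Pi\<^sub>M (UNIV - {k}) (\<lambda>_. lborel)))"
proof -
  interpret product_sigma_finite "\<lambda>_::'n. lborel :: real measure" ..
  have [measurable]: "f \<in> borel_measurable borel" using assms by auto
  have m [measurable]: "(\<lambda>w. \<chi> i. w i) \<in> Pi\<^sub>M UNIV (\<lambda>_. lborel) \<rightarrow>\<^sub>M (borel :: (real^'n) measure)"
    by (rule measurable_vec_lambda) measurable
  have U: "insert k (UNIV - {k}) = UNIV" by auto
  have "integrable (distr (Pi\<^sub>M UNIV (\<lambda>_. lborel)) borel (\<lambda>w. \<chi> i. w i)) f"
    using assms lborel_eq_distr_PiM[where 'n = 'n] by simp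
  then have int: "integrable (Pi\<^sub>M (insert k (UNIV - {k})) (\<lambda>_. lborel)) (\<lambda>w. f (\<chi> i. w i))"
    unfolding U by (rule integrable_distr[OF m])
  have "(\<integral>x. f x \<partial>lborel) = (\<integral>w. f (\<chi> i. w i) \<partial>(Pi\<^sub>M (insert k (UNIV - {k})) (\<lambda>_. lborel)))"
    unfolding U by (subst lborel_eq_distr_PiM, subst integral_distr) auto
  also have "\<dots> = (\<integral>w. \<integral>y. f (\<chi> i. (w(k := y)) i) \<partial>lborel \<partial>(Pi\<^sub>M (UNIV - {k}) (\<lambda>_. lborel)))"
    by (rule product_integral_insert[OF _ _ int]) auto
  finally show ?thesis unfolding fun_upd_eq_insert_coord .
qed

text \<open>Since \<open>\<phi>\<close> is constant along the axis \<open>k\<close>, the map is a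
  translation on every line parallel to that axis. Fubini reduces the claim to translation
  invariance on the real line.\<close>

lemma distr_lborel_shear:
  fixes \<phi> :: "real^'n \<Rightarrow> real"
  assumes [measurable]: "\<phi> \<in> borel_measurable borel"
    and indep: "\<And>x a. \<phi> (x + a *\<^sub>R axis k 1) = \<phi> x"
  shows "distr lborel borel (\<lambda>x. x + \<phi> x *\<^sub>R axis k 1) = lborel"
proof (rule measure_eqI)
  fix A assume "A \<in> sets (distr lborel borel (\<lambda>x. x + \<phi> x *\<^sub>R axis k 1))"
  then have [measurable]: "A \<in> sets borel" by simp
  have eq: "insert_coord k y w + \<phi> (insert_coord k y w) *\<^sub>R axis k 1
      = insert_coord k (\<phi> (insert_coord k 0 w) + y) w" for y w
    using indep[of "insert_coord k 0 w" y] insert_coord_add[of k 0 w y]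
    by (simp add: insert_coord_add add.commute)
  have [measurable]: "(\<lambda>y. insert_coord k y w) \<in> borel_measurable borel" for w :: "'n \<Rightarrow> real"
    unfolding insert_coord_def by (rule measurable_vec_lambda) auto
  have "emeasure (distr lborel borel (\<lambda>x. x + \<phi> x *\<^sub>R axis k 1)) A
      = (\<integral>\<^sup>+x. indicator A (x + \<phi> x *\<^sub>R axis k 1) \<partial>lborel)"
    by (subst nn_integral_indicator[symmetric], simp, subst nn_integral_distr) auto
  also have "\<dots> = (\<integral>\<^sup>+w. \<integral>\<^sup>+y. indicator A (insert_coord k (\<phi> (insert_coord k 0 w) + y) w) \<partial>lborel
      \<partial>(Pi\<^sub>M (UNIV - {k}) (\<lambda>_. lborel)))"
    by (subst nn_integral_insert_coord[where k = k]) (auto simp: eq)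
  also have "\<dots> = (\<integral>\<^sup>+w. \<integral>\<^sup>+y. indicator A (insert_coord k y w) \<partial>lborel
      \<partial>(Pi\<^sub>M (UNIV - {k}) (\<lambda>_. lborel)))"
  proof (rule nn_integral_cong)
    fix w
    show "(\<integral>\<^sup>+y. indicator A (insert_coord k (\<phi> (insert_coord k 0 w) + y) w) \<partial>lborel)
        = (\<integral>\<^sup>+y. indicator A (insert_coord k y w) \<partial>lborel)"
      using nn_integral_real_affine[of "\<lambda>y. indicator A (insert_coord k y w)" 1 "\<phi> (insert_coord k 0 w)"]
      by simp
  qed
  also have "\<dots> = (\<integral>\<^sup>+x. indicator A x \<partial>lborel)"
    by (rule nn_integral_insert_coord[symmetric]) simp
  finally show "emeasure (distr lborel borel (\<lambda>x. x + \<phi> x *\<^sub>R axis k 1)) A = emeasure lborel A"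
    by simp
qed simp

text \<open>The sign \<open>s\<close> selects the ray to the right or to the left of
  \<open>a\<close>. As \<open>h\<close> vanishes far out, the ray can be cut to a compact interval,
  where the fundamental theorem applies.\<close>

lemma integral_deriv_halfline:
  fixes h h' :: "real \<Rightarrow> real"
  assumes der: "\<And>y. (h has_real_derivative h' y) (at y)" and cont: "continuous_on UNIV h'"
    and supp: "\<And>y. R < \<bar>y\<bar> \<Longrightarrow> h y = 0" and s: "s \<in> {1, -1}"
  shows "(\<integral>y. indicator {y. s * y > s * a} y * h' y \<partial>lborel) = - (s * h a)"
proof -
  \<comment> \<open>Larger than \<open>\<bar>a\<bar>\<close> and \<open>R\<close>, so that
    \<open>a\<close> lies between \<open>-b\<close> and \<open>b\<close> and \<open>h\<close>
    vanishes at both of them.\<close>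
  define b where "b = \<bar>a\<bar> + \<bar>R\<bar> + 1"
  have b: "- b < a" "a < b" "R < b" "b > 0" by (auto simp: b_def)
  \<comment> \<open>The set of such \<open>y\<close> is open, so \<open>h\<close> agrees with zero
    near each of them.\<close>
  have h'0: "h' y = 0" if "R < \<bar>y\<bar>" for y
  proof -
    have "open {y. R < \<bar>y\<bar>}" by (intro open_Collect_less continuous_intros)
    then have "((\<lambda>_. 0) has_real_derivative h' y) (at y)"
      using has_field_derivative_transform_within_open[OF der[of y], of "{y. R < \<bar>y\<bar>}" "\<lambda>_. 0"] supp that by simp
    then show ?thesis using DERIV_unique DERIV_const by blast
  qed
  have hb: "h b = 0" "h (- b) = 0" using supp b by auto
  have cont': "isCont h' y" for y using cont continuous_on_eq_continuous_at by blast
  have [measurable]: "h' \<in> borel_measurable borel" using cont by (rule borel_measurable_continuous_onI)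
  have "AE y in lborel. y \<noteq> a" by (rule AE_lborel_singleton)
  from s consider "s = 1" | "s = -1" by auto
  then show ?thesis
  proof cases
    case 1
    have "(\<integral>y. indicator {y. s * y > s * a} y * h' y \<partial>lborel) = (\<integral>y. h' y * indicator {a..b} y \<partial>lborel)"
    proof (rule integral_cong_AE)
      \<comment> \<open>The ray is open and the interval closed; they differ at the endpoint
        \<open>a\<close>, a null set, and beyond \<open>b\<close>, where \<open>h'\<close> is
        zero.\<close>
      show "AE y in lborel. indicator {y. s * y > s * a} y * h' y = h' y * indicator {a..b} y"
        using AE_lborel_singleton[of a] by eventually_elim (use 1 b h'0 in \<open>force simp: indicator_def\<close>)
    qed auto
    also have "\<dots> = h b - h a"
      using b by (intro integral_FTC_Icc_real[OF _ der cont']) auto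
    finally show ?thesis using 1 hb by simp
  next
    case 2
    have "(\<integral>y. indicator {y. s * y > s * a} y * h' y \<partial>lborel) = (\<integral>y. h' y * indicator {-b..a} y \<partial>lborel)"
    proof (rule integral_cong_AE)
      show "AE y in lborel. indicator {y. s * y > s * a} y * h' y = h' y * indicator {-b..a} y"
        using AE_lborel_singleton[of a] by eventually_elim (use 2 b h'0 in \<open>force simp: indicator_def\<close>)
    qed auto
    also have "\<dots> = h a - h (-b)"
      using b by (intro integral_FTC_Icc_real[OF _ der cont']) auto
    finally show ?thesis using 2 hb by simp
  qed
qed

text \<open>A half-line that starts to the left of the support already carries the whole
  integral.\<close>

lemma integral_deriv_line:
  fixes h h' :: "real \<Rightarrow> real"
  assumes der: "\<And>y. (h has_real_derivative h' y) (at y)" and cont: "continuous_on UNIV h'"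
    and supp: "\<And>y. R < \<bar>y\<bar> \<Longrightarrow> h y = 0"
  shows "(\<integral>y. h' y \<partial>lborel) = 0"
proof -
  define b where "b = \<bar>R\<bar> + 1"
  have h'0: "h' y = 0" if "\<not> - b < y" for y
  proof -
    have "open {y. R < \<bar>y\<bar>}" by (intro open_Collect_less continuous_intros)
    moreover have "R < \<bar>y\<bar>" using that by (auto simp: b_def)
    ultimately have "((\<lambda>_. 0) has_real_derivative h' y) (at y)"
      using has_field_derivative_transform_within_open[OF der[of y], of "{y. R < \<bar>y\<bar>}" "\<lambda>_. 0"] supp by simp
    then show ?thesis using DERIV_unique DERIV_const by blast
  qed
  have "(\<integral>y. h' y \<partial>lborel) = (\<integral>y. indicator {y. 1 * y > 1 * (-b)} y * h' y \<partial>lborel)"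
    by (rule Bochner_Integration.integral_cong) (use h'0 in \<open>auto simp: indicator_def\<close>)
  also have "\<dots> = - (1 * h (-b))"
    by (rule integral_deriv_halfline[OF der cont supp]) auto
  also have "h (-b) = 0" using supp by (auto simp: b_def)
  finally show ?thesis by simp
qed


lemma integrable_indicator_compact_support:
  fixes g :: "'a::euclidean_space \<Rightarrow> real"
  assumes "continuous_on UNIV g" "compact K" "\<And>x. x \<notin> K \<Longrightarrow> g x = 0" "H \<in> sets borel"
  shows "integrable lborel (\<lambda>x. indicator H x * g x)"
proof -
  have K: "K \<in> sets borel" using assms(2) by (simp add: borel_compact)
  have "emeasure lborel (K \<inter> H) \<le> emeasure lborel K" using K by (intro emeasure_mono) auto
  also have "\<dots> < \<infinity>" using emeasure_compact_finite[OF assms(2)] by simp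
  finally have "set_integrable lborel (K \<inter> H) g"
    using K assms by (intro set_integrable_continuous_compact[where K = K]) (auto intro: continuous_on_subset)
  moreover have eq: "indicator (K \<inter> H) x *\<^sub>R g x = indicator H x * g x" for x
    using assms(3)[of x] by (auto simp: indicator_def)
  ultimately show ?thesis by (simp only: set_integrable_def eq)
qed

lemma pd_eq_0_off_support:
  assumes "closed K" "\<And>x. x \<notin> K \<Longrightarrow> f x = 0" "x \<notin> K"
  shows "pd v f x = 0"
  using pd_cong_open[of "- K" x "\<lambda>_. 0" f v] assms by (auto simp: open_Compl)

section \<open>Compactly supported C^1 functions on half-spaces\<close>

context
  fixes f :: "real^'n \<Rightarrow> real" and K :: "(real^'n) set"
  assumes f: "Ck_on (Suc 0) UNIV f" and K: "compact K" and f0: "\<And>x. x \<notin> K \<Longrightarrow> f x = 0"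
begin

lemma coord_line:
  obtains R where "\<And>y w. ((\<lambda>y. f (insert_coord i y w)) has_real_derivative pd (axis i 1) f (insert_coord i y w)) (at y)"
    "\<And>w. continuous_on UNIV (\<lambda>y. pd (axis i 1) f (insert_coord i y w))"
    "\<And>y w. R < \<bar>y\<bar> \<Longrightarrow> f (insert_coord i y w) = 0"
proof -
  obtain R where R: "\<And>x. x \<in> K \<Longrightarrow> norm x \<le> R"
    using compact_imp_bounded[OF K] unfolding bounded_iff by blast
  show thesis
  proof (rule that[of R])
    show "((\<lambda>y. f (insert_coord i y w)) has_real_derivative pd (axis i 1) f (insert_coord i y w)) (at y)" for y w
    proof -
      have "((\<lambda>y. f (insert_coord i 0 w + y *\<^sub>R axis i 1)) has_real_derivative
          pd (axis i 1) f (insert_coord i 0 w + y *\<^sub>R axis i 1)) (at y)"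
        using f by (intro line_has_real_derivative) simp
      then show ?thesis by (simp add: insert_coord_add)
    qed
    show "continuous_on UNIV (\<lambda>y. pd (axis i 1) f (insert_coord i y w))" for w
    proof (rule continuous_on_compose2[of UNIV "pd (axis i 1) f"])
      have "continuous_on UNIV (\<lambda>y. insert_coord i 0 w + y *\<^sub>R axis i 1)" by (intro continuous_intros)
      then show "continuous_on UNIV (\<lambda>y. insert_coord i y w)" by (simp add: insert_coord_add)
    qed (use f in auto)
    show "f (insert_coord i y w) = 0" if "R < \<bar>y\<bar>" for y w
    proof (rule f0)
      have "\<bar>y\<bar> \<le> norm (insert_coord i y w)" using component_le_norm_cart[of "insert_coord i y w" i] by simp
      then show "insert_coord i y w \<notin> K" using R[of "insert_coord i y w"] that by auto
    qed
  qed
qed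

lemma integrable_pd:
  assumes "continuous_on UNIV q" "H \<in> sets borel"
  shows "integrable lborel (\<lambda>x. indicator H x * (q x * pd v f x))"
proof (rule integrable_indicator_compact_support[OF _ K _ assms(2)])
  show "continuous_on UNIV (\<lambda>x. q x * pd v f x)"
    using f assms by (intro continuous_on_mult) auto
  show "q x * pd v f x = 0" if "x \<notin> K" for x
    using pd_eq_0_off_support[of K f x v] f0 that compact_imp_closed[OF K] by auto
qed

text \<open>The weight \<open>q\<close> stands for a slope of the chart, which is continuous but in
  general not differentiable. Being constant along the axis \<open>k\<close>, it leaves the inner
  one-dimensional integral as a factor.\<close>

lemma halfspace_integral_normal:
  assumes q: "continuous_on UNIV q" "\<And>x a. q (x + a *\<^sub>R axis k 1) = q x" and s: "s \<in> {1, -1}"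
  shows "(\<integral>x. indicator {x. s * x $ k > 0} x * (q x * pd (axis k 1) f x) \<partial>lborel)
    = - s * (\<integral>w. q (insert_coord k 0 w) * f (insert_coord k 0 w) \<partial>(Pi\<^sub>M (UNIV - {k}) (\<lambda>_. lborel)))"
proof -
  obtain R where R: "\<And>y w. ((\<lambda>y. f (insert_coord k y w)) has_real_derivative pd (axis k 1) f (insert_coord k y w)) (at y)"
    "\<And>w. continuous_on UNIV (\<lambda>y. pd (axis k 1) f (insert_coord k y w))"
    "\<And>y w. R < \<bar>y\<bar> \<Longrightarrow> f (insert_coord k y w) = 0"
    using coord_line[of k] by blast
  have q': "q (insert_coord k y w) = q (insert_coord k 0 w)" for y w
    using q(2)[of "insert_coord k 0 w" y] by (simp add: insert_coord_add)
  have "open {x::real^'n. s * x $ k > 0}" by (intro open_Collect_less continuous_intros)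
  then have "integrable lborel (\<lambda>x. indicator {x. s * x $ k > 0} x * (q x * pd (axis k 1) f x))"
    by (intro integrable_pd q(1)) simp
  then have "(\<integral>x. indicator {x. s * x $ k > 0} x * (q x * pd (axis k 1) f x) \<partial>lborel)
    = (\<integral>w. \<integral>y. indicator {x. s * x $ k > 0} (insert_coord k y w) *
          (q (insert_coord k y w) * pd (axis k 1) f (insert_coord k y w)) \<partial>lborel \<partial>(Pi\<^sub>M (UNIV - {k}) (\<lambda>_. lborel)))"
    by (rule integral_insert_coord)
  also have "\<dots> = (\<integral>w. - s * (q (insert_coord k 0 w) * f (insert_coord k 0 w)) \<partial>(Pi\<^sub>M (UNIV - {k}) (\<lambda>_. lborel)))"
  proof (rule Bochner_Integration.integral_cong[OF refl])
    fix w
    define r where "r = q (insert_coord k 0 w)"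
    have r: "q (insert_coord k y w) = r" for y unfolding r_def by (rule q')
    have "(\<integral>y. indicator {x. s * x $ k > 0} (insert_coord k y w) *
          (q (insert_coord k y w) * pd (axis k 1) f (insert_coord k y w)) \<partial>lborel)
        = (\<integral>y. r * (indicator {y. s * y > s * 0} y * pd (axis k 1) f (insert_coord k y w)) \<partial>lborel)"
      by (rule Bochner_Integration.integral_cong) (auto simp: r indicator_def)
    also have "\<dots> = r * - (s * f (insert_coord k 0 w))"
      using integral_deriv_halfline[where a = 0, OF R(1)[of w] R(2)[of w] R(3)[of _ w] s] by simp
    finally show "(\<integral>y. indicator {x. s * x $ k > 0} (insert_coord k y w) *
          (q (insert_coord k y w) * pd (axis k 1) f (insert_coord k y w)) \<partial>lborel)
      = - s * (q (insert_coord k 0 w) * f (insert_coord k 0 w))" by (simp add: r_def)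
  qed
  finally show ?thesis by simp
qed

text \<open>A line along a tangential axis lies entirely inside or entirely outside the half-space,
  so only whole-line integrals of derivatives of compactly supported functions occur.\<close>

lemma halfspace_integral_tangential:
  assumes "i \<noteq> k"
  shows "(\<integral>x. indicator {x. s * x $ k > 0} x * pd (axis i 1) f x \<partial>lborel) = 0"
proof -
  obtain R where R: "\<And>y w. ((\<lambda>y. f (insert_coord i y w)) has_real_derivative pd (axis i 1) f (insert_coord i y w)) (at y)"
    "\<And>w. continuous_on UNIV (\<lambda>y. pd (axis i 1) f (insert_coord i y w))"
    "\<And>y w. R < \<bar>y\<bar> \<Longrightarrow> f (insert_coord i y w) = 0"
    using coord_line[of i] by blast
  have "open {x::real^'n. s * x $ k > 0}" by (intro open_Collect_less continuous_intros)
  then have "integrable lborel (\<lambda>x. indicator {x. s * x $ k > 0} x * pd (axis i 1) f x)"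
    using integrable_pd[of "\<lambda>_. 1" "{x. s * x $ k > 0}" "axis i 1"] by simp
  then have "(\<integral>x. indicator {x. s * x $ k > 0} x * pd (axis i 1) f x \<partial>lborel)
    = (\<integral>w. \<integral>y. indicator {x. s * x $ k > 0} (insert_coord i y w) *
          pd (axis i 1) f (insert_coord i y w) \<partial>lborel \<partial>(Pi\<^sub>M (UNIV - {i}) (\<lambda>_. lborel)))"
    by (rule integral_insert_coord)
  also have "\<dots> = (\<integral>w. 0 \<partial>(Pi\<^sub>M (UNIV - {i}) (\<lambda>_. lborel :: real measure)))"
  proof (rule Bochner_Integration.integral_cong[OF refl])
    fix w
    have "(\<integral>y. indicator {x. s * x $ k > 0} (insert_coord i y w) * pd (axis i 1) f (insert_coord i y w) \<partial>lborel)
        = (\<integral>y. (if s * w k > 0 then 1 else 0) * pd (axis i 1) f (insert_coord i y w) \<partial>lborel)"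
      by (rule Bochner_Integration.integral_cong) (use assms in \<open>auto simp: indicator_def\<close>)
    also have "\<dots> = 0"
      using integral_deriv_line[OF R(1)[of w] R(2)[of w] R(3)[of _ w]] by simp
    finally show "(\<integral>y. indicator {x. s * x $ k > 0} (insert_coord i y w) * pd (axis i 1) f (insert_coord i y w) \<partial>lborel) = 0" .
  qed
  finally show ?thesis by simp
qed

lemma integral_pd_UNIV: "(\<integral>x. pd (axis i 1) f x \<partial>lborel) = 0"
proof -
  obtain R where R: "\<And>y w. ((\<lambda>y. f (insert_coord i y w)) has_real_derivative pd (axis i 1) f (insert_coord i y w)) (at y)"
    "\<And>w. continuous_on UNIV (\<lambda>y. pd (axis i 1) f (insert_coord i y w))"
    "\<And>y w. R < \<bar>y\<bar> \<Longrightarrow> f (insert_coord i y w) = 0"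
    using coord_line[of i] by blast
  have "integrable lborel (pd (axis i 1) f)"
    using integrable_pd[of "\<lambda>_. 1" UNIV "axis i 1"] by simp
  then have "(\<integral>x. pd (axis i 1) f x \<partial>lborel)
    = (\<integral>w. \<integral>y. pd (axis i 1) f (insert_coord i y w) \<partial>lborel \<partial>(Pi\<^sub>M (UNIV - {i}) (\<lambda>_. lborel)))"
    by (rule integral_insert_coord)
  moreover have "(\<integral>y. pd (axis i 1) f (insert_coord i y w) \<partial>lborel) = 0" for w
    by (rule integral_deriv_line[OF R(1)[of w] R(2)[of w] R(3)[of _ w]])
  ultimately show ?thesis by simp
qed

end

text \<open>Translation along the axis \<open>k\<close> leaves \<open>\<phi>\<close> fixed, hence
  also its differential. The slope at a graph point can thus be read off at height zero.\<close>

lemma pd_axis_indep: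
  assumes "\<And>x a. \<phi> (x + a *\<^sub>R axis k 1) = \<phi> x" "\<phi> differentiable (at x)"
  shows "pd v \<phi> (x + a *\<^sub>R axis k 1) = pd v \<phi> x"
proof (rule pd_eqI)
  have "((\<lambda>y. \<phi> (y - a *\<^sub>R axis k 1)) has_derivative frechet_derivative \<phi> (at x)) (at (x + a *\<^sub>R axis k 1))"
    by (rule has_derivative_compose[where g = \<phi> and f = "\<lambda>y. y - a *\<^sub>R axis k 1" and f' = "\<lambda>v. v"])
       (use has_derivative_pd[OF assms(2)] in \<open>auto intro!: derivative_eq_intros\<close>)
  moreover have "\<phi> (y - a *\<^sub>R axis k 1) = \<phi> y" for y
    using assms(1)[of "y - a *\<^sub>R axis k 1" a] by simp
  ultimately show "(\<phi> has_derivative frechet_derivative \<phi> (at x)) (at (x + a *\<^sub>R axis k 1))" by simp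
qed

lemma pd_axis_eq_0:
  assumes "\<And>x a. \<phi> (x + a *\<^sub>R axis k 1) = \<phi> x" "\<phi> differentiable (at x)"
  shows "pd (axis k 1) \<phi> x = (0::real)"
proof -
  have "((\<lambda>a. \<phi> (x + a *\<^sub>R axis k 1)) has_real_derivative pd (axis k 1) \<phi> (x + 0 *\<^sub>R axis k 1)) (at 0)"
    by (rule line_has_real_derivative) (use assms(2) in simp)
  then show ?thesis using DERIV_unique[OF _ DERIV_const] by (simp add: assms(1))
qed

text \<open>The shear \<open>x \<mapsto> x + \<phi> x e\<^sub>k\<close> straightens the graph \<open>x\<^sub>k = \<phi> x\<close> and preserves Lebesgue measure,
  which reduces the region on one side of a graph to a half-space.\<close>

lemma graph_region_integral:
  fixes f \<phi> :: "real^'n \<Rightarrow> real"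
  assumes f: "Ck_on (Suc 0) UNIV f" and K: "compact K" and f0: "\<And>x. x \<notin> K \<Longrightarrow> f x = 0"
    and \<phi>: "Ck_on (Suc 0) UNIV \<phi>" and indep: "\<And>x a. \<phi> (x + a *\<^sub>R axis k 1) = \<phi> x"
    and s: "s \<in> {1, -1}"
  shows "(\<integral>x. indicator {x. s * x $ k > s * \<phi> x} x * pd (axis i 1) f x \<partial>lborel)
    = s * (\<integral>w. (pd (axis i 1) \<phi> (graph_point k \<phi> w) - axis k 1 $ i) * f (graph_point k \<phi> w)
         \<partial>(Pi\<^sub>M (UNIV - {k}) (\<lambda>_. lborel)))"
proof -
  define T where "T x = x + \<phi> x *\<^sub>R axis k 1" for x :: "real^'n"
  define h where "h x = f (T x)" for x
  have \<phi>c: "continuous_on UNIV \<phi>" using \<phi> Ck_on_imp_continuous_on by blast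
  then have [measurable]: "\<phi> \<in> borel_measurable borel" by (rule borel_measurable_continuous_onI)
  have T[measurable]: "T \<in> borel_measurable borel" unfolding T_def by measurable
  have Tc: "continuous_on UNIV T" unfolding T_def by (intro continuous_intros \<phi>c)
  have \<phi>T: "\<phi> (T x) = \<phi> x" for x by (simp add: T_def indep)
  have dT: "(T has_derivative (\<lambda>v. v + pd v \<phi> x *\<^sub>R axis k 1)) (at x)" for x
    unfolding T_def using \<phi> by (auto intro!: derivative_eq_intros has_derivative_pd)
  have dh: "(h has_derivative (\<lambda>v. pd (v + pd v \<phi> x *\<^sub>R axis k 1) f (T x))) (at x)" for x
    unfolding h_def
    by (rule has_derivative_compose[where g = f and f = T and g' = "frechet_derivative f (at (T x))", OF dT])
       (use has_derivative_pd[of f] f in auto)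
  have lin: "pd (a + r *\<^sub>R b) f x = pd a f x + r * pd b f x" for a b x r
  proof -
    have "linear (frechet_derivative f (at x))" by (rule linear_frechet_derivative) (use f in simp)
    then show ?thesis by (simp add: linear_add linear_scale)
  qed
  have pdh: "pd v h x = pd v f (T x) + pd v \<phi> x * pd (axis k 1) f (T x)" for v x
    using pd_eqI[OF dh] lin by simp
  have hC1: "Ck_on (Suc 0) UNIV h"
  proof -
    have "continuous_on UNIV (pd v h)" for v
      unfolding pdh using f \<phi> Tc
      by (intro continuous_intros continuous_on_compose2[of UNIV "pd v f" UNIV T]
          continuous_on_compose2[of UNIV "pd (axis k 1) f" UNIV T]) auto
    then show ?thesis using dh by (auto simp: differentiable_def)
  qed
  \<comment> \<open>The inverse shear is continuous; it carries \<open>K\<close> to a compact set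
    outside of which \<open>h\<close> vanishes.\<close>
  have hK: "compact ((\<lambda>x. x - \<phi> x *\<^sub>R axis k 1) ` K)"
    by (intro compact_continuous_image K continuous_intros continuous_on_subset[OF \<phi>c]) auto
  have h0: "h x = 0" if "x \<notin> (\<lambda>x. x - \<phi> x *\<^sub>R axis k 1) ` K" for x
  proof -
    have "x = T x - \<phi> (T x) *\<^sub>R axis k 1" by (simp only: \<phi>T) (simp add: T_def)
    then have "T x \<notin> K" using that by blast
    then show ?thesis by (simp add: h_def f0)
  qed
  have pdk: "pd (axis k 1) \<phi> x = 0" for x
    by (rule pd_axis_eq_0[OF indep]) (use \<phi> in simp)
  have gp: "graph_point k \<phi> w = T (insert_coord k 0 w)" for w
    by (simp add: graph_point_eq T_def insert_coord_add)
  have hgp: "h (insert_coord k 0 w) = f (graph_point k \<phi> w)" for w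
    by (simp add: h_def gp)
  have pd_gp: "pd v \<phi> (graph_point k \<phi> w) = pd v \<phi> (insert_coord k 0 w)" for v w
    unfolding gp T_def by (rule pd_axis_indep[OF indep]) (use \<phi> in simp)
  have H: "open {x::real^'n. s * x $ k > 0}" by (intro open_Collect_less continuous_intros)
  have [measurable]: "pd (axis i 1) f \<in> borel_measurable borel"
    by (rule borel_measurable_continuous_onI) (use f in simp)
  have [measurable]: "{x. s * x $ k > s * \<phi> x} \<in> sets borel"
    by (intro borel_open open_Collect_less continuous_intros \<phi>c)
  have "(\<integral>x. indicator {x. s * x $ k > s * \<phi> x} x * pd (axis i 1) f x \<partial>lborel)
    = (\<integral>x. indicator {x. s * x $ k > s * \<phi> x} x * pd (axis i 1) f x \<partial>(distr lborel borel T))"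
    using distr_lborel_shear[of \<phi> k] indep unfolding T_def by simp
  also have "\<dots> = (\<integral>x. indicator {x. s * x $ k > s * \<phi> x} (T x) * pd (axis i 1) f (T x) \<partial>lborel)"
    by (rule integral_distr) auto
  \<comment> \<open>By \<open>pdh\<close> and \<open>pdk\<close>, the derivative of \<open>h\<close>
    along the axis \<open>k\<close> is that of \<open>f\<close> at \<open>T x\<close>. Solving
    \<open>pdh\<close> for the derivative of \<open>f\<close> along the axis \<open>i\<close> leaves
    a correction with the slope of \<open>\<phi>\<close> as weight.\<close>
  also have "\<dots> = (\<integral>x. indicator {x. s * x $ k > 0} x * pd (axis i 1) h x
      - indicator {x. s * x $ k > 0} x * (pd (axis i 1) \<phi> x * pd (axis k 1) h x) \<partial>lborel)"
  proof (rule Bochner_Integration.integral_cong[OF refl])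
    fix x
    have "T x $ k = x $ k + \<phi> x" by (simp add: T_def)
    then have "indicator {x. s * x $ k > s * \<phi> x} (T x) = (indicator {x. s * x $ k > 0} x :: real)"
      by (simp add: indicator_def \<phi>T distrib_left)
    then show "indicator {x. s * x $ k > s * \<phi> x} (T x) * pd (axis i 1) f (T x)
      = indicator {x. s * x $ k > 0} x * pd (axis i 1) h x
      - indicator {x. s * x $ k > 0} x * (pd (axis i 1) \<phi> x * pd (axis k 1) h x)"
      by (simp add: pdh pdk algebra_simps)
  qed
  also have "\<dots> = (\<integral>x. indicator {x. s * x $ k > 0} x * pd (axis i 1) h x \<partial>lborel)
      - (\<integral>x. indicator {x. s * x $ k > 0} x * (pd (axis i 1) \<phi> x * pd (axis k 1) h x) \<partial>lborel)"
    using integrable_pd[OF hC1 hK h0, of "\<lambda>_. 1" "{x. s * x $ k > 0}" "axis i 1"]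
      integrable_pd[OF hC1 hK h0, of "pd (axis i 1) \<phi>" "{x. s * x $ k > 0}" "axis k 1"] \<phi> H
    by (intro Bochner_Integration.integral_diff) auto
  also have "\<dots> = s * (\<integral>w. (pd (axis i 1) \<phi> (graph_point k \<phi> w) - axis k 1 $ i) * f (graph_point k \<phi> w)
         \<partial>(Pi\<^sub>M (UNIV - {k}) (\<lambda>_. lborel)))"
  \<comment> \<open>For \<open>i = k\<close> the slope vanishes and the first integral remains;
    otherwise the first integral is tangential and vanishes, and the second contributes the
    slope.\<close>
  proof (cases "i = k")
    case True
    then show ?thesis
      using halfspace_integral_normal[OF hC1 hK h0 _ _ s, of "\<lambda>_. 1" k]
      by (simp add: pdk hgp)
  next
    case False
    have q: "continuous_on UNIV (pd (axis i 1) \<phi>)" using \<phi> by simp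
    have "pd (axis i 1) \<phi> (x + a *\<^sub>R axis k 1) = pd (axis i 1) \<phi> x" for x a
      by (rule pd_axis_indep[OF indep]) (use \<phi> in simp)
    note halfspace_integral_normal[OF hC1 hK h0 q this s]
    moreover have "axis k (1::real) $ i = 0" using False by (simp add: axis_def)
    ultimately show ?thesis
      using halfspace_integral_tangential[OF hC1 hK h0 False, of s] by (simp add: pd_gp hgp)
  qed
  finally show ?thesis .
qed


section \<open>Boundary charts\<close>

lemma grad_nth: "grad f x $ i = pd (axis i 1) f x"
  by (simp add: grad_def)

lemma continuous_on_grad:
  assumes "Ck_on (Suc 0) W f"
  shows "continuous_on W (grad f)"
  unfolding grad_def using assms by (intro continuous_on_vec_lambda) auto

lemma graph_fun_C1: "graph_fun k g \<Longrightarrow> Ck_on (Suc 0) UNIV g"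
  by (simp add: graph_fun_def)

lemma graph_fun_axis:
  assumes "graph_fun k g"
  shows "g (x + a *\<^sub>R axis k 1) = g x"
proof -
  have "\<forall>i. i \<noteq> k \<longrightarrow> (x + a *\<^sub>R axis k 1) $ i = x $ i" by (simp add: axis_def)
  then show ?thesis using assms unfolding graph_fun_def by blast
qed

text \<open>A chart is written as \<open>s * x $ k > g x\<close>, the surface measure in terms of
  graphs \<open>x $ k = \<phi> x\<close>. As \<open>s\<close> is a sign,
  \<open>\<phi> = s * g\<close> translates between the two.\<close>

lemma graph_fun_scale:
  assumes "graph_fun k g"
  shows "graph_fun k (\<lambda>x. s * g x)"
proof -
  have "Ck_on (Suc 0) UNIV (\<lambda>x. s * g x)"
    using graph_fun_C1[OF assms] by (intro Ck_on_mult Ck_on_const) auto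
  then show ?thesis using assms unfolding graph_fun_def by auto
qed

lemma graph_point_nth: "graph_fun k \<phi> \<Longrightarrow> graph_point k \<phi> w $ k = \<phi> (graph_point k \<phi> w)"
  using graph_fun_axis[of k \<phi> "insert_coord k 0 w" "\<phi> (insert_coord k 0 w)"]
  by (simp add: graph_point_eq insert_coord_add)

lemma measurable_graph_point:
  assumes "graph_fun k \<phi>"
  shows "graph_point k \<phi> \<in> Pi\<^sub>M (UNIV - {k}) (\<lambda>_. lborel) \<rightarrow>\<^sub>M (borel :: (real^'n) measure)"
proof -
  have [measurable]: "\<phi> \<in> borel_measurable borel"
    using graph_fun_C1[OF assms] Ck_on_imp_continuous_on borel_measurable_continuous_onI by blast
  have "graph_point k \<phi> = (\<lambda>w. insert_coord k 0 w + \<phi> (insert_coord k 0 w) *\<^sub>R axis k 1)"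
    by (simp add: fun_eq_iff graph_point_eq insert_coord_add)
  then show ?thesis by simp
qed

text \<open>A point with \<open>s * x $ k < g x\<close> has a neighbourhood that misses
  \<open>\<Omega>\<close>. From a point of the graph, arbitrarily small steps along \<open>s\<close>
  times the axis \<open>k\<close> enter \<open>\<Omega>\<close>, because \<open>g\<close> does not
  change along that axis.\<close>

lemma frontier_chart:
  assumes "open \<Omega>" "domain_chart \<Omega> U k s g"
  shows "frontier \<Omega> \<inter> U = {x \<in> U. x $ k = s * g x}"
proof -
  have U: "open U" "graph_fun k g" "\<Omega> \<inter> U = {x \<in> U. s * x $ k > g x}" and s: "s = 1 \<or> s = -1"
    using assms(2) by (auto simp: domain_chart_def)
  have gc: "continuous_on UNIV g" using graph_fun_C1[OF U(2)] Ck_on_imp_continuous_on by blast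
  have eqv: "x $ k = s * g x \<longleftrightarrow> s * x $ k = g x" for x using s by auto
  have "s * x $ k = g x" if x: "x \<in> frontier \<Omega>" "x \<in> U" for x
  proof (rule ccontr)
    assume ne: "s * x $ k \<noteq> g x"
    have "x \<notin> \<Omega>" using x(1) assms(1) by (simp add: frontier_def interior_open)
    then have "x \<notin> {x \<in> U. s * x $ k > g x}" using U(3) by blast
    then have lt: "s * x $ k < g x" using x(2) ne by simp
    have "open ({y. s * y $ k < g y} \<inter> U)" by (intro open_Int U open_Collect_less continuous_intros gc)
    moreover have "x \<in> {y. s * y $ k < g y} \<inter> U" using lt x by simp
    moreover have "x \<in> closure \<Omega>" using x(1) by (simp add: frontier_def)
    ultimately have "\<Omega> \<inter> ({y. s * y $ k < g y} \<inter> U) \<noteq> {}"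
      unfolding closure_iff_nhds_not_empty by blast
    then obtain y where y: "y \<in> \<Omega>" "y \<in> U" "s * y $ k < g y" by blast
    then have "y \<in> {x \<in> U. s * x $ k > g x}" using U(3) by blast
    then show False using y(3) by simp
  qed
  moreover have "x \<in> frontier \<Omega>" if x: "x \<in> U" "s * x $ k = g x" for x
  proof -
    have "x \<notin> {x \<in> U. s * x $ k > g x}" using x(2) by simp
    then have "x \<notin> \<Omega>" using U(3) x(1) by blast
    moreover have "x \<in> closure \<Omega>"
    proof (unfold closure_approachable, intro allI impI)
      fix e :: real assume "0 < e"
      obtain r where r: "0 < r" "ball x r \<subseteq> U" using U(1) x(1) openE by blast
      define d where "d = min e r / 2"
      have d: "0 < d" "d < e" "d < r" using \<open>0 < e\<close> r by (auto simp: d_def)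
      define y where "y = x + (d * s) *\<^sub>R axis k 1"
      have "dist y x = d" using s d by (auto simp: y_def dist_norm)
      moreover have "y \<in> U"
      proof -
        have "y \<in> ball x r" using \<open>dist y x = d\<close> d(3) by (simp add: dist_commute)
        then show ?thesis using r(2) by blast
      qed
      moreover have "s * y $ k > g y"
      proof -
        have "g y = g x" unfolding y_def by (rule graph_fun_axis[OF U(2)])
        moreover have "s * y $ k = s * x $ k + d" using s by (auto simp: y_def algebra_simps)
        ultimately show ?thesis using x(2) d(1) by simp
      qed
      ultimately have "y \<in> \<Omega>" using U(3) by blast
      then show "\<exists>y\<in>\<Omega>. dist y x < e" using \<open>dist y x = d\<close> d(2) by blast
    qed
    ultimately show ?thesis using assms(1) by (simp add: frontier_def interior_open)
  qed
  ultimately show ?thesis using eqv by auto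
qed

text \<open>The outward normal expressed through \<open>\<phi> = s * g\<close>. Since
  \<open>\<phi>\<close> has no slope along the axis \<open>k\<close>, the square root is the length
  of \<open>grad \<phi> x - axis k 1\<close>; it is also the area factor of the surface measure,
  against which it will cancel.\<close>

definition chart_normal :: "'n \<Rightarrow> real \<Rightarrow> (real^'n \<Rightarrow> real) \<Rightarrow> real^'n \<Rightarrow> real^'n" where
  "chart_normal k s \<phi> x = (s / sqrt (1 + (norm (grad \<phi> x))\<^sup>2)) *\<^sub>R (grad \<phi> x - axis k 1)"

lemma area_pos: "0 < 1 + (norm x)\<^sup>2"
  by (rule add_pos_nonneg) auto

lemma continuous_on_chart_normal:
  assumes "graph_fun k \<phi>"
  shows "continuous_on UNIV (chart_normal k s \<phi>)"
proof -
  have "sqrt (1 + (norm v)\<^sup>2) \<noteq> 0" for v :: "real^'n"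
    using area_pos[of v] by simp
  then show ?thesis
    unfolding chart_normal_def
    by (intro continuous_intros continuous_on_grad graph_fun_C1[OF assms]) auto
qed

lemma norm_grad_minus_axis:
  assumes "graph_fun k \<phi>"
  shows "norm (grad \<phi> z - axis k 1) = sqrt (1 + (norm (grad \<phi> z))\<^sup>2)"
proof -
  have "pd (axis k 1) \<phi> z = 0"
    using graph_fun_axis[OF assms] graph_fun_C1[OF assms] by (intro pd_axis_eq_0) auto
  then have "grad \<phi> z \<bullet> axis k 1 = 0" by (simp add: inner_axis grad_nth)
  then have "(norm (grad \<phi> z - axis k 1))\<^sup>2 = 1 + (norm (grad \<phi> z))\<^sup>2"
    by (simp add: power2_norm_eq_inner inner_diff inner_commute)
  then show ?thesis using real_sqrt_unique by (metis norm_ge_zero)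
qed

lemma outward_unit_normal_chart:
  assumes n: "outward_unit_normal \<Omega> n" "z \<in> frontier \<Omega>" "z \<in> U" and ch: "domain_chart \<Omega> U k s g"
  shows "n z = chart_normal k s (\<lambda>x. s * g x) z"
proof -
  have gf: "graph_fun k g" and s: "s * s = 1" "\<bar>s\<bar> = 1" using ch by (auto simp: domain_chart_def)
  let ?\<phi> = "\<lambda>x. s * g x"
  have "pd v ?\<phi> z = s * pd v g z" for v
    by (rule pd_eqI) (use graph_fun_C1[OF gf] has_derivative_pd in \<open>auto intro!: derivative_eq_intros\<close>)
  then have "grad ?\<phi> z = s *\<^sub>R grad g z" by (simp add: vec_eq_iff grad_nth)
  then have v: "grad g z - s *\<^sub>R axis k 1 = s *\<^sub>R (grad ?\<phi> z - axis k 1)"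
    using s(1) by (simp add: scaleR_diff_right)
  have "n z = (1 / norm (grad g z - s *\<^sub>R axis k 1)) *\<^sub>R (grad g z - s *\<^sub>R axis k 1)"
    using n ch unfolding outward_unit_normal_def Let_def by blast
  also have "\<dots> = chart_normal k s ?\<phi> z"
    unfolding v using norm_grad_minus_axis[OF graph_fun_scale[OF gf, of s], of z] s(2)
    by (simp add: chart_normal_def)
  finally show ?thesis .
qed

lemma norm_outward_unit_normal:
  assumes "C1_domain \<Omega>" "outward_unit_normal \<Omega> n" "z \<in> frontier \<Omega>"
  shows "norm (n z) = 1"
proof -
  obtain U k s g where z: "z \<in> U" and ch: "domain_chart \<Omega> U k s g"
    using assms(1,3) unfolding C1_domain_def by blast
  have gf: "graph_fun k g" and s: "\<bar>s\<bar> = 1" using ch by (auto simp: domain_chart_def)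
  show ?thesis
    unfolding outward_unit_normal_chart[OF assms(2,3) z ch] chart_normal_def
    using norm_grad_minus_axis[OF graph_fun_scale[OF gf, of s], of z] s area_pos[of "grad (\<lambda>x. s * g x) z"]
    by simp
qed

text \<open>Near each boundary point, \<open>n\<close> coincides on the boundary with a chart
  formula that is continuous on the whole space.\<close>

lemma continuous_on_outward_unit_normal:
  assumes "C1_domain \<Omega>" "outward_unit_normal \<Omega> n"
  shows "continuous_on (frontier \<Omega>) n"
  unfolding continuous_on_def
proof
  fix z assume z: "z \<in> frontier \<Omega>"
  obtain U k s g where U: "z \<in> U" and ch: "domain_chart \<Omega> U k s g"
    using assms(1) z unfolding C1_domain_def by blast
  have gf: "graph_fun k g" and "open U" using ch by (auto simp: domain_chart_def)
  let ?N = "chart_normal k s (\<lambda>x. s * g x)"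
  have "(?N \<longlongrightarrow> ?N z) (at z within frontier \<Omega>)"
    using continuous_on_subset[OF continuous_on_chart_normal[OF graph_fun_scale[OF gf]], of "frontier \<Omega>"] z
    by (auto simp: continuous_on_def)
  moreover have "eventually (\<lambda>x. ?N x = n x) (at z within frontier \<Omega>)"
    unfolding eventually_at_topological
    using \<open>open U\<close> U outward_unit_normal_chart[OF assms(2) _ _ ch] by metis
  moreover have "?N z = n z" using outward_unit_normal_chart[OF assms(2) z U ch] by simp
  ultimately show "(n \<longlongrightarrow> n z) (at z within frontier \<Omega>)"
    using Lim_transform_eventually by fastforce
qed

section \<open>Surface integrals in a chart and finiteness of the surface measure\<close>

lemma emeasure_surface_graph:
  assumes S: "surface_measure \<Gamma> S" and U: "open U" and gf: "graph_fun k \<phi>"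
    and eq: "\<Gamma> \<inter> U = {x \<in> U. x $ k = \<phi> x}" and A: "A \<in> sets borel" "A \<subseteq> \<Gamma> \<inter> U"
  shows "emeasure S A = (\<integral>\<^sup>+w. ennreal (sqrt (1 + (norm (grad \<phi> (graph_point k \<phi> w)))\<^sup>2))
    * indicator A (graph_point k \<phi> w) \<partial>(Pi\<^sub>M (UNIV - {k}) (\<lambda>_. lborel)))"
  using S[unfolded surface_measure_def, THEN conjunct2, THEN conjunct2, rule_format,
      OF conjI[OF U conjI[OF gf eq]] A] .

text \<open>The definition of \<open>surface_measure\<close> speaks of sets only. It says that
  \<open>S\<close> restricted to \<open>\<Gamma> \<inter> U\<close> is the image of a weighted
  Lebesgue measure under the graph map; this equality of measures gives the equality of integrals
  for every measurable \<open>h\<close>, integrable or not.\<close>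

lemma surface_integral_graph:
  fixes h :: "real^'n \<Rightarrow> real"
  assumes S: "surface_measure \<Gamma> S" and \<Gamma>: "closed \<Gamma>" and U: "open U" and gf: "graph_fun k \<phi>"
    and eq: "\<Gamma> \<inter> U = {x \<in> U. x $ k = \<phi> x}" and h: "h \<in> borel_measurable borel"
  shows "(\<integral>x. indicator (\<Gamma> \<inter> U) x * h x \<partial>S)
    = (\<integral>w. sqrt (1 + (norm (grad \<phi> (graph_point k \<phi> w)))\<^sup>2) * (indicator U (graph_point k \<phi> w) * h (graph_point k \<phi> w))
        \<partial>(Pi\<^sub>M (UNIV - {k}) (\<lambda>_. lborel)))"
proof -
  note [measurable] = measurable_graph_point[OF gf] h
  have sS: "sets S = sets borel" using S by (simp add: surface_measure_def)
  have [measurable]: "h \<in> borel_measurable S" using h measurable_cong_sets[OF sS refl] by blast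
  have \<Gamma>U [measurable]: "\<Gamma> \<inter> U \<in> sets borel" using \<Gamma> U by auto
  then have [measurable]: "\<Gamma> \<inter> U \<in> sets S" using sS by simp
  have [measurable]: "grad \<phi> \<in> borel_measurable borel"
    by (rule borel_measurable_continuous_onI) (rule continuous_on_grad[OF graph_fun_C1[OF gf]])
  let ?P = "Pi\<^sub>M (UNIV - {k}) (\<lambda>_. lborel :: real measure)"
  let ?a = "\<lambda>w. sqrt (1 + (norm (grad \<phi> (graph_point k \<phi> w)))\<^sup>2)"
  \<comment> \<open>A graph point that lies in \<open>U\<close> lies on \<open>\<Gamma>\<close> as
    well.\<close>
  have ind: "indicator U (graph_point k \<phi> w) = (indicator (\<Gamma> \<inter> U) (graph_point k \<phi> w) :: real)" for w
    using eq graph_point_nth[OF gf, of w] by (auto simp: indicator_def)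
  have "density S (\<lambda>x. ennreal (indicator (\<Gamma> \<inter> U) x))
      = distr (density ?P (\<lambda>w. ennreal (?a w * indicator (\<Gamma> \<inter> U) (graph_point k \<phi> w)))) borel (graph_point k \<phi>)"
    (is "?L = ?R")
  proof (rule measure_eqI)
    show "sets ?L = sets ?R" by (simp add: sS)
    fix A assume "A \<in> sets ?L"
    then have A [measurable]: "A \<in> sets borel" by (simp add: sS)
    have AS [measurable]: "A \<in> sets S" by (simp add: sS)
    have "(\<lambda>x. ennreal (indicator (\<Gamma> \<inter> U) x)) \<in> borel_measurable S" by measurable
    then have "emeasure ?L A = (\<integral>\<^sup>+x. ennreal (indicator (\<Gamma> \<inter> U) x) * indicator A x \<partial>S)"
      using AS by (rule emeasure_density)
    also have "\<dots> = (\<integral>\<^sup>+x. indicator (A \<inter> (\<Gamma> \<inter> U)) x \<partial>S)"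
      by (rule nn_integral_cong) (auto simp: indicator_def)
    also have "\<dots> = emeasure S (A \<inter> (\<Gamma> \<inter> U))" by (rule nn_integral_indicator) measurable
    also have "\<dots> = (\<integral>\<^sup>+w. ennreal (?a w) * indicator (A \<inter> (\<Gamma> \<inter> U)) (graph_point k \<phi> w) \<partial>?P)"
    proof -
      have "A \<inter> (\<Gamma> \<inter> U) \<in> sets borel" "A \<inter> (\<Gamma> \<inter> U) \<subseteq> \<Gamma> \<inter> U" by auto
      then show ?thesis by (rule emeasure_surface_graph[OF S U gf eq])
    qed
    also have "\<dots> = (\<integral>\<^sup>+w. ennreal (?a w * indicator (\<Gamma> \<inter> U) (graph_point k \<phi> w)) *
        indicator (graph_point k \<phi> -` A \<inter> space ?P) w \<partial>?P)"
      by (rule nn_integral_cong) (auto simp: indicator_def)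
    also have "\<dots> = emeasure ?R A"
      by (subst emeasure_distr, simp, simp, subst emeasure_density) auto
    finally show "emeasure ?L A = emeasure ?R A" .
  qed
  then have "integral\<^sup>L ?L h = integral\<^sup>L ?R h" by simp
  moreover have "integral\<^sup>L ?L h = (\<integral>x. indicator (\<Gamma> \<inter> U) x * h x \<partial>S)"
    by (rule integral_real_density) auto
  moreover have "integral\<^sup>L ?R h = (\<integral>w. ?a w * indicator (\<Gamma> \<inter> U) (graph_point k \<phi> w) * h (graph_point k \<phi> w) \<partial>?P)"
    by (subst integral_distr, simp, simp, subst integral_real_density) auto
  ultimately show ?thesis by (simp add: ind mult.assoc)
qed

text \<open>On a closed ball inside the chart the area factor is bounded by compactness, and the
  graph points in the ball project into a cube of side \<open>2 * r\<close>.\<close>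

lemma emeasure_surface_finite_local:
  fixes S :: "(real^'n) measure"
  assumes S: "surface_measure \<Gamma> S" and \<Gamma>: "closed \<Gamma>" and U: "open U" "z \<in> U" and gf: "graph_fun k \<phi>"
    and eq: "\<Gamma> \<inter> U = {x \<in> U. x $ k = \<phi> x}"
  obtains r where "0 < r" "emeasure S (\<Gamma> \<inter> ball z r) < \<infinity>"
proof -
  interpret product_sigma_finite "\<lambda>_::'n. lborel :: real measure" ..
  obtain r where r: "0 < r" "cball z r \<subseteq> U" using U open_contains_cball by blast
  let ?P = "Pi\<^sub>M (UNIV - {k}) (\<lambda>_. lborel :: real measure)"
  let ?a = "\<lambda>x. sqrt (1 + (norm (grad \<phi> x))\<^sup>2)"
  let ?A = "\<Gamma> \<inter> ball z r"
  define Q where "Q = Pi\<^sub>E (UNIV - {k}) (\<lambda>i. {z $ i - r .. z $ i + r})"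
  have "continuous_on (cball z r) ?a"
    by (intro continuous_intros continuous_on_grad Ck_on_subset[OF graph_fun_C1[OF gf]]) auto
  then have "bounded (?a ` cball z r)" using compact_continuous_image compact_imp_bounded compact_cball by blast
  then obtain B where "\<forall>y\<in>?a ` cball z r. norm y \<le> B" unfolding bounded_iff by blast
  then have B: "?a x \<le> B" if "x \<in> cball z r" for x using that by auto
  have Q [measurable]: "Q \<in> sets ?P" unfolding Q_def by (rule sets_PiM_I_finite) auto
  have "emeasure S ?A = (\<integral>\<^sup>+w. ennreal (?a (graph_point k \<phi> w)) * indicator ?A (graph_point k \<phi> w) \<partial>?P)"
  proof -
    have "?A \<in> sets borel" "?A \<subseteq> \<Gamma> \<inter> U" using \<Gamma> r by auto
    then show ?thesis by (rule emeasure_surface_graph[OF S U(1) gf eq])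
  qed
  also have "\<dots> \<le> (\<integral>\<^sup>+w. ennreal B * indicator Q w \<partial>?P)"
  proof (rule nn_integral_mono)
    fix w assume w: "w \<in> space ?P"
    show "ennreal (?a (graph_point k \<phi> w)) * indicator ?A (graph_point k \<phi> w) \<le> ennreal B * indicator Q w"
    proof (cases "graph_point k \<phi> w \<in> ?A")
      case True
      then have in_ball: "graph_point k \<phi> w \<in> cball z r" by auto
      have "w i \<in> {z $ i - r .. z $ i + r}" if "i \<noteq> k" for i
      proof -
        have "\<bar>(graph_point k \<phi> w - z) $ i\<bar> \<le> r"
          using in_ball component_le_norm_cart[of "graph_point k \<phi> w - z" i]
          by (simp add: dist_norm norm_minus_commute)
        then show ?thesis using that by (simp add: graph_point_eq abs_le_iff)
      qed
      then have "w \<in> Q" using w by (auto simp: Q_def space_PiM PiE_iff)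
      then show ?thesis using True B[OF in_ball] by (simp add: ennreal_leI)
    qed simp
  qed
  also have "\<dots> = ennreal B * emeasure ?P Q" by (rule nn_integral_cmult_indicator) simp
  also have "emeasure ?P Q = (\<Prod>i\<in>UNIV - {k}. emeasure lborel {z $ i - r .. z $ i + r})"
    unfolding Q_def by (rule emeasure_PiM) auto
  also have "\<dots> = (\<Prod>i\<in>UNIV - {k}. ennreal (2 * r))" using r by simp
  also have "ennreal B * \<dots> < \<infinity>" by (simp add: ennreal_mult_less_top prod_constant power_less_top_ennreal)
  finally show thesis using that[OF r(1)] by blast
qed

lemma C1_domain_chart:
  assumes "C1_domain \<Omega>" "z \<in> frontier \<Omega>"
  obtains U k s g where "z \<in> U" "domain_chart \<Omega> U k s g" "open U" "graph_fun k g"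
    "frontier \<Omega> \<inter> U = {x \<in> U. x $ k = s * g x}"
proof -
  obtain U k s g where U: "z \<in> U" and ch: "domain_chart \<Omega> U k s g"
    using assms unfolding C1_domain_def by blast
  moreover have "open U" "graph_fun k g" using ch by (auto simp: domain_chart_def)
  moreover have "frontier \<Omega> \<inter> U = {x \<in> U. x $ k = s * g x}"
    using assms(1) by (intro frontier_chart[OF _ ch]) (simp add: C1_domain_def)
  ultimately show thesis using that by blast
qed

text \<open>\<open>surface_measure\<close> does not postulate finiteness; compactness of the
  boundary reduces it to finitely many balls.\<close>

lemma emeasure_frontier_finite:
  assumes \<Omega>: "C1_domain \<Omega>" "bounded \<Omega>" and S: "surface_measure (frontier \<Omega>) S"
  shows "emeasure S (frontier \<Omega>) < \<infinity>"
proof -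
  have "\<exists>r. 0 < r \<and> emeasure S (frontier \<Omega> \<inter> ball z r) < \<infinity>" if z: "z \<in> frontier \<Omega>" for z
  proof -
    obtain U k s g where ch: "z \<in> U" "domain_chart \<Omega> U k s g" "open U" "graph_fun k g"
        "frontier \<Omega> \<inter> U = {x \<in> U. x $ k = s * g x}"
      by (rule C1_domain_chart[OF \<Omega>(1) z])
    obtain r where "0 < r" "emeasure S (frontier \<Omega> \<inter> ball z r) < \<infinity>"
      by (rule emeasure_surface_finite_local[OF S frontier_closed ch(3,1) graph_fun_scale[OF ch(4)] ch(5)])
    then show ?thesis by blast
  qed
  then obtain r where r: "\<And>z. z \<in> frontier \<Omega> \<Longrightarrow> 0 < r z"
    "\<And>z. z \<in> frontier \<Omega> \<Longrightarrow> emeasure S (frontier \<Omega> \<inter> ball z (r z)) < \<infinity>" by metis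
  have K: "compact (frontier \<Omega>)" using \<Omega>(2) by (rule compact_frontier_bounded)
  have "frontier \<Omega> \<subseteq> (\<Union>z\<in>frontier \<Omega>. ball z (r z))" using r(1) by force
  then obtain Z where Z: "Z \<subseteq> frontier \<Omega>" "finite Z" "frontier \<Omega> \<subseteq> (\<Union>z\<in>Z. ball z (r z))"
    using compactE_image[OF K, of "frontier \<Omega>" "\<lambda>z. ball z (r z)"] by auto
  have sS: "sets S = sets borel" using S by (simp add: surface_measure_def)
  have "emeasure S (frontier \<Omega>) \<le> emeasure S (\<Union>z\<in>Z. frontier \<Omega> \<inter> ball z (r z))"
    using Z by (intro emeasure_mono) (auto simp: sS simp del: UN_simps intro!: sets.finite_UN sets.Int)
  also have "\<dots> \<le> (\<Sum>z\<in>Z. emeasure S (frontier \<Omega> \<inter> ball z (r z)))"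
    using Z by (intro emeasure_subadditive_finite) (auto simp: sS)
  also have "\<dots> < \<infinity>"
  proof -
    have "emeasure S (frontier \<Omega> \<inter> ball z (r z)) < top" if "z \<in> Z" for z using r(2)[of z] Z(1) that by auto
    then show ?thesis using Z(2) by simp
  qed
  finally show ?thesis .
qed


section \<open>The divergence theorem\<close>

text \<open>With \<open>f\<close> supported inside \<open>U\<close>, the domain may be exchanged for
  the full region on one side of the graph. The area factor of \<open>S\<close> cancels the
  normalisation of the normal, which leaves the transverse integral of
  \<open>graph_region_integral\<close>.\<close>

lemma divergence_theorem_chart:
  fixes f :: "real^'n \<Rightarrow> real"
  assumes \<Omega>: "open \<Omega>" and n: "outward_unit_normal \<Omega> n" and S: "surface_measure (frontier \<Omega>) S"
    and ch: "domain_chart \<Omega> U k s g" and f: "Ck_on (Suc 0) UNIV f"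
    and K: "compact K" "K \<subseteq> U" and f0: "\<And>x. x \<notin> K \<Longrightarrow> f x = 0"
  shows "(LINT x:\<Omega>|lborel. pd (axis i 1) f x) = (LINT x:frontier \<Omega>|S. f x * n x $ i)"
proof -
  define \<phi> where "\<phi> x = s * g x" for x
  have U: "open U" "graph_fun k g" and \<Omega>U: "\<Omega> \<inter> U = {x \<in> U. s * x $ k > g x}"
    and s: "s \<in> {1, -1}" "s * s = 1"
    using ch by (auto simp: domain_chart_def)
  have gf: "graph_fun k \<phi>" unfolding \<phi>_def by (rule graph_fun_scale[OF U(2)])
  have \<Gamma>U: "frontier \<Omega> \<inter> U = {x \<in> U. x $ k = \<phi> x}"
    unfolding \<phi>_def by (rule frontier_chart[OF \<Omega> ch])
  have s\<phi>: "s * \<phi> x = g x" for x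
    using s(2) by (simp add: \<phi>_def mult.assoc[symmetric])
  have fc: "continuous_on UNIV f" using f Ck_on_imp_continuous_on by blast
  let ?P = "Pi\<^sub>M (UNIV - {k}) (\<lambda>_. lborel :: real measure)"
  let ?N = "\<lambda>x. chart_normal k s \<phi> x $ i"
  have "(LINT x:\<Omega>|lborel. pd (axis i 1) f x)
      = (\<integral>x. indicator {x. s * x $ k > s * \<phi> x} x * pd (axis i 1) f x \<partial>lborel)"
    unfolding set_lebesgue_integral_def
  proof (rule Bochner_Integration.integral_cong[OF refl])
    fix x
    show "indicator \<Omega> x *\<^sub>R pd (axis i 1) f x = indicator {x. s * x $ k > s * \<phi> x} x * pd (axis i 1) f x"
    proof (cases "x \<in> K")
      case True
      then have "x \<in> \<Omega> \<longleftrightarrow> s * x $ k > g x" using \<Omega>U K(2) by blast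
      then show ?thesis by (simp add: indicator_def s\<phi>)
    next
      case False
      then have "pd (axis i 1) f x = 0"
        using f0 by (intro pd_eq_0_off_support[of K]) (auto simp: compact_imp_closed K)
      then show ?thesis by simp
    qed
  qed
  also have "\<dots> = s * (\<integral>w. (pd (axis i 1) \<phi> (graph_point k \<phi> w) - axis k 1 $ i) * f (graph_point k \<phi> w) \<partial>?P)"
    by (rule graph_region_integral[OF f K(1) f0 graph_fun_C1[OF gf] graph_fun_axis[OF gf] s(1)])
  also have "\<dots> = (\<integral>w. s * ((pd (axis i 1) \<phi> (graph_point k \<phi> w) - axis k 1 $ i) * f (graph_point k \<phi> w)) \<partial>?P)"
    by (rule integral_mult_right_zero[symmetric])
  also have "\<dots> = (\<integral>w. sqrt (1 + (norm (grad \<phi> (graph_point k \<phi> w)))\<^sup>2) *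
      (indicator U (graph_point k \<phi> w) * (f (graph_point k \<phi> w) * ?N (graph_point k \<phi> w))) \<partial>?P)"
  proof (rule Bochner_Integration.integral_cong[OF refl])
    fix w
    define z where "z = graph_point k \<phi> w"
    have "sqrt (1 + (norm (grad \<phi> z))\<^sup>2) \<noteq> 0" using area_pos[of "grad \<phi> z"] by simp
    then have e1: "sqrt (1 + (norm (grad \<phi> z))\<^sup>2) * ?N z = s * (pd (axis i 1) \<phi> z - axis k 1 $ i)"
      by (simp add: chart_normal_def grad_nth)
    have e2: "indicator U z * f z = f z" using f0[of z] K(2) by (auto simp: indicator_def)
    have "sqrt (1 + (norm (grad \<phi> z))\<^sup>2) * (indicator U z * (f z * ?N z))
      = (sqrt (1 + (norm (grad \<phi> z))\<^sup>2) * ?N z) * (indicator U z * f z)"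
      by (simp only: mult_ac)
    then show "s * ((pd (axis i 1) \<phi> (graph_point k \<phi> w) - axis k 1 $ i) * f (graph_point k \<phi> w))
      = sqrt (1 + (norm (grad \<phi> (graph_point k \<phi> w)))\<^sup>2) *
      (indicator U (graph_point k \<phi> w) * (f (graph_point k \<phi> w) * ?N (graph_point k \<phi> w)))"
      unfolding z_def[symmetric] e1 e2 by (simp only: mult_ac)
  qed
  also have "\<dots> = (\<integral>x. indicator (frontier \<Omega> \<inter> U) x * (f x * ?N x) \<partial>S)"
  proof (rule surface_integral_graph[OF S frontier_closed U(1) gf \<Gamma>U, symmetric])
    show "(\<lambda>x. f x * ?N x) \<in> borel_measurable borel"
      by (intro borel_measurable_continuous_onI continuous_intros fc continuous_on_chart_normal[OF gf])
  qed
  also have "\<dots> = (LINT x:frontier \<Omega>|S. f x * n x $ i)"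
    unfolding set_lebesgue_integral_def
  proof (rule Bochner_Integration.integral_cong[OF refl])
    fix x
    show "indicator (frontier \<Omega> \<inter> U) x * (f x * ?N x) = indicator (frontier \<Omega>) x *\<^sub>R (f x * n x $ i)"
    proof (cases "x \<in> frontier \<Omega> \<inter> U")
      case True
      then have "n x = chart_normal k s \<phi> x"
        unfolding \<phi>_def using outward_unit_normal_chart[OF n _ _ ch] by blast
      then show ?thesis using True by simp
    next
      case False
      then show ?thesis using f0[of x] K(2) by (auto simp: indicator_def)
    qed
  qed
  finally show ?thesis .
qed

text \<open>Both sides are zero: the left one is an integral of a derivative over the whole space,
  and on the right \<open>f\<close> vanishes on the boundary.\<close>

lemma divergence_theorem_interior:
  fixes f :: "real^'n \<Rightarrow> real"
  assumes \<Omega>: "open \<Omega>" and f: "Ck_on (Suc 0) UNIV f"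
    and K: "compact K" "K \<subseteq> \<Omega>" and f0: "\<And>x. x \<notin> K \<Longrightarrow> f x = 0"
  shows "(LINT x:\<Omega>|lborel. pd (axis i 1) f x) = (LINT x:frontier \<Omega>|S. f x * n x $ i)"
proof -
  have "indicator \<Omega> x *\<^sub>R pd (axis i 1) f x = pd (axis i 1) f x" for x
    using K(2) pd_eq_0_off_support[of K f x "axis i 1"] f0 compact_imp_closed[OF K(1)]
    by (cases "x \<in> K") (auto simp: indicator_def)
  then have "(LINT x:\<Omega>|lborel. pd (axis i 1) f x) = (\<integral>x. pd (axis i 1) f x \<partial>lborel)"
    by (simp only: set_lebesgue_integral_def)
  also have "\<dots> = 0" by (rule integral_pd_UNIV[OF f K(1) f0])
  also have "0 = (LINT x:frontier \<Omega>|S. f x * n x $ i)"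
  proof -
    have "indicator (frontier \<Omega>) x *\<^sub>R (f x * n x $ i) = 0" for x
      using f0[of x] K(2) \<Omega> by (auto simp: indicator_def frontier_def interior_open)
    then show ?thesis unfolding set_lebesgue_integral_def by (simp only: integral_zero)
  qed
  finally show ?thesis .
qed

section \<open>Cutoff functions and patching\<close>

text \<open>Squaring removes the kink of \<open>max 0 t\<close>; one continuous derivative is all
  that the cutoff has to provide.\<close>

lemma Ck_on_square_max0: "Ck_on (Suc 0) UNIV (\<lambda>t::real. (max 0 t)\<^sup>2)"
proof -
  have D: "((\<lambda>t::real. (max 0 t)\<^sup>2) has_real_derivative 2 * max 0 t) (at t)" for t
  proof (cases "t = 0")
    case False
    show ?thesis
    proof (cases "t > 0")
      case True
      have "((\<lambda>t::real. t\<^sup>2) has_real_derivative 2 * t) (at t)"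
        by (auto intro!: derivative_eq_intros)
      then have "((\<lambda>t::real. (max 0 t)\<^sup>2) has_real_derivative 2 * t) (at t)"
        by (rule has_field_derivative_transform_within_open[of _ _ _ "{0<..}"]) (use True in auto)
      then show ?thesis using True by simp
    next
      case neg: False
      have "((\<lambda>t::real. 0) has_real_derivative 0) (at t)" by simp
      then have "((\<lambda>t::real. (max 0 t)\<^sup>2) has_real_derivative 0) (at t)"
        by (rule has_field_derivative_transform_within_open[of _ _ _ "{..<0}"]) (use neg False in auto)
      then show ?thesis using neg by simp
    qed
  next
    case True
    \<comment> \<open>For nonzero \<open>h\<close> the difference quotient at 0 equals
      \<open>max 0 h\<close>.\<close>
    have "((\<lambda>h::real. max 0 h) \<longlongrightarrow> max 0 0) (at 0)" by (intro tendsto_intros)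
    then have "((\<lambda>h::real. max 0 h) \<longlongrightarrow> 0) (at 0)" by simp
    then have "((\<lambda>h::real. ((max 0 (0 + h))\<^sup>2 - (max 0 0)\<^sup>2) / h) \<longlongrightarrow> 0) (at 0)"
      by (rule Lim_transform_eventually)
         (auto simp: eventually_at power2_eq_square max_def intro!: exI[of _ 1])
    then show ?thesis using True by (simp add: DERIV_def)
  qed
  have "pd v (\<lambda>t::real. (max 0 t)\<^sup>2) = (\<lambda>t. 2 * max 0 t * v)" for v
    using pd_eqI[OF D[unfolded has_field_derivative_def]] by (simp add: fun_eq_iff)
  then show ?thesis
    using D by (auto simp: differentiable_def has_field_derivative_def intro!: continuous_intros)
qed

lemma Ck_on_dist_square: "Ck_on (Suc 0) UNIV (\<lambda>x::'a::real_inner. (dist z x)\<^sup>2)"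
proof -
  have D: "((\<lambda>x. (dist z x)\<^sup>2) has_derivative (\<lambda>v. 2 * ((x - z) \<bullet> v))) (at x)" for x :: 'a
  proof -
    have "((\<lambda>x. (x - z) \<bullet> (x - z)) has_derivative (\<lambda>v. 2 * ((x - z) \<bullet> v))) (at x)"
      by (auto intro!: derivative_eq_intros simp: inner_commute)
    moreover have "(dist z y)\<^sup>2 = (y - z) \<bullet> (y - z)" for y
      by (subst dist_commute) (simp only: dist_norm power2_norm_eq_inner)
    ultimately show ?thesis by (simp only:)
  qed
  have "pd v (\<lambda>x. (dist z x)\<^sup>2) = (\<lambda>x. 2 * ((x - z) \<bullet> v))" for v
    using pd_eqI[OF D] by (simp add: fun_eq_iff)
  then show ?thesis using D by (auto simp: differentiable_def intro!: continuous_intros)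
qed

lemma cutoff_exists:
  fixes z :: "'a::real_inner"
  assumes "0 < r"
  obtains \<xi> :: "'a \<Rightarrow> real" where "Ck_on (Suc 0) UNIV \<xi>"
    "\<And>x. x \<in> ball z (r/2) \<Longrightarrow> \<xi> x = 1" "\<And>x. x \<notin> cball z r \<Longrightarrow> \<xi> x = 0"
proof -
  define q where "q t = (max 0 t)\<^sup>2" for t :: real
  define b where "b = r\<^sup>2 - (r/2)\<^sup>2"
  \<comment> \<open>The argument of the inner \<open>q\<close> rises from 0 on the sphere of radius
    \<open>r/2\<close> to 1 on that of radius \<open>r\<close>. The inner \<open>q\<close> flattens
    the negative values inside to 0, the outer one the negative values of the difference
    outside.\<close>
  define \<xi> where "\<xi> x = q (1 - q (((dist z x)\<^sup>2 - (r/2)\<^sup>2) / b))" for x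
  have b: "b > 0" using assms by (simp add: b_def power_divide)
  have q: "Ck_on (Suc 0) UNIV q" using Ck_on_square_max0 by (simp add: q_def[abs_def])
  have "Ck_on (Suc 0) UNIV \<xi>"
    unfolding \<xi>_def using b
    by (intro Ck_on_compose_real[OF _ _ q] Ck_on_diff Ck_on_divide Ck_on_const Ck_on_dist_square) auto
  moreover have "\<xi> x = 1" if "x \<in> ball z (r/2)" for x
  proof -
    have "(dist z x)\<^sup>2 \<le> (r/2)\<^sup>2" using that by (intro power_mono) auto
    then have "((dist z x)\<^sup>2 - (r/2)\<^sup>2) / b \<le> 0" using b by (intro divide_nonpos_pos) auto
    then show ?thesis by (simp add: \<xi>_def q_def)
  qed
  moreover have "\<xi> x = 0" if "x \<notin> cball z r" for x
  proof -
    have "r\<^sup>2 \<le> (dist z x)\<^sup>2" using that assms by (intro power_mono) auto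
    then have "1 \<le> ((dist z x)\<^sup>2 - (r/2)\<^sup>2) / b" using b by (simp add: le_divide_eq b_def)
    then have "1 \<le> q (((dist z x)\<^sup>2 - (r/2)\<^sup>2) / b)"
      unfolding q_def using one_le_power[of "max 0 (((dist z x)\<^sup>2 - (r/2)\<^sup>2) / b)" 2] by simp
    then show ?thesis by (simp add: \<xi>_def q_def)
  qed
  ultimately show thesis by (rule that)
qed

text \<open>Outside \<open>W\<close> the values of \<open>f\<close> carry no information, so a localised \<open>f\<close> is first
  extended by zero.\<close>

lemma divergence_theorem_local:
  fixes f :: "real^'n \<Rightarrow> real"
  assumes \<Omega>: "C1_domain \<Omega>" and n: "outward_unit_normal \<Omega> n" and S: "surface_measure (frontier \<Omega>) S"
    and W: "open W" "closure \<Omega> \<subseteq> W" and z: "z \<in> closure \<Omega>"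
  shows "\<exists>r>0. \<forall>f i. Ck_on (Suc 0) W f \<longrightarrow> (\<forall>x\<in>W. x \<notin> cball z r \<longrightarrow> f x = 0) \<longrightarrow>
     (LINT x:\<Omega>|lborel. pd (axis i 1) f x) = (LINT x:frontier \<Omega>|S. f x * n x $ i)"
proof -
  have o\<Omega>: "open \<Omega>" using \<Omega> by (simp add: C1_domain_def)
  have "\<exists>V. open V \<and> z \<in> V \<and> (V \<subseteq> \<Omega> \<or> (\<exists>k s g. domain_chart \<Omega> V k s g))"
  proof (cases "z \<in> \<Omega>")
    case True
    then show ?thesis using o\<Omega> by blast
  next
    case False
    then have "z \<in> frontier \<Omega>" using z o\<Omega> by (simp add: frontier_def interior_open)
    then show ?thesis using C1_domain_chart[OF \<Omega>] by metis
  qed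
  then obtain V where V: "open V" "z \<in> V" "V \<subseteq> \<Omega> \<or> (\<exists>k s g. domain_chart \<Omega> V k s g)" by blast
  have "open (V \<inter> W)" "z \<in> V \<inter> W" using V W z by auto
  \<comment> \<open>The radius depends on \<open>z\<close> alone and not on the integrand, so one
    finite cover will serve all products with cutoffs.\<close>
  then obtain r where r: "0 < r" "cball z r \<subseteq> V \<inter> W" using open_contains_cball by blast
  have "(LINT x:\<Omega>|lborel. pd (axis i 1) f x) = (LINT x:frontier \<Omega>|S. f x * n x $ i)"
    if f: "Ck_on (Suc 0) W f" and f0: "\<And>x. x \<in> W \<Longrightarrow> x \<notin> cball z r \<Longrightarrow> f x = 0" for f i
  proof -
    define f1 where "f1 x = (if x \<in> W then f x else 0)" for x
    have "Ck_on (Suc 0) W f1" by (rule Ck_on_cong[OF W(1) _ f]) (simp add: f1_def)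
    moreover have "Ck_on (Suc 0) (- cball z r) f1"
      by (rule Ck_on_cong[OF _ _ Ck_on_const[of _ _ 0]]) (auto simp: f1_def f0)
    moreover have "W \<union> - cball z r = UNIV" using r(2) by auto
    ultimately have f1: "Ck_on (Suc 0) UNIV f1"
      using Ck_on_Un[OF W(1), of "- cball z r"] by (metis closed_cball open_Compl)
    have f10: "f1 x = 0" if "x \<notin> cball z r" for x using f0 that by (simp add: f1_def)
    have main: "(LINT x:\<Omega>|lborel. pd (axis i 1) f1 x) = (LINT x:frontier \<Omega>|S. f1 x * n x $ i)"
    proof (cases "V \<subseteq> \<Omega>")
      case True
      then have "cball z r \<subseteq> \<Omega>" using r(2) by blast
      then show ?thesis by (rule divergence_theorem_interior[OF o\<Omega> f1 compact_cball _ f10])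
    next
      case False
      then obtain k s g where ch: "domain_chart \<Omega> V k s g" using V(3) by blast
      have "cball z r \<subseteq> V" using r(2) by blast
      then show ?thesis by (rule divergence_theorem_chart[OF o\<Omega> n S ch f1 compact_cball _ f10])
    qed
    have "(LINT x:\<Omega>|lborel. pd (axis i 1) f x) = (LINT x:\<Omega>|lborel. pd (axis i 1) f1 x)"
    proof (rule set_lebesgue_integral_cong)
      show "\<Omega> \<in> sets lborel" using o\<Omega> by simp
      show "\<forall>x. x \<in> \<Omega> \<longrightarrow> pd (axis i 1) f x = pd (axis i 1) f1 x"
      proof (intro allI impI)
        fix x assume "x \<in> \<Omega>"
        then have "x \<in> W" using W(2) closure_subset by blast
        then show "pd (axis i 1) f x = pd (axis i 1) f1 x"
          using f by (intro pd_cong_open[OF W(1)]) (auto simp: f1_def)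
      qed
    qed
    also have "\<dots> = (LINT x:frontier \<Omega>|S. f x * n x $ i)"
      unfolding main
    proof (rule set_lebesgue_integral_cong)
      show "frontier \<Omega> \<in> sets S" using S frontier_closed by (auto simp: surface_measure_def)
      show "\<forall>x. x \<in> frontier \<Omega> \<longrightarrow> f1 x * n x $ i = f x * n x $ i"
        using W(2) by (auto simp: f1_def frontier_def)
    qed
    finally show ?thesis .
  qed
  then show ?thesis using r(1) by blast
qed

text \<open>A finite cover by half-radius balls replaces a partition of unity. For each ball
  \<open>f\<close> is split into its product with the cutoff, covered by the local statement, and a
  remainder that vanishes on that half-radius ball.\<close>

lemma divergence_theorem_component:
  fixes f :: "real^'n \<Rightarrow> real"
  assumes \<Omega>: "C1_domain \<Omega>" "bounded \<Omega>" and n: "outward_unit_normal \<Omega> n"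
    and S: "surface_measure (frontier \<Omega>) S"
    and W: "open W" "closure \<Omega> \<subseteq> W" and f: "Ck_on (Suc 0) W f"
  shows "(LINT x:\<Omega>|lborel. pd (axis i 1) f x) = (LINT x:frontier \<Omega>|S. f x * n x $ i)"
proof -
  have o\<Omega>: "open \<Omega>" and \<Omega>W: "\<Omega> \<subseteq> W" and \<Gamma>W: "frontier \<Omega> \<subseteq> W"
    using \<Omega> W closure_subset by (auto simp: C1_domain_def frontier_def)
  have sS: "sets S = sets borel" using S by (simp add: surface_measure_def)
  define P where "P f \<longleftrightarrow> (LINT x:\<Omega>|lborel. pd (axis i 1) f x) = (LINT x:frontier \<Omega>|S. f x * n x $ i)"
    for f :: "real^'n \<Rightarrow> real"
  have int\<Omega>: "set_integrable lborel \<Omega> (pd (axis i 1) f)" if "Ck_on (Suc 0) W f" for f :: "real^'n \<Rightarrow> real"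
  proof (rule set_integrable_continuous_compact[where K = "closure \<Omega>"])
    show "emeasure lborel \<Omega> < \<infinity>" using emeasure_bounded_finite[OF \<Omega>(2)] by simp
    show "continuous_on (closure \<Omega>) (pd (axis i 1) f)"
      using that by (auto intro: continuous_on_subset[OF _ W(2)])
  qed (use o\<Omega> \<Omega>(2) in \<open>auto simp: compact_closure closure_subset\<close>)
  have int\<Gamma>: "set_integrable S (frontier \<Omega>) (\<lambda>x. f x * n x $ i)" if "Ck_on (Suc 0) W f" for f :: "real^'n \<Rightarrow> real"
  proof (rule set_integrable_continuous_compact[where K = "frontier \<Omega>"])
    have "continuous_on (frontier \<Omega>) f"
      using Ck_on_imp_continuous_on[OF that] \<Gamma>W by (rule continuous_on_subset)
    then show "continuous_on (frontier \<Omega>) (\<lambda>x. f x * n x $ i)"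
      using continuous_on_outward_unit_normal[OF \<Omega>(1) n] by (intro continuous_intros)
  qed (use sS emeasure_frontier_finite[OF \<Omega> S] \<Omega>(2) in \<open>auto simp: compact_frontier_bounded frontier_closed\<close>)
  have P_add: "P (\<lambda>x. f x + h x)" if "P f" "P h" "Ck_on (Suc 0) W f" "Ck_on (Suc 0) W h"
    for f h :: "real^'n \<Rightarrow> real"
  proof -
    have "pd (axis i 1) (\<lambda>x. f x + h x) x = pd (axis i 1) f x + pd (axis i 1) h x" if "x \<in> \<Omega>" for x
      by (rule pd_eqI, intro has_derivative_add has_derivative_pd) (use that \<Omega>W \<open>Ck_on (Suc 0) W f\<close> \<open>Ck_on (Suc 0) W h\<close> in auto)
    then have "(LINT x:\<Omega>|lborel. pd (axis i 1) (\<lambda>x. f x + h x) x)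
      = (LINT x:\<Omega>|lborel. pd (axis i 1) f x + pd (axis i 1) h x)"
      using o\<Omega> by (intro set_lebesgue_integral_cong) auto
    also have "\<dots> = (LINT x:\<Omega>|lborel. pd (axis i 1) f x) + (LINT x:\<Omega>|lborel. pd (axis i 1) h x)"
      by (intro set_integral_add int\<Omega> that)
    also have "\<dots> = (LINT x:frontier \<Omega>|S. f x * n x $ i) + (LINT x:frontier \<Omega>|S. h x * n x $ i)"
      using that by (simp add: P_def)
    also have "\<dots> = (LINT x:frontier \<Omega>|S. f x * n x $ i + h x * n x $ i)"
      by (intro set_integral_add(2)[symmetric] int\<Gamma> that)
    finally show ?thesis by (simp add: P_def distrib_right)
  qed
  define Q where "Q z r \<longleftrightarrow> 0 < r \<and>
      (\<forall>f. Ck_on (Suc 0) W f \<longrightarrow> (\<forall>x\<in>W. x \<notin> cball z r \<longrightarrow> f x = 0) \<longrightarrow> P f)" for z r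
  have "\<exists>r. Q z r" if z: "z \<in> closure \<Omega>" for z
    using divergence_theorem_local[OF \<Omega>(1) n S W z] unfolding Q_def P_def by blast
  then obtain r where Q: "\<And>z. z \<in> closure \<Omega> \<Longrightarrow> Q z (r z)" by metis
  have r: "\<And>z. z \<in> closure \<Omega> \<Longrightarrow> 0 < r z"
    "\<And>z f. z \<in> closure \<Omega> \<Longrightarrow> Ck_on (Suc 0) W f \<Longrightarrow> (\<And>x. x \<in> W \<Longrightarrow> x \<notin> cball z (r z) \<Longrightarrow> f x = 0) \<Longrightarrow> P f"
    using Q unfolding Q_def by blast+
  \<comment> \<open>Induction on the cover. Vanishing is asked on \<open>closure \<Omega>\<close>
    only; with an empty cover this still gives zero derivatives in the open set
    \<open>\<Omega>\<close> and zero boundary values.\<close>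
  have patch: "P f" if "finite Z" "Z \<subseteq> closure \<Omega>" "Ck_on (Suc 0) W f"
    "\<And>x. x \<in> closure \<Omega> \<Longrightarrow> x \<notin> (\<Union>z\<in>Z. ball z (r z / 2)) \<Longrightarrow> f x = 0" for Z and f :: "real^'n \<Rightarrow> real"
    using that
  proof (induction Z arbitrary: f rule: finite_induct)
    case empty
    have f0: "f x = 0" if "x \<in> closure \<Omega>" for x using empty.prems(3) that by simp
    have "pd (axis i 1) f x = 0" if "x \<in> \<Omega>" for x
    proof -
      have "f differentiable (at x)" using empty.prems(2) \<Omega>W that by auto
      then have "pd (axis i 1) f x = pd (axis i 1) (\<lambda>_. 0) x"
        using f0 closure_subset that by (intro pd_cong_open[OF o\<Omega>]) auto
      then show ?thesis by simp
    qed
    then have "(LINT x:\<Omega>|lborel. pd (axis i 1) f x) = (LINT x:\<Omega>|lborel. 0)"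
      using o\<Omega> by (intro set_lebesgue_integral_cong) auto
    moreover have "(LINT x:frontier \<Omega>|S. f x * n x $ i) = (LINT x:frontier \<Omega>|S. 0)"
      using f0 sS by (intro set_lebesgue_integral_cong) (auto simp: frontier_def frontier_closed)
    ultimately show ?case by (simp add: P_def set_lebesgue_integral_def)
  next
    case (insert z Z)
    have z: "z \<in> closure \<Omega>" using insert.prems(1) by simp
    obtain \<xi> :: "real^'n \<Rightarrow> real" where \<xi>: "Ck_on (Suc 0) UNIV \<xi>" "\<And>x. x \<in> ball z (r z / 2) \<Longrightarrow> \<xi> x = 1"
      "\<And>x. x \<notin> cball z (r z) \<Longrightarrow> \<xi> x = 0"
      using cutoff_exists[OF r(1)[OF z]] by blast
    have \<xi>W: "Ck_on (Suc 0) W \<xi>" using \<xi>(1) by (rule Ck_on_subset) simp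
    have 1: "Ck_on (Suc 0) W (\<lambda>x. \<xi> x * f x)" "Ck_on (Suc 0) W (\<lambda>x. (1 - \<xi> x) * f x)"
      by (rule Ck_on_mult[OF W(1) \<xi>W insert.prems(2)],
          rule Ck_on_mult[OF W(1) Ck_on_diff[OF W(1) Ck_on_const \<xi>W] insert.prems(2)])
    have "P (\<lambda>x. \<xi> x * f x)" by (rule r(2)[OF z 1(1)]) (simp add: \<xi>(3))
    moreover have "P (\<lambda>x. (1 - \<xi> x) * f x)"
    proof (rule insert.IH[OF _ 1(2)])
      show "Z \<subseteq> closure \<Omega>" using insert.prems(1) by simp
      \<comment> \<open>Either \<open>x\<close> is in the half-radius ball at \<open>z\<close>,
        where the cutoff is 1, or \<open>f\<close> itself vanishes at \<open>x\<close>.\<close>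
      show "(1 - \<xi> x) * f x = 0" if "x \<in> closure \<Omega>" "x \<notin> (\<Union>z\<in>Z. ball z (r z / 2))" for x
        using insert.prems(3)[of x] that \<xi>(2)[of x] by auto
    qed
    ultimately have "P (\<lambda>x. \<xi> x * f x + (1 - \<xi> x) * f x)" using 1 by (intro P_add)
    moreover have "(\<lambda>x. \<xi> x * f x + (1 - \<xi> x) * f x) = f" by (simp add: fun_eq_iff algebra_simps)
    ultimately show ?case by simp
  qed
  have K: "compact (closure \<Omega>)" using \<Omega>(2) by (simp add: compact_closure)
  have "closure \<Omega> \<subseteq> (\<Union>z\<in>closure \<Omega>. ball z (r z / 2))" using r(1) by force
  then obtain Z where Z: "Z \<subseteq> closure \<Omega>" "finite Z" "closure \<Omega> \<subseteq> (\<Union>z\<in>Z. ball z (r z / 2))"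
    using compactE_image[OF K, of "closure \<Omega>" "\<lambda>z. ball z (r z / 2)"] by auto
  have "P f" by (rule patch[OF Z(2,1) f]) (use Z(3) in blast)
  then show ?thesis by (simp add: P_def)
qed

lemma set_integral_sum:
  fixes f :: "'i \<Rightarrow> 'a \<Rightarrow> real"
  assumes "\<And>i. i \<in> I \<Longrightarrow> set_integrable M A (f i)"
  shows "set_integrable M A (\<lambda>x. \<Sum>i\<in>I. f i x)"
    "(LINT x:A|M. \<Sum>i\<in>I. f i x) = (\<Sum>i\<in>I. LINT x:A|M. f i x)"
  using assms unfolding set_integrable_def set_lebesgue_integral_def scaleR_sum_right
  by (auto intro!: Bochner_Integration.integrable_sum Bochner_Integration.integral_sum)

text \<open>Summation over components. Integrability is delivered too, because the energy law splits
  the bulk integral and merges the boundary integrals.\<close>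

theorem divergence_theorem:
  fixes F :: "real^'n \<Rightarrow> real^'n"
  assumes \<Omega>: "C1_domain \<Omega>" "bounded \<Omega>" and n: "outward_unit_normal \<Omega> n"
    and S: "surface_measure (frontier \<Omega>) S"
    and W: "open W" "closure \<Omega> \<subseteq> W" and F: "\<And>i. Ck_on (Suc 0) W (\<lambda>x. F x $ i)"
  shows "(LINT x:\<Omega>|lborel. divergence F x) = (LINT x:frontier \<Omega>|S. F x \<bullet> n x)"
    "set_integrable lborel \<Omega> (divergence F)" "set_integrable S (frontier \<Omega>) (\<lambda>x. F x \<bullet> n x)"
proof -
  have int\<Omega>: "set_integrable lborel \<Omega> (pd (axis i 1) (\<lambda>x. F x $ i))" for i
  proof (rule set_integrable_continuous_compact[where K = "closure \<Omega>"])
    show "emeasure lborel \<Omega> < \<infinity>" using emeasure_bounded_finite[OF \<Omega>(2)] by simp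
    show "continuous_on (closure \<Omega>) (pd (axis i 1) (\<lambda>x. F x $ i))"
      using F[of i] by (auto intro: continuous_on_subset[OF _ W(2)])
  qed (use \<Omega> in \<open>auto simp: compact_closure closure_subset C1_domain_def\<close>)
  have int\<Gamma>: "set_integrable S (frontier \<Omega>) (\<lambda>x. F x $ i * n x $ i)" for i
  proof (rule set_integrable_continuous_compact[where K = "frontier \<Omega>"])
    have "continuous_on (frontier \<Omega>) (\<lambda>x. F x $ i)"
      by (rule continuous_on_subset[OF Ck_on_imp_continuous_on[OF F]]) (use W(2) in \<open>auto simp: frontier_def\<close>)
    then show "continuous_on (frontier \<Omega>) (\<lambda>x. F x $ i * n x $ i)"
      by (rule continuous_on_mult[OF _ continuous_on_component[OF continuous_on_outward_unit_normal[OF \<Omega>(1) n]]])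
  qed (use S emeasure_frontier_finite[OF \<Omega> S] \<Omega>(2) in
      \<open>auto simp: compact_frontier_bounded frontier_closed surface_measure_def\<close>)
  show "set_integrable lborel \<Omega> (divergence F)"
    unfolding divergence_def[abs_def] grad_nth by (intro set_integral_sum(1) int\<Omega>)
  show "set_integrable S (frontier \<Omega>) (\<lambda>x. F x \<bullet> n x)"
    unfolding inner_vec_def inner_real_def by (intro set_integral_sum(1) int\<Gamma>)
  have "(LINT x:\<Omega>|lborel. divergence F x) = (\<Sum>i\<in>UNIV. LINT x:\<Omega>|lborel. pd (axis i 1) (\<lambda>x. F x $ i) x)"
    unfolding divergence_def grad_nth by (intro set_integral_sum(2) int\<Omega>)
  also have "\<dots> = (\<Sum>i\<in>UNIV. LINT x:frontier \<Omega>|S. F x $ i * n x $ i)"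
    by (intro sum.cong refl divergence_theorem_component[OF \<Omega> n S W F])
  also have "\<dots> = (LINT x:frontier \<Omega>|S. F x \<bullet> n x)"
    unfolding inner_vec_def inner_real_def by (intro set_integral_sum(2)[symmetric] int\<Gamma>)
  finally show "(LINT x:\<Omega>|lborel. divergence F x) = (LINT x:frontier \<Omega>|S. F x \<bullet> n x)" .
qed


section \<open>Smooth functions\<close>

text \<open>\<open>smooth_on\<close> with its neighbourhood made explicit, so that all fields can
  share one open set.\<close>

definition Cinf_on :: "'a::real_normed_vector set \<Rightarrow> ('a \<Rightarrow> 'b::real_normed_vector) \<Rightarrow> bool" where
  "Cinf_on W f \<longleftrightarrow> (\<forall>k. Ck_on k W f)"

lemma Cinf_on_differentiable: "Cinf_on W f \<Longrightarrow> x \<in> W \<Longrightarrow> f differentiable (at x)"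
  unfolding Cinf_on_def using Ck_on_imp_differentiable[of "Suc 0" W f x] by simp

lemma Cinf_on_continuous_on: "Cinf_on W f \<Longrightarrow> continuous_on W f"
  unfolding Cinf_on_def using Ck_on_imp_continuous_on by blast

lemma Cinf_on_pd: "Cinf_on W f \<Longrightarrow> Cinf_on W (pd v f)"
  unfolding Cinf_on_def by (metis Ck_on.simps(2))

lemma Cinf_on_subset: "Cinf_on W f \<Longrightarrow> V \<subseteq> W \<Longrightarrow> Cinf_on V f"
  unfolding Cinf_on_def using Ck_on_subset by blast

lemma Cinf_on_bounded_linear_comp:
  "open W \<Longrightarrow> bounded_linear l \<Longrightarrow> Cinf_on W f \<Longrightarrow> Cinf_on W (\<lambda>x. l (f x))"
  by (simp add: Cinf_on_def Ck_on_bounded_linear_comp)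

context
  fixes W :: "'a::real_normed_vector set"
  assumes W: "open W"
begin

lemma Cinf_on_const: "Cinf_on W (\<lambda>_. a)"
  by (simp add: Cinf_on_def Ck_on_const)

lemma Cinf_on_add: "Cinf_on W f \<Longrightarrow> Cinf_on W g \<Longrightarrow> Cinf_on W (\<lambda>x. f x + g x)"
  by (simp add: Cinf_on_def Ck_on_add W)

lemma Cinf_on_diff: "Cinf_on W f \<Longrightarrow> Cinf_on W g \<Longrightarrow> Cinf_on W (\<lambda>x. f x - g x)"
  by (simp add: Cinf_on_def Ck_on_diff W)

lemma Cinf_on_sum: "(\<And>i. i \<in> A \<Longrightarrow> Cinf_on W (f i)) \<Longrightarrow> Cinf_on W (\<lambda>x. \<Sum>i\<in>A. f i x)"
  by (simp add: Cinf_on_def Ck_on_sum W)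

context
  fixes f g :: "'a \<Rightarrow> real"
  assumes f: "Cinf_on W f" and g: "Cinf_on W g"
begin

lemma Cinf_on_mult: "Cinf_on W (\<lambda>x. f x * g x)"
  using f g by (simp add: Cinf_on_def Ck_on_mult W)

lemma Cinf_on_divide: "(\<And>x. x \<in> W \<Longrightarrow> g x \<noteq> 0) \<Longrightarrow> Cinf_on W (\<lambda>x. f x / g x)"
  using f g by (simp add: Cinf_on_def Ck_on_divide W)

end

lemma Cinf_on_power: "Cinf_on W f \<Longrightarrow> Cinf_on W (\<lambda>x. f x ^ m)" for f :: "'a \<Rightarrow> real"
  by (simp add: Cinf_on_def Ck_on_power W)

lemma Cinf_on_compose_real:
  fixes h :: "real \<Rightarrow> real"
  shows "(\<And>x. x \<in> W \<Longrightarrow> f x \<in> V) \<Longrightarrow> Cinf_on V h \<Longrightarrow> Cinf_on W f \<Longrightarrow> Cinf_on W (\<lambda>x. h (f x))"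
  by (auto simp: Cinf_on_def intro: Ck_on_compose_real[OF W])

context
  fixes x assumes x: "x \<in> W"
begin

lemma pd_add: "Cinf_on W f \<Longrightarrow> Cinf_on W g \<Longrightarrow> pd v (\<lambda>x. f x + g x) x = pd v f x + pd v g x"
  by (intro pd_eqI has_derivative_add has_derivative_pd) (auto intro: Cinf_on_differentiable x)

lemma pd_diff: "Cinf_on W f \<Longrightarrow> Cinf_on W g \<Longrightarrow> pd v (\<lambda>x. f x - g x) x = pd v f x - pd v g x"
  by (intro pd_eqI has_derivative_diff has_derivative_pd) (auto intro: Cinf_on_differentiable x)

lemma pd_sum: "(\<And>i. i \<in> A \<Longrightarrow> Cinf_on W (f i)) \<Longrightarrow> pd v (\<lambda>x. \<Sum>i\<in>A. f i x) x = (\<Sum>i\<in>A. pd v (f i) x)"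
  by (intro pd_eqI has_derivative_sum has_derivative_pd) (auto intro: Cinf_on_differentiable x)

lemma pd_mult:
  fixes f g :: "'a \<Rightarrow> real"
  assumes "Cinf_on W f" "Cinf_on W g"
  shows "pd v (\<lambda>x. f x * g x) x = pd v f x * g x + f x * pd v g x"
proof -
  have "((\<lambda>x. f x * g x) has_derivative (\<lambda>v. f x * pd v g x + pd v f x * g x)) (at x)"
    using assms by (intro has_derivative_mult has_derivative_pd) (auto intro: Cinf_on_differentiable x)
  then show ?thesis by (simp add: pd_eqI)
qed

lemma Cinf_on_pd_commute:
  fixes f :: "'a \<Rightarrow> real"
  assumes "Cinf_on W f"
  shows "pd v (pd w f) x = pd w (pd v f) x"
  by (rule pd_commute[OF W x]) (use assms in \<open>simp add: Cinf_on_def del: Ck_on.simps\<close>)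

lemma pd_cmult:
  fixes f :: "'a \<Rightarrow> real"
  assumes "Cinf_on W f"
  shows "pd v (\<lambda>x. a * f x) x = a * pd v f x"
  using pd_mult[OF Cinf_on_const[of a] assms] by simp

lemma pd_compose_real:
  fixes f :: "'a \<Rightarrow> real" and h :: "real \<Rightarrow> real"
  assumes "Cinf_on W f" "(h has_real_derivative h') (at (f x))"
  shows "pd v (\<lambda>x. h (f x)) x = h' * pd v f x"
proof -
  have "((\<lambda>x. h (f x)) has_derivative (\<lambda>v. h' * pd v f x)) (at x)"
    by (rule has_derivative_compose[where g = h and f = f and f' = "\<lambda>v. pd v f x" and g' = "\<lambda>r. h' * r"])
       (use assms Cinf_on_differentiable x in \<open>auto intro: has_derivative_pd simp: has_field_derivative_def\<close>)
  then show ?thesis by (rule pd_eqI)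
qed

end

end


section \<open>The pointwise energy balance\<close>

text \<open>The balance rests on commuting directional derivatives, so time \<open>e0\<close> and
  the space axes \<open>d i\<close> are arbitrary directions in a normed space. Identities are
  evaluated at the single point \<open>z\<close>; smoothness on \<open>W\<close> around it justifies
  the product rules and the change of order.\<close>

locale energy_fields =
  fixes W :: "'a::real_normed_vector set" and z :: 'a and e0 :: 'a and d :: "'n::finite \<Rightarrow> 'a"
    and C P R E Lm M \<mu> :: "'a \<Rightarrow> real" and U :: "'n \<Rightarrow> 'a \<Rightarrow> real"
    and G G' :: "real \<Rightarrow> real" and l \<gamma> \<alpha> :: real
  assumes W: "open W" and z: "z \<in> W"
    and C: "Cinf_on W C" and P: "Cinf_on W P" and R: "Cinf_on W R" and E: "Cinf_on W E"
    and Lm: "Cinf_on W Lm" and M: "Cinf_on W M" and \<mu>: "Cinf_on W \<mu>" and U: "\<And>j. Cinf_on W (U j)"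
    and GC: "Cinf_on W (\<lambda>x. G (C x))" and G': "\<And>y. (G has_real_derivative G' y) (at y)"
    and R0: "R z \<noteq> 0"
begin

definition dv :: "'a \<Rightarrow> real" where
  "dv x = (\<Sum>i\<in>UNIV. pd (d i) (U i) x)"

definition str :: "'n \<Rightarrow> 'n \<Rightarrow> 'a \<Rightarrow> real" where
  "str i j x = (1/2) * (pd (d j) (U i) x + pd (d i) (U j) x)"

text \<open>Energy per unit mass; the density in the balance is \<open>R x * ed x\<close>. In this
  form mass conservation lets the material derivative fall on \<open>ed\<close> alone.\<close>

definition ed :: "'a \<Rightarrow> real" where
  "ed x = (1/2) * (\<Sum>j\<in>UNIV. U j x * U j x)
    + l * (G (C x) + \<gamma>\<^sup>2 / 2 * (\<Sum>j\<in>UNIV. pd (d j) C x * pd (d j) C x))"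

text \<open>In order: energy carried by diffusion, capillary work under a changing composition, work
  of the viscous stress and of the pressure, convected energy.\<close>

definition flux :: "'n \<Rightarrow> 'a \<Rightarrow> real" where
  "flux i x = \<mu> x * (M x * pd (d i) \<mu> x) + pd e0 C x * (l * \<gamma>\<^sup>2 * (R x * pd (d i) C x))
    + (\<Sum>j\<in>UNIV. (2 * E x * str i j x) * U j x) + Lm x * dv x * U i x - P x * U i x - R x * ed x * U i x"

definition MD :: "('a \<Rightarrow> real) \<Rightarrow> real" where
  "MD f = pd e0 f z + (\<Sum>i\<in>UNIV. U i z * pd (d i) f z)"

lemma smooth_dv: "Cinf_on W dv"
  unfolding dv_def[abs_def] by (intro Cinf_on_sum W Cinf_on_pd U)

lemma smooth_str: "Cinf_on W (str i j)"
  unfolding str_def[abs_def] by (intro Cinf_on_mult Cinf_on_add Cinf_on_const W Cinf_on_pd U)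

lemma smooth_ed: "Cinf_on W ed"
  unfolding ed_def[abs_def]
  by (intro Cinf_on_add Cinf_on_mult Cinf_on_sum Cinf_on_const GC Cinf_on_pd C U W)

lemmas smooth_intros = smooth_dv smooth_str smooth_ed C P R E Lm M \<mu> U GC
  Cinf_on_const[OF W] Cinf_on_mult[OF W] Cinf_on_add[OF W] Cinf_on_diff[OF W] Cinf_on_sum[OF W] Cinf_on_pd

lemmas pd_rules = pd_add[OF W z] pd_diff[OF W z] pd_sum[OF W z] pd_mult[OF W z] pd_cmult[OF W z]

lemma smooth_flux: "Cinf_on W (flux i)"
  unfolding flux_def[abs_def] by (intro smooth_intros)

lemma pd_ed: "pd v ed z = (\<Sum>j\<in>UNIV. U j z * pd v (U j) z)
    + l * (G' (C z) * pd v C z + \<gamma>\<^sup>2 * (\<Sum>j\<in>UNIV. pd (d j) C z * pd v (pd (d j) C) z))"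
proof -
  have sq: "pd v (\<lambda>x. \<Sum>j\<in>UNIV. f j x * f j x) z = 2 * (\<Sum>j\<in>UNIV. f j z * pd v (f j) z)"
    if "\<And>j. Cinf_on W (f j)" for f :: "'n \<Rightarrow> 'a \<Rightarrow> real"
  proof -
    have "pd v (\<lambda>x. \<Sum>j\<in>UNIV. f j x * f j x) z = (\<Sum>j\<in>UNIV. pd v (\<lambda>x. f j x * f j x) z)"
      by (intro pd_rules smooth_intros that)
    also have "\<dots> = (\<Sum>j\<in>UNIV. 2 * (f j z * pd v (f j) z))"
      by (intro sum.cong refl) (simp add: pd_mult[OF W z that that])
    finally show ?thesis by (simp add: sum_distrib_left)
  qed
  have s1: "Cinf_on W (\<lambda>x. \<Sum>j\<in>UNIV. U j x * U j x)"
    and s2: "Cinf_on W (\<lambda>x. \<Sum>j\<in>UNIV. pd (d j) C x * pd (d j) C x)"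
    by (intro smooth_intros)+
  have "pd v ed z = 1/2 * pd v (\<lambda>x. \<Sum>j\<in>UNIV. U j x * U j x) z
      + l * (pd v (\<lambda>x. G (C x)) z + \<gamma>\<^sup>2/2 * pd v (\<lambda>x. \<Sum>j\<in>UNIV. pd (d j) C x * pd (d j) C x) z)"
    unfolding ed_def[abs_def]
    by (simp only: pd_add[OF W z] pd_cmult[OF W z] smooth_intros s1 s2)
  also have "pd v (\<lambda>x. G (C x)) z = G' (C z) * pd v C z"
    by (rule pd_compose_real[OF W z C G'])
  finally show ?thesis
    by (simp add: sq U Cinf_on_pd[OF C])
qed

text \<open>The gradient stays inside \<open>MD (pd (d j) C)\<close>: its commutator with the
  material derivative is the term that has to meet the capillary stress later.\<close>

lemma MD_ed: "MD ed = (\<Sum>j\<in>UNIV. U j z * MD (U j))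
    + l * (G' (C z) * MD C + \<gamma>\<^sup>2 * (\<Sum>j\<in>UNIV. pd (d j) C z * MD (pd (d j) C)))"
proof -
  have swap: "(\<Sum>i\<in>UNIV. U i z * (\<Sum>j\<in>UNIV. f j * g i j)) = (\<Sum>j\<in>UNIV. f j * (\<Sum>i\<in>UNIV. U i z * g i j))"
    for f :: "'n \<Rightarrow> real" and g :: "'n \<Rightarrow> 'n \<Rightarrow> real"
    unfolding sum_distrib_left by (subst sum.swap) (simp add: mult.left_commute)
  note s1 = swap[of "\<lambda>j. U j z" "\<lambda>i j. pd (d i) (U j) z"]
  note s2 = swap[of "\<lambda>j. pd (d j) C z" "\<lambda>i j. pd (d i) (pd (d j) C) z"]
  have m1: "(\<Sum>j\<in>UNIV. U j z * MD (U j)) = (\<Sum>j\<in>UNIV. U j z * pd e0 (U j) z)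
      + (\<Sum>j\<in>UNIV. U j z * (\<Sum>i\<in>UNIV. U i z * pd (d i) (U j) z))"
    by (simp only: MD_def distrib_left sum.distrib)
  have m2: "(\<Sum>j\<in>UNIV. pd (d j) C z * MD (pd (d j) C)) = (\<Sum>j\<in>UNIV. pd (d j) C z * pd e0 (pd (d j) C) z)
      + (\<Sum>j\<in>UNIV. pd (d j) C z * (\<Sum>i\<in>UNIV. U i z * pd (d i) (pd (d j) C) z))"
    by (simp only: MD_def distrib_left sum.distrib)
  have a: "(\<Sum>i\<in>UNIV. U i z * pd (d i) ed z)
    = (\<Sum>i\<in>UNIV. U i z * (\<Sum>j\<in>UNIV. U j z * pd (d i) (U j) z))
      + l * (G' (C z) * (\<Sum>i\<in>UNIV. U i z * pd (d i) C z)
        + \<gamma>\<^sup>2 * (\<Sum>i\<in>UNIV. U i z * (\<Sum>j\<in>UNIV. pd (d j) C z * pd (d i) (pd (d j) C) z)))"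
    unfolding pd_ed distrib_left sum.distrib sum_distrib_left by (simp add: mult_ac)
  show ?thesis
    unfolding m1 m2 MD_def[of ed] MD_def[of C] a
    unfolding s1 s2 pd_ed[of e0] by (simp add: algebra_simps)
qed

text \<open>Product rule, arranged so that every divergence occurring in an equation of motion stays
  intact and can be substituted afterwards.\<close>

lemma divergence_flux:
  "(\<Sum>i\<in>UNIV. pd (d i) (flux i) z)
  = \<mu> z * (\<Sum>i\<in>UNIV. pd (d i) (\<lambda>x. M x * pd (d i) \<mu> x) z) + M z * (\<Sum>i\<in>UNIV. (pd (d i) \<mu> z)\<^sup>2)
  + pd e0 C z * (l * \<gamma>\<^sup>2 * (\<Sum>i\<in>UNIV. pd (d i) (\<lambda>x. R x * pd (d i) C x) z))
  + l * \<gamma>\<^sup>2 * R z * (\<Sum>i\<in>UNIV. pd (d i) C z * pd e0 (pd (d i) C) z)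
  + (\<Sum>j\<in>UNIV. U j z * (\<Sum>i\<in>UNIV. pd (d i) (\<lambda>x. 2 * E x * str i j x) z))
  + 2 * E z * (\<Sum>i\<in>UNIV. \<Sum>j\<in>UNIV. (str i j z)\<^sup>2)
  + (\<Sum>j\<in>UNIV. U j z * pd (d j) (\<lambda>x. Lm x * dv x) z) + Lm z * (dv z)\<^sup>2
  - (\<Sum>j\<in>UNIV. U j z * pd (d j) P z) - P z * dv z
  - (\<Sum>j\<in>UNIV. U j z * pd (d j) (\<lambda>x. R x * ed x) z) - R z * ed z * dv z"
proof -
  have fl: "pd (d i) (flux i) z
    = \<mu> z * pd (d i) (\<lambda>x. M x * pd (d i) \<mu> x) z + M z * (pd (d i) \<mu> z)\<^sup>2
    + pd e0 C z * (l * \<gamma>\<^sup>2 * pd (d i) (\<lambda>x. R x * pd (d i) C x) z)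
    + l * \<gamma>\<^sup>2 * R z * (pd (d i) C z * pd e0 (pd (d i) C) z)
    + (\<Sum>j\<in>UNIV. U j z * pd (d i) (\<lambda>x. 2 * E x * str i j x) z)
    + (\<Sum>j\<in>UNIV. 2 * E z * str i j z * pd (d i) (U j) z)
    + U i z * pd (d i) (\<lambda>x. Lm x * dv x) z + Lm z * dv z * pd (d i) (U i) z
    - U i z * pd (d i) P z - P z * pd (d i) (U i) z
    - U i z * pd (d i) (\<lambda>x. R x * ed x) z - R z * ed z * pd (d i) (U i) z" for i
  proof -
    \<comment> \<open>The flux contains the time derivative of \<open>C\<close>; exchanging the
      order of differentiation produces the rate of change of the gradient.\<close>
    have c: "pd (d i) (pd e0 C) z = pd e0 (pd (d i) C) z"
      by (rule Cinf_on_pd_commute[OF W z C])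
    have s: "Cinf_on W (\<lambda>x. M x * pd (d i) \<mu> x)" "Cinf_on W (\<lambda>x. R x * pd (d i) C x)"
      "Cinf_on W (\<lambda>x. 2 * E x * str i j x)" "Cinf_on W (\<lambda>x. Lm x * dv x)" "Cinf_on W (\<lambda>x. R x * ed x)"
      "Cinf_on W (\<lambda>x. l * \<gamma>\<^sup>2 * (R x * pd (d i) C x))" for j
      by (intro smooth_intros)+
    have t: "Cinf_on W (\<lambda>x. \<mu> x * (M x * pd (d i) \<mu> x))"
      "Cinf_on W (\<lambda>x. pd e0 C x * (l * \<gamma>\<^sup>2 * (R x * pd (d i) C x)))"
      "Cinf_on W (\<lambda>x. (2 * E x * str i j x) * U j x)"
      "Cinf_on W (\<lambda>x. \<Sum>j\<in>UNIV. (2 * E x * str i j x) * U j x)"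
      "Cinf_on W (\<lambda>x. Lm x * dv x * U i x)" "Cinf_on W (\<lambda>x. P x * U i x)" "Cinf_on W (\<lambda>x. R x * ed x * U i x)" for j
      by (intro smooth_intros)+
    have "pd (d i) (flux i) z
      = pd (d i) (\<lambda>x. \<mu> x * (M x * pd (d i) \<mu> x)) z + pd (d i) (\<lambda>x. pd e0 C x * (l * \<gamma>\<^sup>2 * (R x * pd (d i) C x))) z
      + (\<Sum>j\<in>UNIV. pd (d i) (\<lambda>x. (2 * E x * str i j x) * U j x) z) + pd (d i) (\<lambda>x. Lm x * dv x * U i x) z
      - pd (d i) (\<lambda>x. P x * U i x) z - pd (d i) (\<lambda>x. R x * ed x * U i x) z"
      unfolding flux_def[abs_def]
      by (simp only: pd_add[OF W z] pd_diff[OF W z] pd_sum[OF W z] t Cinf_on_add[OF W] Cinf_on_diff[OF W])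
    also have "pd (d i) (\<lambda>x. \<mu> x * (M x * pd (d i) \<mu> x)) z
      = \<mu> z * pd (d i) (\<lambda>x. M x * pd (d i) \<mu> x) z + M z * (pd (d i) \<mu> z)\<^sup>2"
      by (subst pd_mult[OF W z \<mu> s(1)]) (simp add: power2_eq_square)
    also have "pd (d i) (\<lambda>x. pd e0 C x * (l * \<gamma>\<^sup>2 * (R x * pd (d i) C x))) z
      = pd e0 C z * (l * \<gamma>\<^sup>2 * pd (d i) (\<lambda>x. R x * pd (d i) C x) z)
      + l * \<gamma>\<^sup>2 * R z * (pd (d i) C z * pd e0 (pd (d i) C) z)"
      by (subst pd_mult[OF W z Cinf_on_pd[OF C] s(6)], subst pd_cmult[OF W z s(2)]) (simp add: c)
    also have "(\<Sum>j\<in>UNIV. pd (d i) (\<lambda>x. (2 * E x * str i j x) * U j x) z)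
      = (\<Sum>j\<in>UNIV. U j z * pd (d i) (\<lambda>x. 2 * E x * str i j x) z)
      + (\<Sum>j\<in>UNIV. 2 * E z * str i j z * pd (d i) (U j) z)"
      by (subst sum.distrib[symmetric], intro sum.cong refl, subst pd_mult[OF W z s(3) U]) (simp add: mult_ac)
    also have "pd (d i) (\<lambda>x. Lm x * dv x * U i x) z
      = U i z * pd (d i) (\<lambda>x. Lm x * dv x) z + Lm z * dv z * pd (d i) (U i) z"
      by (subst pd_mult[OF W z s(4) U]) simp
    also have "pd (d i) (\<lambda>x. P x * U i x) z = U i z * pd (d i) P z + P z * pd (d i) (U i) z"
      by (subst pd_mult[OF W z P U]) simp
    also have "pd (d i) (\<lambda>x. R x * ed x * U i x) z
      = U i z * pd (d i) (\<lambda>x. R x * ed x) z + R z * ed z * pd (d i) (U i) z"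
      by (subst pd_mult[OF W z s(5) U]) simp
    finally show ?thesis by simp
  qed
  \<comment> \<open>The symmetric \<open>str\<close> sees only the symmetric part of the velocity
    gradient: averaging the double sum with its transpose gives a sum of squares.\<close>
  have str_sq: "(\<Sum>i\<in>UNIV. \<Sum>j\<in>UNIV. 2 * E z * str i j z * pd (d i) (U j) z)
    = 2 * E z * (\<Sum>i\<in>UNIV. \<Sum>j\<in>UNIV. (str i j z)\<^sup>2)"
  proof -
    have sym: "str i j z = str j i z" for i j by (simp add: str_def)
    have "(\<Sum>i\<in>UNIV. \<Sum>j\<in>UNIV. (str i j z)\<^sup>2)
      = (\<Sum>i\<in>UNIV. \<Sum>j\<in>UNIV. 1/2 * (str i j z * pd (d j) (U i) z) + 1/2 * (str i j z * pd (d i) (U j) z))"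
      by (intro sum.cong refl) (subst (2) str_def, simp add: power2_eq_square str_def algebra_simps)
    also have "\<dots> = 1/2 * (\<Sum>i\<in>UNIV. \<Sum>j\<in>UNIV. str i j z * pd (d j) (U i) z)
        + 1/2 * (\<Sum>i\<in>UNIV. \<Sum>j\<in>UNIV. str i j z * pd (d i) (U j) z)"
      by (simp only: sum.distrib sum_distrib_left)
    also have "(\<Sum>i\<in>UNIV. \<Sum>j\<in>UNIV. str i j z * pd (d j) (U i) z)
        = (\<Sum>i\<in>UNIV. \<Sum>j\<in>UNIV. str i j z * pd (d i) (U j) z)"
      by (subst sum.swap) (simp only: sym)
    finally show ?thesis by (simp add: sum_distrib_left mult.assoc)
  qed
  have "(\<Sum>i\<in>UNIV. \<Sum>j\<in>UNIV. U j z * pd (d i) (\<lambda>x. 2 * E x * str i j x) z)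
    = (\<Sum>j\<in>UNIV. U j z * (\<Sum>i\<in>UNIV. pd (d i) (\<lambda>x. 2 * E x * str i j x) z))"
    unfolding sum_distrib_left by (rule sum.swap)
  then show ?thesis
    unfolding fl sum.distrib sum_subtractf str_sq
    by (simp add: dv_def sum_distrib_left sum_distrib_right power2_eq_square mult_ac)
qed

theorem local_energy_balance:
  assumes mass: "MD R + R z * dv z = 0"
    and phase: "R z * MD C = (\<Sum>i\<in>UNIV. pd (d i) (\<lambda>x. M x * pd (d i) \<mu> x) z)"
    and mom: "\<And>j. R z * MD (U j) = (\<Sum>i\<in>UNIV. pd (d i) (\<lambda>x. 2 * E x * str i j x) z)
      + pd (d j) (\<lambda>x. Lm x * dv x) z - pd (d j) P z
      - (\<Sum>i\<in>UNIV. pd (d i) (\<lambda>x. l * \<gamma>\<^sup>2 * R x * (pd (d i) C x * pd (d j) C x)) z)"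
    and pot: "\<mu> z = l * G' (C z) - l * \<gamma>\<^sup>2 / R z * (\<Sum>i\<in>UNIV. pd (d i) (\<lambda>x. R x * pd (d i) C x) z) + \<alpha> * P z"
    and compr: "\<alpha> * (R z * MD C) = dv z"
  shows "pd e0 (\<lambda>x. R x * ed x) z = (\<Sum>i\<in>UNIV. pd (d i) (flux i) z)
    - 2 * E z * (\<Sum>i\<in>UNIV. \<Sum>j\<in>UNIV. (str i j z)\<^sup>2) - Lm z * (dv z)\<^sup>2 - M z * (\<Sum>i\<in>UNIV. (pd (d i) \<mu> z)\<^sup>2)"
proof -
  let ?Ci = "\<lambda>i. pd (d i) C z"
  \<comment> \<open>\<open>H\<close> arises with a minus sign from the power of the capillary stress
    and with a plus sign from the convected gradient. \<open>Q * A\<close>, also from the stress,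
    completes the term \<open>Q * pd e0 C z\<close> of the flux to \<open>Q * MD C\<close>, the
    capillary part of the potential times the phase equation.\<close>
  define Q where "Q = (\<Sum>i\<in>UNIV. pd (d i) (\<lambda>x. R x * pd (d i) C x) z)"
  define A where "A = (\<Sum>j\<in>UNIV. U j z * ?Ci j)"
  define H where "H = (\<Sum>j\<in>UNIV. \<Sum>i\<in>UNIV. U j z * (?Ci i * pd (d i) (pd (d j) C) z))"
  have comm: "pd (d i) (pd (d j) C) z = pd (d j) (pd (d i) C) z" for i j
    by (rule Cinf_on_pd_commute[OF W z C])
  have ten: "pd (d i) (\<lambda>x. l * \<gamma>\<^sup>2 * R x * (pd (d i) C x * pd (d j) C x)) z
    = l * \<gamma>\<^sup>2 * pd (d i) (\<lambda>x. R x * pd (d i) C x) z * ?Ci j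
      + l * \<gamma>\<^sup>2 * R z * (?Ci i * pd (d i) (pd (d j) C) z)" for i j
  proof -
    have s: "Cinf_on W (\<lambda>x. R x * pd (d i) C x)" "Cinf_on W (\<lambda>x. l * \<gamma>\<^sup>2 * (R x * pd (d i) C x))"
      by (intro smooth_intros)+
    have eq: "(\<lambda>x. l * \<gamma>\<^sup>2 * R x * (pd (d i) C x * pd (d j) C x))
      = (\<lambda>x. (l * \<gamma>\<^sup>2 * (R x * pd (d i) C x)) * pd (d j) C x)" by (simp add: mult_ac)
    show ?thesis
      unfolding eq pd_mult[OF W z s(2) Cinf_on_pd[OF C]] pd_cmult[OF W z s(1)] by (simp add: algebra_simps)
  qed
  have ten_sum: "(\<Sum>j\<in>UNIV. U j z * (\<Sum>i\<in>UNIV. pd (d i) (\<lambda>x. l * \<gamma>\<^sup>2 * R x * (pd (d i) C x * pd (d j) C x)) z))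
    = l * \<gamma>\<^sup>2 * Q * A + l * \<gamma>\<^sup>2 * R z * H"
  proof -
    have "(\<Sum>j\<in>UNIV. U j z * (\<Sum>i\<in>UNIV. pd (d i) (\<lambda>x. l * \<gamma>\<^sup>2 * R x * (pd (d i) C x * pd (d j) C x)) z))
      = (\<Sum>j\<in>UNIV. l * \<gamma>\<^sup>2 * Q * (U j z * ?Ci j) + l * \<gamma>\<^sup>2 * R z * (\<Sum>i\<in>UNIV. U j z * (?Ci i * pd (d i) (pd (d j) C) z)))"
      unfolding ten Q_def
      by (intro sum.cong refl)
         (simp add: sum.distrib sum_distrib_left sum_distrib_right distrib_left mult_ac)
    then show ?thesis by (simp add: sum.distrib A_def H_def sum_distrib_left)
  qed
  have grad_sum: "(\<Sum>j\<in>UNIV. ?Ci j * MD (pd (d j) C)) = (\<Sum>i\<in>UNIV. ?Ci i * pd e0 (pd (d i) C) z) + H"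
  proof -
    have "(\<Sum>j\<in>UNIV. ?Ci j * (\<Sum>i\<in>UNIV. U i z * pd (d i) (pd (d j) C) z)) = H"
      unfolding H_def sum_distrib_left
      by (subst sum.swap, intro sum.cong refl) (subst comm, simp add: mult_ac)
    then show ?thesis by (simp add: MD_def distrib_left sum.distrib)
  qed
  have mom_sum: "R z * (\<Sum>j\<in>UNIV. U j z * MD (U j))
    = (\<Sum>j\<in>UNIV. U j z * (\<Sum>i\<in>UNIV. pd (d i) (\<lambda>x. 2 * E x * str i j x) z))
    + (\<Sum>j\<in>UNIV. U j z * pd (d j) (\<lambda>x. Lm x * dv x) z) - (\<Sum>j\<in>UNIV. U j z * pd (d j) P z)
    - (l * \<gamma>\<^sup>2 * Q * A + l * \<gamma>\<^sup>2 * R z * H)"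
  proof -
    have "R z * (\<Sum>j\<in>UNIV. U j z * MD (U j)) = (\<Sum>j\<in>UNIV. U j z * (R z * MD (U j)))"
      by (simp add: sum_distrib_left mult_ac)
    then show ?thesis
      unfolding mom ten_sum[symmetric] by (simp add: sum.distrib sum_subtractf distrib_left right_diff_distrib)
  qed
  have MDe: "pd e0 (\<lambda>x. R x * ed x) z + (\<Sum>j\<in>UNIV. U j z * pd (d j) (\<lambda>x. R x * ed x) z)
    = MD R * ed z + R z * MD ed"
    unfolding pd_mult[OF W z R smooth_ed] MD_def
    by (simp add: algebra_simps sum.distrib sum_distrib_left)
  have MDR: "MD R = - R z * dv z" using mass by simp
  have MDC: "MD C = pd e0 C z + A" by (simp add: MD_def A_def)
  have \<mu>N: "\<mu> z * (R z * MD C) = R z * l * G' (C z) * MD C - l * \<gamma>\<^sup>2 * Q * MD C + P z * dv z"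
    unfolding pot Q_def[symmetric] compr[symmetric] using R0 by (simp add: field_simps)
  have RMD: "R z * MD ed = R z * (\<Sum>j\<in>UNIV. U j z * MD (U j)) + R z * l * G' (C z) * MD C
      + l * \<gamma>\<^sup>2 * R z * (\<Sum>i\<in>UNIV. ?Ci i * pd e0 (pd (d i) C) z) + l * \<gamma>\<^sup>2 * R z * H"
    unfolding MD_ed grad_sum by (simp add: algebra_simps)
  have last: "l * \<gamma>\<^sup>2 * Q * MD C = l * \<gamma>\<^sup>2 * Q * pd e0 C z + l * \<gamma>\<^sup>2 * Q * A"
    unfolding MDC by (simp add: algebra_simps)
  \<comment> \<open>What remains is linear in the products; \<open>c1\<close> and \<open>c2\<close>
    only bring equal products to the same form.\<close>
  have c1: "pd e0 C z * (l * \<gamma>\<^sup>2 * Q) = l * \<gamma>\<^sup>2 * Q * pd e0 C z" by simp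
  have c2: "MD R * ed z = - (R z * ed z * dv z)" unfolding MDR by simp
  show ?thesis
    unfolding divergence_flux phase[symmetric] Q_def[symmetric] \<mu>N c1
    using MDe[unfolded c2 RMD mom_sum] last by linarith
qed

end


section \<open>Slip on the wall\<close>

text \<open>An orthonormal family with as many members as the dimension spans the space. The
  remainder of the expansion is orthogonal to all members, hence to itself.\<close>

lemma orthonormal_expansion:
  fixes e :: "'i \<Rightarrow> 'a::euclidean_space"
  assumes "finite I" "card I = DIM('a)"
    and e: "\<And>i j. i \<in> I \<Longrightarrow> j \<in> I \<Longrightarrow> e i \<bullet> e j = (if i = j then 1 else 0)"
  shows "v = (\<Sum>i\<in>I. (v \<bullet> e i) *\<^sub>R e i)"
proof -
  define w where "w = v - (\<Sum>i\<in>I. (v \<bullet> e i) *\<^sub>R e i)"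
  have w: "w \<bullet> e j = 0" if "j \<in> I" for j
  proof -
    have "(\<Sum>i\<in>I. (v \<bullet> e i) *\<^sub>R e i) \<bullet> e j = (\<Sum>i\<in>I. if i = j then v \<bullet> e j else 0)"
      unfolding inner_sum_left by (intro sum.cong refl) (use e that in auto)
    then show ?thesis using that assms(1) by (simp add: w_def inner_diff_left)
  qed
  have inj: "inj_on e I"
  proof (rule inj_onI, rule ccontr)
    fix i j assume ij: "i \<in> I" "j \<in> I" "e i = e j" "i \<noteq> j"
    then show False using e[of i j] e[of i i] by simp
  qed
  have "independent (e ` I)"
  proof (rule pairwise_orthogonal_independent)
    show "pairwise orthogonal (e ` I)"
      unfolding pairwise_def orthogonal_def using e by auto
    show "0 \<notin> e ` I" using e by force
  qed
  moreover have "card (e ` I) = DIM('a)" using inj assms(2) by (simp add: card_image)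
  ultimately have "UNIV \<subseteq> span (e ` I)"
    by (intro card_ge_dim_independent) auto
  then have "w \<in> span (e ` I)" by auto
  moreover have "orthogonal w y" if "y \<in> e ` I" for y
    using w that by (auto simp: orthogonal_def)
  ultimately have "orthogonal w w" by (rule orthogonal_to_span)
  then have "w = 0" by (simp add: orthogonal_def)
  then show ?thesis by (simp add: w_def)
qed

lemma tangent_frame_expansion:
  fixes n :: "real^'n \<Rightarrow> real^'n"
  assumes fr: "tangent_frame \<Gamma> n \<tau>" "x \<in> \<Gamma>" and n: "norm (n x) = 1" and v: "v \<bullet> n x = 0"
  shows "v = (\<Sum>i\<in>{1..<CARD('n)}. (v \<bullet> \<tau> i x) *\<^sub>R \<tau> i x)"
proof -
  \<comment> \<open>The frame is indexed from 1, so the index 0 is free for the normal; together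
    they form a full orthonormal basis.\<close>
  define e where "e i = (if i = 0 then n x else \<tau> i x)" for i
  have t: "\<tau> i x \<bullet> n x = 0" "\<And>j. j \<in> {1..<CARD('n)} \<Longrightarrow> \<tau> i x \<bullet> \<tau> j x = (if i = j then 1 else 0)"
    if "i \<in> {1..<CARD('n)}" for i
    using fr that unfolding tangent_frame_def by blast+
  have nn: "n x \<bullet> n x = 1" using n by (simp add: norm_eq_1)
  have "v = (\<Sum>i\<in>{..<CARD('n)}. (v \<bullet> e i) *\<^sub>R e i)"
  proof (rule orthonormal_expansion)
    show "e i \<bullet> e j = (if i = j then 1 else 0)" if "i \<in> {..<CARD('n)}" "j \<in> {..<CARD('n)}" for i j
    proof -
      have "n x \<bullet> \<tau> j x = 0" if "j \<noteq> 0"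
        using t(1)[of j] that \<open>j \<in> _\<close> by (simp add: inner_commute[of "n x"])
      then show ?thesis using t[of i] nn that by (auto simp: e_def)
    qed
  qed auto
  also have "{..<CARD('n)} = insert 0 {1..<CARD('n)}" by auto
  also have "(\<Sum>i\<in>insert 0 {1..<CARD('n)}. (v \<bullet> e i) *\<^sub>R e i) = (\<Sum>i\<in>{1..<CARD('n)}. (v \<bullet> e i) *\<^sub>R e i)"
    using v by (subst sum.insert) (auto simp: e_def)
  also have "\<dots> = (\<Sum>i\<in>{1..<CARD('n)}. (v \<bullet> \<tau> i x) *\<^sub>R \<tau> i x)"
    by (intro sum.cong) (auto simp: e_def)
  finally show ?thesis .
qed

text \<open>The slip law is known on frame vectors only. Multiples of the identity drop out there,
  since each frame vector is orthogonal to \<open>n x\<close>, and summing against the components of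
  \<open>v\<close> gives the power of the traction.\<close>

lemma wall_traction_power:
  fixes n :: "real^'n \<Rightarrow> real^'n" and A :: "real^'n^'n"
  assumes fr: "tangent_frame \<Gamma> n \<tau>" "x \<in> \<Gamma>" and n: "norm (n x) = 1" and v: "v \<bullet> n x = 0"
    and b: "b \<noteq> 0"
    and slip: "\<And>i. i \<in> {1..<CARD('n)} \<Longrightarrow>
      v \<bullet> \<tau> i x = inverse b * (- (n x \<bullet> ((A + a *\<^sub>R mat 1 - q *\<^sub>R mat 1) *v \<tau> i x)) + l * (\<tau> i x \<bullet> g))"
  shows "n x \<bullet> (A *v v) = l * (v \<bullet> g) - b * (norm v)\<^sup>2"
proof -
  let ?I = "{1..<CARD('n)}"
  have ex: "v = (\<Sum>i\<in>?I. (v \<bullet> \<tau> i x) *\<^sub>R \<tau> i x)" by (rule tangent_frame_expansion[OF fr n v])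
  have inner_v: "w \<bullet> v = (\<Sum>i\<in>?I. (v \<bullet> \<tau> i x) * (\<tau> i x \<bullet> w))" for w
    by (subst (1) ex) (simp add: inner_sum_right inner_commute)
  have tr: "n x \<bullet> (A *v \<tau> i x) = l * (\<tau> i x \<bullet> g) - b * (v \<bullet> \<tau> i x)" if "i \<in> ?I" for i
  proof -
    have "n x \<bullet> \<tau> i x = 0" using fr that unfolding tangent_frame_def by (metis inner_commute)
    then have "n x \<bullet> ((A + a *\<^sub>R mat 1 - q *\<^sub>R mat 1) *v \<tau> i x) = n x \<bullet> (A *v \<tau> i x)"
      by (simp add: matrix_vector_mult_add_rdistrib matrix_vector_mult_diff_rdistrib
          scaleR_matrix_vector_assoc[symmetric] inner_simps)
    then have "b * (v \<bullet> \<tau> i x) = - (n x \<bullet> (A *v \<tau> i x)) + l * (\<tau> i x \<bullet> g)"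
      using slip[OF that] b by (simp add: field_simps)
    then show ?thesis by simp
  qed
  have "n x \<bullet> (A *v v) = (n x v* A) \<bullet> v" by (simp add: dot_lmul_matrix)
  also have "\<dots> = (\<Sum>i\<in>?I. (v \<bullet> \<tau> i x) * (n x \<bullet> (A *v \<tau> i x)))"
    unfolding inner_v by (simp add: inner_commute[of "\<tau> _ x"] dot_lmul_matrix)
  also have "\<dots> = (\<Sum>i\<in>?I. l * ((v \<bullet> \<tau> i x) * (\<tau> i x \<bullet> g)) - b * ((v \<bullet> \<tau> i x) * (\<tau> i x \<bullet> v)))"
    by (intro sum.cong refl) (simp add: tr inner_commute[of v] algebra_simps)
  also have "\<dots> = l * (g \<bullet> v) - b * (v \<bullet> v)"
    unfolding inner_v sum_subtractf sum_distrib_left ..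
  finally show ?thesis by (simp add: inner_commute power2_norm_eq_inner)
qed


section \<open>Fields on space-time\<close>

lemma slice_has_derivative:
  assumes "F differentiable (at (t, x))"
  shows "((\<lambda>y. F (t, y)) has_derivative (\<lambda>v. pd (0, v) F (t, x))) (at x)"
  by (rule has_derivative_compose[where g = F and f = "\<lambda>y. (t, y)" and f' = "\<lambda>v. (0, v)"
        and g' = "frechet_derivative F (at (t, x))"])
     (use has_derivative_pd[OF assms] in \<open>auto intro!: derivative_eq_intros\<close>)

lemma slice_has_vector_derivative:
  assumes "F differentiable (at (t, x))"
  shows "((\<lambda>s. F (s, x)) has_vector_derivative pd (1, 0) F (t, x)) (at t)"
proof -
  have "((\<lambda>s. F (s, x)) has_derivative (\<lambda>r. pd (r, 0) F (t, x))) (at t)"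
    by (rule has_derivative_compose[where g = F and f = "\<lambda>s. (s, x)" and f' = "\<lambda>r. (r, 0)"
        and g' = "frechet_derivative F (at (t, x))"])
       (use has_derivative_pd[OF assms] in \<open>auto intro!: derivative_eq_intros\<close>)
  moreover have "(\<lambda>r. pd (r, 0) F (t, x)) = (\<lambda>r. r *\<^sub>R pd (1, 0) F (t, x))"
  proof
    fix r
    show "pd (r, 0) F (t, x) = r *\<^sub>R pd (1, 0) F (t, x)"
      using linear_scale[OF linear_frechet_derivative[OF assms], of r "(1, 0)"] by simp
  qed
  ultimately show ?thesis by (simp add: has_vector_derivative_def)
qed

lemma open_slice: "open W \<Longrightarrow> open {y. (t, y) \<in> W}"
  using open_vimage[of W "Pair t"] by (simp add: vimage_def continuous_on_Pair)

context
  fixes W :: "(real \<times> 'a::real_normed_vector) set" and t :: real and x :: 'a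
  assumes W: "open W" and z: "(t, x) \<in> W"
begin

text \<open>The equations differentiate sections at fixed time, the balance differentiates in
  space-time. Agreement is asked only where \<open>(t, y) \<in> W\<close>, because the chemical
  potential is identified with a smooth field only on \<open>W\<close>.\<close>

lemma pd_slice:
  assumes "Cinf_on W F" "\<And>y. (t, y) \<in> W \<Longrightarrow> f y = F (t, y)"
  shows "pd v f x = pd (0, v) F (t, x)"
proof (rule pd_eqI)
  have "((\<lambda>y. F (t, y)) has_derivative (\<lambda>v. pd (0, v) F (t, x))) (at x)"
    by (rule slice_has_derivative[OF Cinf_on_differentiable[OF assms(1) z]])
  then show "(f has_derivative (\<lambda>v. pd (0, v) F (t, x))) (at x)"
    by (rule has_derivative_transform_within_open[OF _ open_slice[OF W, of t]]) (use z assms(2) in auto)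
qed

lemma deriv_slice:
  fixes f :: "real \<Rightarrow> real"
  assumes "Cinf_on W F" "\<And>s. f s = F (s, x)"
  shows "(f has_real_derivative pd (1, 0) F (t, x)) (at t)"
proof -
  have "f = (\<lambda>s. F (s, x))" using assms(2) by (simp add: fun_eq_iff)
  then show ?thesis
    using slice_has_vector_derivative[OF Cinf_on_differentiable[OF assms(1) z]]
    by (simp add: has_real_derivative_iff_has_vector_derivative)
qed

end

lemma Ck_on_slice:
  fixes W :: "(real \<times> 'a::real_normed_vector) set"
  assumes "open W" "Cinf_on W F"
  shows "Ck_on (Suc 0) {y. (t, y) \<in> W} (\<lambda>y. F (t, y))"
proof -
  have "(\<lambda>y. F (t, y)) differentiable (at x)" if "(t, x) \<in> W" for x
    using slice_has_derivative[OF Cinf_on_differentiable[OF assms(2) that]] by (auto simp: differentiable_def)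
  moreover have "continuous_on {y. (t, y) \<in> W} (pd v (\<lambda>y. F (t, y)))" for v
  proof -
    have "continuous_on {y. (t, y) \<in> W} (\<lambda>y. pd (0, v) F (t, y))"
      by (rule continuous_on_compose2[OF Cinf_on_continuous_on[OF Cinf_on_pd[OF assms(2), of "(0, v)"]]])
         (auto intro!: continuous_intros)
    moreover have "pd (0, v) F (t, y) = pd v (\<lambda>y. F (t, y)) y" if "(t, y) \<in> W" for y
      by (rule pd_slice[OF assms(1) that assms(2) refl, symmetric])
    ultimately show ?thesis by (rule continuous_on_eq) simp
  qed
  ultimately show ?thesis by simp
qed

lemma continuous_on_slice:
  assumes "Cinf_on W F" "\<And>y. y \<in> K \<Longrightarrow> (t, y) \<in> W"
  shows "continuous_on K (\<lambda>y. F (t, y))"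
  by (rule continuous_on_compose2[OF Cinf_on_continuous_on[OF assms(1)]])
     (use assms(2) in \<open>auto intro!: continuous_intros\<close>)

text \<open>Turns the derivative along \<open>u\<close>, by which \<open>mat_deriv_vec\<close> is
  defined, into a sum of partial derivatives weighted by the components of \<open>u\<close>.\<close>

lemma pd_space_expand:
  fixes F :: "real \<times> (real^'n) \<Rightarrow> 'b::real_normed_vector"
  assumes "F differentiable (at z)"
  shows "pd (0, v) F z = (\<Sum>i\<in>UNIV. v $ i *\<^sub>R pd (0, axis i 1) F z)"
proof -
  have lin: "linear (frechet_derivative F (at z))" by (rule linear_frechet_derivative[OF assms])
  have "(\<Sum>i\<in>UNIV. v $ i *\<^sub>R (0::real, axis i (1::real))) = (0, \<Sum>i\<in>UNIV. v $ i *\<^sub>R axis i 1)"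
    by (induction rule: finite_induct[OF finite[of UNIV]]) (auto simp: zero_prod_def)
  also have "(\<Sum>i\<in>UNIV. v $ i *\<^sub>R axis i 1) = v"
    using basis_expansion[of v] by (simp add: scalar_mult_eq_scaleR)
  finally have "pd (0, v) F z = pd (\<Sum>i\<in>UNIV. v $ i *\<^sub>R (0::real, axis i (1::real))) F z" by simp
  also have "\<dots> = (\<Sum>i\<in>UNIV. v $ i *\<^sub>R pd (0, axis i 1) F z)"
    by (simp only: linear_sum[OF lin] linear_scale[OF lin])
  finally show ?thesis .
qed

lemma pd_component:
  fixes F :: "'a::real_normed_vector \<Rightarrow> real^'n"
  assumes "F differentiable (at z)"
  shows "pd v (\<lambda>x. F x $ j) z = pd v F z $ j"
  by (rule pd_eqI) (rule bounded_linear.has_derivative[OF bounded_linear_vec_nth has_derivative_pd[OF assms]])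

lemma norm_matrix_square: "(norm (A :: real^'n^'m))\<^sup>2 = (\<Sum>i\<in>UNIV. \<Sum>j\<in>UNIV. (A $ i $ j)\<^sup>2)"
  unfolding power2_norm_eq_inner by (simp add: inner_vec_def power2_eq_square)

lemma norm_vec_square: "(norm (v :: real^'n))\<^sup>2 = (\<Sum>i\<in>UNIV. (v $ i)\<^sup>2)"
  unfolding power2_norm_eq_inner by (simp add: inner_vec_def power2_eq_square)

lemma strain_nth:
  "strain u x $ i $ j = (1/2) * (pd (axis j 1) u x $ i + pd (axis i 1) u x $ j)"
  by (simp add: strain_def matrix_def transpose_def)

section \<open>Derivatives of the constitutive functions\<close>

lemma has_real_derivative_double_well:
  "(double_well has_real_derivative (1/2) * y * (1 - y)\<^sup>2 - (1/2) * y\<^sup>2 * (1 - y)) (at y)"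
  unfolding double_well_def[abs_def]
  by (auto intro!: derivative_eq_intros simp: power2_eq_square field_simps)

lemma has_real_derivative_wall_energy:
  "(wall_energy \<sigma> \<theta> has_real_derivative - (\<sigma>/2) * cos \<theta> * (cos ((2 * y - 1) * pi / 2) * pi)) (at y)"
  unfolding wall_energy_def[abs_def] by (auto intro!: derivative_eq_intros)

text \<open>For the density this is the relation
  \<open>\<rho>' = - \<alpha> * \<rho>\<^sup>2\<close>, the origin of the link between compression
  and change of composition.\<close>

lemma has_real_derivative_mixture:
  assumes "q1 > 0" "q2 > 0" "y / q1 + (1 - y) / q2 \<noteq> 0"
  shows "(mixture q1 q2 has_real_derivative - density_coeff q1 q2 * (mixture q1 q2 y)\<^sup>2) (at y)"
proof -
  define r where "r = y / q1 + (1 - y) / q2"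
  have "((\<lambda>y. 1 / (y / q1 + (1 - y) / q2)) has_real_derivative - (1 / q1 - 1 / q2) / r\<^sup>2) (at y)"
    using assms unfolding r_def by (auto intro!: derivative_eq_intros simp: power2_eq_square)
  moreover have "density_coeff q1 q2 = 1 / q1 - 1 / q2"
    using assms(1,2) by (simp add: density_coeff_def diff_frac_eq)
  ultimately show ?thesis
    unfolding mixture_def[abs_def] by (simp add: power_divide r_def)
qed

text \<open>Proved together because the derivative of each is, up to sign, the other.\<close>

lemma Ck_on_sin_cos: "Ck_on k UNIV (sin :: real \<Rightarrow> real) \<and> Ck_on k UNIV (cos :: real \<Rightarrow> real)"
proof (induction k)
  case 0
  then show ?case by (auto intro: continuous_intros)
next
  case (Suc k)
  have s: "(sin has_derivative (\<lambda>v. cos x * v)) (at x)" for x :: real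
    using DERIV_sin[of x] unfolding has_field_derivative_def .
  have c: "(cos has_derivative (\<lambda>v. - sin x * v)) (at x)" for x :: real
    using DERIV_cos[of x] unfolding has_field_derivative_def .
  have "Ck_on k UNIV (\<lambda>x. cos x * v)" "Ck_on k UNIV (\<lambda>x. - sin x * v)" for v :: real
    using Suc by (auto intro!: Ck_on_mult Ck_on_uminus Ck_on_const)
  moreover have "sin differentiable (at x)" "cos differentiable (at x)" for x :: real
    using s c unfolding differentiable_def by blast+
  ultimately show ?case by (simp add: pd_eqI[OF s] pd_eqI[OF c])
qed

lemma smooth_onE:
  assumes "smooth_on A f"
  obtains W where "open W" "A \<subseteq> W" "Cinf_on W f"
  using assms unfolding smooth_on_def Cinf_on_def by blast


section \<open>The energy law\<close>

theorem theorem2p2: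
  fixes \<Omega> :: "(real^'n) set"
    and n :: "real^'n \<Rightarrow> real^'n"
    and \<tau> :: "nat \<Rightarrow> real^'n \<Rightarrow> real^'n"
    and S :: "(real^'n) measure"
    and I :: "real set"
    and c p :: "real \<Rightarrow> real^'n \<Rightarrow> real"
    and u :: "real \<Rightarrow> real^'n \<Rightarrow> real^'n"
    and \<rho>1 \<rho>2 \<eta>1 \<eta>2 \<beta>1 \<beta>2 \<sigma> \<theta>s lamc \<gamma> \<alpha> :: real
    and \<rho> \<eta> lam \<beta> fw :: "real \<Rightarrow> real"
    and M M\<Gamma> \<mu> L :: "real \<Rightarrow> real^'n \<Rightarrow> real"
    and \<sigma>\<eta> :: "real \<Rightarrow> real^'n \<Rightarrow> real^'n^'n"
    and us :: "real \<Rightarrow> real^'n \<Rightarrow> real^'n"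
  assumes dim: "CARD('n) = 2 \<or> CARD('n) = 3"
    \<comment> \<open>geometry\<close>
    and \<Omega>: "C1_domain \<Omega>" "bounded \<Omega>"
    and n: "outward_unit_normal \<Omega> n"
    and \<tau>: "tangent_frame (frontier \<Omega>) n \<tau>"
    and S: "surface_measure (frontier \<Omega>) S"
    and I: "open I" "is_interval I"
    \<comment> \<open>material constants and coefficients\<close>
    and pos: "\<rho>1 > 0" "\<rho>2 > 0" "\<eta>1 > 0" "\<eta>2 > 0" "\<beta>1 > 0" "\<beta>2 > 0"
    and \<rho>: "\<rho> = mixture \<rho>1 \<rho>2"
    and \<eta>: "\<eta> = mixture \<eta>1 \<eta>2"
    and \<beta>: "\<beta> = mixture \<beta>1 \<beta>2"
    and \<alpha>: "\<alpha> = density_coeff \<rho>1 \<rho>2"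
    and fw: "fw = wall_energy \<sigma> \<theta>s"
    and \<rho>_pos: "\<And>t x. t \<in> I \<Longrightarrow> x \<in> closure \<Omega> \<Longrightarrow> \<rho> (c t x) > 0"
    and \<eta>_nz: "\<And>t x. t \<in> I \<Longrightarrow> x \<in> closure \<Omega> \<Longrightarrow> \<eta> (c t x) \<noteq> 0"
    and \<beta>_pos: "\<And>t x. t \<in> I \<Longrightarrow> x \<in> frontier \<Omega> \<Longrightarrow> \<beta> (c t x) > 0"
    and lam_smooth: "smooth_on {c t x | t x. t \<in> I \<and> x \<in> closure \<Omega>} lam"
    and M_smooth: "smooth_on (I \<times> closure \<Omega>) (\<lambda>(t, x). M t x)"
    and M\<Gamma>_cont: "continuous_on (I \<times> frontier \<Omega>) (\<lambda>(t, x). M\<Gamma> t x)"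
    \<comment> \<open>smoothness of the solution\<close>
    and c_smooth: "smooth_on (I \<times> closure \<Omega>) (\<lambda>(t, x). c t x)"
    and u_smooth: "smooth_on (I \<times> closure \<Omega>) (\<lambda>(t, x). u t x)"
    and p_smooth: "smooth_on (I \<times> closure \<Omega>) (\<lambda>(t, x). p t x)"
    \<comment> \<open>derived fields\<close>
    and \<mu>: "\<And>t x. \<mu> t x = lamc * deriv double_well (c t x)
              - lamc * \<gamma>\<^sup>2 / \<rho> (c t x) * divergence (\<lambda>y. \<rho> (c t y) *\<^sub>R grad (c t) y) x
              + \<alpha> * p t x"
    and L: "\<And>t x. L t x = \<rho> (c t x) * lamc * \<gamma>\<^sup>2 * (n x \<bullet> grad (c t) x) + deriv fw (c t x)"
    and \<sigma>\<eta>: "\<And>t x. \<sigma>\<eta> t x = (2 * \<eta> (c t x)) *\<^sub>R strain (u t) x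
              + (lam (c t x) * divergence (u t) x) *\<^sub>R mat 1 - p t x *\<^sub>R mat 1"
    and us: "\<And>t x. us t x = u t x - (u t x \<bullet> n x) *\<^sub>R n x"
    \<comment> \<open>equations in the domain\<close>
    and phase_eq: "\<And>t x. t \<in> I \<Longrightarrow> x \<in> \<Omega> \<Longrightarrow>
          \<rho> (c t x) * mat_deriv u c t x = divergence (\<lambda>y. M t y *\<^sub>R grad (\<mu> t) y) x"
    and mass_eq: "\<And>t x. t \<in> I \<Longrightarrow> x \<in> \<Omega> \<Longrightarrow>
          mat_deriv u (\<lambda>s y. \<rho> (c s y)) t x + \<rho> (c t x) * divergence (u t) x = 0"
    and momentum_eq: "\<And>t x. t \<in> I \<Longrightarrow> x \<in> \<Omega> \<Longrightarrow>
          \<rho> (c t x) *\<^sub>R mat_deriv_vec u u t x =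
            tensor_div (\<lambda>y. (2 * \<eta> (c t y)) *\<^sub>R strain (u t) y) x
            + grad (\<lambda>y. lam (c t y) * divergence (u t) y) x
            - grad (p t) x
            - tensor_div (\<lambda>y. (lamc * \<gamma>\<^sup>2 * \<rho> (c t y)) *\<^sub>R outer (grad (c t) y) (grad (c t) y)) x"
    \<comment> \<open>boundary conditions\<close>
    and wall_relax: "\<And>t x. t \<in> I \<Longrightarrow> x \<in> frontier \<Omega> \<Longrightarrow>
          surf_mat_deriv n u c t x = - M\<Gamma> t x * L t x"
    and no_flux: "\<And>t x. t \<in> I \<Longrightarrow> x \<in> frontier \<Omega> \<Longrightarrow> grad (\<mu> t) x \<bullet> n x = 0"
    and no_penetration: "\<And>t x. t \<in> I \<Longrightarrow> x \<in> frontier \<Omega> \<Longrightarrow> u t x \<bullet> n x = 0"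
    and slip: "\<And>t x i. t \<in> I \<Longrightarrow> x \<in> frontier \<Omega> \<Longrightarrow> i \<in> {1..<CARD('n)} \<Longrightarrow>
          us t x \<bullet> \<tau> i x = inverse (\<beta> (c t x)) *
            (- (n x \<bullet> (\<sigma>\<eta> t x *v \<tau> i x)) + L t x * (\<tau> i x \<bullet> grad (c t) x))"
    and t: "t \<in> I"
  shows "((\<lambda>t. (LINT x:\<Omega>|lborel. \<rho> (c t x) * (norm (u t x))\<^sup>2 / 2)
            + (LINT x:\<Omega>|lborel. lamc * \<rho> (c t x) *
                 (double_well (c t x) + \<gamma>\<^sup>2 / 2 * (norm (grad (c t) x))\<^sup>2))
            + (LINT x:frontier \<Omega>|S. fw (c t x)))
          has_real_derivative
            (- (LINT x:\<Omega>|lborel. 2 * \<eta> (c t x) * (norm (strain (u t) x))\<^sup>2)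
             - (LINT x:\<Omega>|lborel. lam (c t x) * \<bar>divergence (u t) x\<bar>\<^sup>2)
             - (LINT x:\<Omega>|lborel. M t x * (norm (grad (\<mu> t) x))\<^sup>2)
             - (LINT x:frontier \<Omega>|S. M\<Gamma> t x * \<bar>L t x\<bar>\<^sup>2
                   + \<beta> (c t x) * (norm (us t x))\<^sup>2))) (at t)"
proof -
  \<comment> \<open>Space axes and time axis as directions in space-time; the fields defined next
    are the given ones as functions of a space-time point.\<close>
  define d :: "'n \<Rightarrow> real \<times> (real^'n)" where "d i = (0, axis i 1)" for i
  define e0 :: "real \<times> (real^'n)" where "e0 = (1, 0)"
  define C where "C z = c (fst z) (snd z)" for z
  define P where "P z = p (fst z) (snd z)" for z
  define Mf where "Mf z = M (fst z) (snd z)" for z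
  define Uv where "Uv z = u (fst z) (snd z)" for z
  define U where "U j z = Uv z $ j" for j z
  define R where "R z = \<rho> (C z)" for z
  define E where "E z = \<eta> (C z)" for z
  define Lm where "Lm z = lam (C z)" for z
  have o\<Omega>: "open \<Omega>" using \<Omega>(1) by (simp add: C1_domain_def)
  have \<Omega>cl: "\<Omega> \<subseteq> closure \<Omega>" by (rule closure_subset)
  have \<Gamma>cl: "frontier \<Omega> \<subseteq> closure \<Omega>" by (simp add: frontier_def)
  have kcl: "compact (closure \<Omega>)" using \<Omega>(2) by (simp add: compact_closure)
  have sS: "sets S = sets borel" using S by (simp add: surface_measure_def)

  have eqC: "(\<lambda>(t, x). c t x) = C" and eqUv: "(\<lambda>(t, x). u t x) = Uv"
    and eqP: "(\<lambda>(t, x). p t x) = P" and eqMf: "(\<lambda>(t, x). M t x) = Mf"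
    by (simp_all add: fun_eq_iff C_def Uv_def P_def Mf_def)
  obtain Wc where Wc: "open Wc" "I \<times> closure \<Omega> \<subseteq> Wc" "Cinf_on Wc C"
    by (rule smooth_onE[OF c_smooth[unfolded eqC]])
  obtain Wu where Wu: "open Wu" "I \<times> closure \<Omega> \<subseteq> Wu" "Cinf_on Wu Uv"
    by (rule smooth_onE[OF u_smooth[unfolded eqUv]])
  obtain Wp where Wp: "open Wp" "I \<times> closure \<Omega> \<subseteq> Wp" "Cinf_on Wp P"
    by (rule smooth_onE[OF p_smooth[unfolded eqP]])
  obtain WM where WM: "open WM" "I \<times> closure \<Omega> \<subseteq> WM" "Cinf_on WM Mf"
    by (rule smooth_onE[OF M_smooth[unfolded eqMf]])
  obtain Wl where Wl: "open Wl" "{c t x | t x. t \<in> I \<and> x \<in> closure \<Omega>} \<subseteq> Wl" "Cinf_on Wl lam"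
    by (rule smooth_onE[OF lam_smooth])
  \<comment> \<open>\<open>V\<close> removes the values of \<open>c\<close> at which the rational
    laws for density and viscosity break down; \<open>W\<close> is restricted to points where
    \<open>c\<close> takes values in \<open>V\<close>.\<close>
  define V where "V = Wl \<inter> {y. y / \<rho>1 + (1 - y) / \<rho>2 \<noteq> 0} \<inter> {y. y / \<eta>1 + (1 - y) / \<eta>2 \<noteq> 0}"
  define W1 where "W1 = Wc \<inter> Wu \<inter> Wp \<inter> WM"
  define W where "W = W1 \<inter> C -` V"
  have "open V"
    unfolding V_def by (intro open_Int Wl open_Collect_neq continuous_intros) (use pos in auto)
  moreover have W1: "open W1" unfolding W1_def by (intro open_Int Wc Wu Wp WM)
  moreover have "continuous_on W1 C"
    by (rule continuous_on_subset[OF Cinf_on_continuous_on[OF Wc(3)]]) (auto simp: W1_def)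
  ultimately have W: "open W" unfolding W_def by (intro continuous_open_preimage)
  have inW: "(s, x) \<in> W" if "s \<in> I" "x \<in> closure \<Omega>" for s x
  proof -
    \<comment> \<open>A vanishing denominator would give the value \<open>1 / 0 = 0\<close>, so a
      nonzero mixture value excludes it.\<close>
    have "c s x / \<rho>1 + (1 - c s x) / \<rho>2 \<noteq> 0"
      using \<rho>_pos[OF that] unfolding \<rho> mixture_def by auto
    moreover have "c s x / \<eta>1 + (1 - c s x) / \<eta>2 \<noteq> 0"
      using \<eta>_nz[OF that] unfolding \<eta> mixture_def by auto
    moreover have "c s x \<in> Wl" using Wl(2) that by blast
    moreover have "(s, x) \<in> W1" using that Wc(2) Wu(2) Wp(2) WM(2) by (auto simp: W1_def)
    ultimately show ?thesis by (simp add: W_def V_def C_def)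
  qed
  have Cs: "Cinf_on W C" by (rule Cinf_on_subset[OF Wc(3)]) (auto simp: W_def W1_def)
  have Ps: "Cinf_on W P" by (rule Cinf_on_subset[OF Wp(3)]) (auto simp: W_def W1_def)
  have Ms: "Cinf_on W Mf" by (rule Cinf_on_subset[OF WM(3)]) (auto simp: W_def W1_def)
  have Uvs: "Cinf_on W Uv" by (rule Cinf_on_subset[OF Wu(3)]) (auto simp: W_def W1_def)
  have Us: "Cinf_on W (U j)" for j
    unfolding U_def[abs_def] by (rule Cinf_on_bounded_linear_comp[OF W bounded_linear_vec_nth Uvs])
  have Rnz: "C z / \<rho>1 + (1 - C z) / \<rho>2 \<noteq> 0" and Enz: "C z / \<eta>1 + (1 - C z) / \<eta>2 \<noteq> 0"
    and Cl: "C z \<in> Wl" if "z \<in> W" for z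
    using that by (auto simp: W_def V_def)
  have R0: "R z \<noteq> 0" if "z \<in> W" for z
    using Rnz[OF that] by (simp add: R_def \<rho> mixture_def)
  have Rs: "Cinf_on W R"
    unfolding R_def[abs_def] \<rho> mixture_def using pos Rnz
    by (intro Cinf_on_divide Cinf_on_add Cinf_on_diff Cinf_on_const W Cs) auto
  have Es: "Cinf_on W E"
    unfolding E_def[abs_def] \<eta> mixture_def using pos Enz
    by (intro Cinf_on_divide Cinf_on_add Cinf_on_diff Cinf_on_const W Cs) auto
  have Ls: "Cinf_on W Lm"
    unfolding Lm_def[abs_def] by (rule Cinf_on_compose_real[OF W Cl Wl(3) Cs])
  have dw: "deriv double_well y = (1/2) * y * (1 - y)\<^sup>2 - (1/2) * y\<^sup>2 * (1 - y)" for y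
    by (rule DERIV_imp_deriv[OF has_real_derivative_double_well])
  have Gs: "Cinf_on W (\<lambda>z. double_well (C z))"
    unfolding double_well_def
    by (intro Cinf_on_mult Cinf_on_power Cinf_on_diff Cinf_on_const W Cs)
  have fws: "Cinf_on W (\<lambda>z. fw (C z))"
  proof -
    have "Cinf_on UNIV (sin :: real \<Rightarrow> real)" using Ck_on_sin_cos by (simp add: Cinf_on_def)
    then have "Cinf_on W (\<lambda>z. sin ((2 * C z - 1) * pi / 2))"
      by (intro Cinf_on_compose_real[OF W, where h = sin and V = UNIV] Cinf_on_divide Cinf_on_mult
          Cinf_on_diff Cinf_on_const W Cs) auto
    then show ?thesis
      unfolding fw wall_energy_def by (intro Cinf_on_mult Cinf_on_const W)
  qed
  \<comment> \<open>The chemical potential as a space-time field, with all derivatives taken in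
    space-time; it is smooth on \<open>W\<close> and agrees with \<open>\<mu>\<close> there.\<close>
  define pot where "pot z = lamc * deriv double_well (C z)
      - lamc * \<gamma>\<^sup>2 / R z * (\<Sum>i\<in>UNIV. pd (d i) (\<lambda>z. R z * pd (d i) C z) z) + \<alpha> * P z" for z
  have pots: "Cinf_on W pot"
    unfolding pot_def[abs_def] dw using R0
    by (intro Cinf_on_add Cinf_on_diff Cinf_on_mult Cinf_on_divide Cinf_on_power Cinf_on_sum Cinf_on_pd
        Cinf_on_const W Cs Rs Ps) auto
  have loc: "energy_fields W z C P R E Lm Mf pot U double_well (deriv double_well)" if "z \<in> W" for z
    using that has_real_derivative_double_well
    by unfold_locales (simp_all add: W Cs Ps Rs Es Ls Ms pots Us Gs R0 dw)
  \<comment> \<open>\<open>dv\<close>, \<open>str\<close>, \<open>ed\<close> and \<open>flux\<close>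
    do not depend on the point of the locale, so one interpretation at an arbitrary point provides
    them with their smoothness on \<open>W\<close>.\<close>
  obtain x0 where "x0 \<in> \<Omega>" using \<Omega>(1) by (auto simp: C1_domain_def)
  then have "(t, x0) \<in> W" using inW t \<Omega>cl by blast
  then interpret ef: energy_fields W "(t, x0)" e0 d C P R E Lm Mf pot U double_well "deriv double_well" lamc \<gamma> \<alpha>
    by (rule loc)

  have sl: "pd (axis i 1) f x = pd (d i) F (s, x)"
    if "(s, x) \<in> W" "Cinf_on W F" "\<And>y. (s, y) \<in> W \<Longrightarrow> f y = F (s, y)" for f F i s and x :: "real^'n"
    unfolding d_def by (rule pd_slice[OF W that])
  have gradC: "grad (c s) x $ i = pd (d i) C (s, x)" if "(s, x) \<in> W" for s x i
    unfolding grad_nth by (rule sl[OF that Cs]) (simp add: C_def)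
  have mu: "\<mu> s x = pot (s, x)" if z: "(s, x) \<in> W" for s x
  proof -
    have "divergence (\<lambda>y. \<rho> (c s y) *\<^sub>R grad (c s) y) x = (\<Sum>i\<in>UNIV. pd (d i) (\<lambda>z. R z * pd (d i) C z) (s, x))"
      unfolding divergence_def grad_nth
      by (intro sum.cong refl sl[OF z] ef.smooth_intros) (simp add: R_def C_def gradC)
    then show ?thesis unfolding \<mu> pot_def by (simp add: C_def R_def P_def)
  qed
  have gradmu: "grad (\<mu> s) x $ i = pd (d i) pot (s, x)" if "(s, x) \<in> W" for s x i
    unfolding grad_nth by (rule sl[OF that pots mu])
  have pdu: "pd (axis i 1) (u s) x $ j = pd (d i) (U j) (s, x)" if z: "(s, x) \<in> W" for s x i j
  proof -
    have "pd (axis i 1) (u s) x = pd (d i) Uv (s, x)"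
      unfolding d_def by (rule pd_slice[OF W z Uvs]) (simp add: Uv_def)
    then show ?thesis
      unfolding U_def[abs_def] by (simp add: pd_component[OF Cinf_on_differentiable[OF Uvs z]])
  qed
  have strn: "strain (u s) x $ i $ j = ef.str i j (s, x)" if "(s, x) \<in> W" for s x i j
    unfolding strain_nth ef.str_def pdu[OF that] ..
  have dvn: "divergence (u s) x = ef.dv (s, x)" if "(s, x) \<in> W" for s x
    unfolding divergence_def grad_nth ef.dv_def
    by (intro sum.cong refl sl[OF that Us]) (simp add: U_def Uv_def)
  have matd: "mat_deriv u f s x = pd e0 F (s, x) + (\<Sum>i\<in>UNIV. U i (s, x) * pd (d i) F (s, x))"
    if z: "(s, x) \<in> W" and F: "Cinf_on W F" "\<And>s y. f s y = F (s, y)" for f F s x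
  proof -
    have "deriv (\<lambda>s. f s x) s = pd e0 F (s, x)"
      unfolding e0_def by (intro DERIV_imp_deriv deriv_slice[OF W z F(1)] F(2))
    moreover have "grad (f s) x $ i = pd (d i) F (s, x)" for i
      unfolding grad_nth by (rule sl[OF z F])
    ultimately show ?thesis by (simp add: mat_deriv_def inner_vec_def U_def Uv_def)
  qed
  have matdu: "mat_deriv_vec u u s x $ j = pd e0 (U j) (s, x) + (\<Sum>i\<in>UNIV. U i (s, x) * pd (d i) (U j) (s, x))"
    if z: "(s, x) \<in> W" for s x j
  proof -
    note du = Cinf_on_differentiable[OF Uvs z]
    have "((\<lambda>s. u s x) has_vector_derivative pd e0 Uv (s, x)) (at s)"
      using slice_has_vector_derivative[OF du] by (simp add: Uv_def e0_def)
    then have "vector_derivative (\<lambda>s. u s x) (at s) = pd e0 Uv (s, x)" by (rule vector_derivative_at)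
    moreover have "pd (u s x) (u s) x = pd (0, u s x) Uv (s, x)"
      by (rule pd_slice[OF W z Uvs]) (simp add: Uv_def)
    then have "pd (u s x) (u s) x = (\<Sum>i\<in>UNIV. u s x $ i *\<^sub>R pd (d i) Uv (s, x))"
      unfolding d_def pd_space_expand[OF du, of "u s x"] .
    ultimately show ?thesis
      unfolding mat_deriv_vec_def U_def[abs_def] pd_component[OF du] by (simp add: Uv_def)
  qed
  have tdiv: "tensor_div T x $ j = (\<Sum>i\<in>UNIV. pd (d i) (F i) (s, x))"
    if z: "(s, x) \<in> W" and F: "\<And>i. Cinf_on W (F i)" "\<And>i y. (s, y) \<in> W \<Longrightarrow> T y $ i $ j = F i (s, y)" for T F s x j
    unfolding tensor_div_def divergence_def grad_nth vec_lambda_beta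
    by (intro sum.cong refl sl[OF z F(1)]) (simp add: column_def F(2))

  have balance: "pd e0 (\<lambda>z. R z * ef.ed z) (s, x) = (\<Sum>i\<in>UNIV. pd (d i) (ef.flux i) (s, x))
      - 2 * E (s, x) * (\<Sum>i\<in>UNIV. \<Sum>j\<in>UNIV. (ef.str i j (s, x))\<^sup>2) - Lm (s, x) * (ef.dv (s, x))\<^sup>2
      - Mf (s, x) * (\<Sum>i\<in>UNIV. (pd (d i) pot (s, x))\<^sup>2)"
    if s: "s \<in> I" and x: "x \<in> \<Omega>" for s x
  proof -
    have z: "(s, x) \<in> W" using inW s x \<Omega>cl by blast
    interpret z: energy_fields W "(s, x)" e0 d C P R E Lm Mf pot U double_well "deriv double_well" lamc \<gamma> \<alpha>
      by (rule loc[OF z])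
    have mdC: "mat_deriv u c s x = z.MD C"
      unfolding z.MD_def by (rule matd[OF z Cs]) (simp add: C_def)
    have mdR: "mat_deriv u (\<lambda>s y. \<rho> (c s y)) s x = z.MD R"
      unfolding z.MD_def by (rule matd[OF z Rs]) (simp add: R_def C_def)
    have mass: "z.MD R + R (s, x) * ef.dv (s, x) = 0"
      using mass_eq[OF s x] unfolding mdR dvn[OF z] by (simp add: R_def C_def)
    have phase: "R (s, x) * z.MD C = (\<Sum>i\<in>UNIV. pd (d i) (\<lambda>z. Mf z * pd (d i) pot z) (s, x))"
    proof -
      have "divergence (\<lambda>y. M s y *\<^sub>R grad (\<mu> s) y) x = (\<Sum>i\<in>UNIV. pd (d i) (\<lambda>z. Mf z * pd (d i) pot z) (s, x))"
        unfolding divergence_def grad_nth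
        by (intro sum.cong refl sl[OF z] ef.smooth_intros) (simp add: Mf_def gradmu)
      then show ?thesis using phase_eq[OF s x] unfolding mdC by (simp add: R_def C_def)
    qed
    \<comment> \<open>The density is a function of \<open>C\<close> alone, so all its derivatives
      are proportional to those of \<open>C\<close>. Mass conservation, divided by the nonzero
      density, then becomes \<open>compr\<close>.\<close>
    have pdR: "pd v R (s, x) = - \<alpha> * (R (s, x))\<^sup>2 * pd v C (s, x)" for v
      unfolding R_def[abs_def] \<rho> \<alpha>
      by (rule pd_compose_real[OF W z Cs]) (rule has_real_derivative_mixture[OF pos(1,2) Rnz[OF z]])
    have "z.MD R = - \<alpha> * (R (s, x))\<^sup>2 * z.MD C"
      unfolding z.MD_def pdR by (simp add: distrib_left sum_distrib_left mult_ac sum_negf)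
    with mass have "R (s, x) * (\<alpha> * (R (s, x) * z.MD C)) = R (s, x) * ef.dv (s, x)"
      by (auto simp: power2_eq_square algebra_simps)
    then have compr: "\<alpha> * (R (s, x) * z.MD C) = ef.dv (s, x)" using R0[OF z] by simp
    have mom: "R (s, x) * z.MD (U j) = (\<Sum>i\<in>UNIV. pd (d i) (\<lambda>z. 2 * E z * ef.str i j z) (s, x))
        + pd (d j) (\<lambda>z. Lm z * ef.dv z) (s, x) - pd (d j) P (s, x)
        - (\<Sum>i\<in>UNIV. pd (d i) (\<lambda>z. lamc * \<gamma>\<^sup>2 * R z * (pd (d i) C z * pd (d j) C z)) (s, x))" for j
    proof -
      have 1: "tensor_div (\<lambda>y. (2 * \<eta> (c s y)) *\<^sub>R strain (u s) y) x $ j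
          = (\<Sum>i\<in>UNIV. pd (d i) (\<lambda>z. 2 * E z * ef.str i j z) (s, x))"
        by (rule tdiv[OF z]) (intro ef.smooth_intros, simp add: strn E_def C_def)
      have 2: "tensor_div (\<lambda>y. (lamc * \<gamma>\<^sup>2 * \<rho> (c s y)) *\<^sub>R outer (grad (c s) y) (grad (c s) y)) x $ j
          = (\<Sum>i\<in>UNIV. pd (d i) (\<lambda>z. lamc * \<gamma>\<^sup>2 * R z * (pd (d i) C z * pd (d j) C z)) (s, x))"
      proof (rule tdiv[OF z])
        show "((lamc * \<gamma>\<^sup>2 * \<rho> (c s y)) *\<^sub>R outer (grad (c s) y) (grad (c s) y)) $ i $ j
          = lamc * \<gamma>\<^sup>2 * R (s, y) * (pd (d i) C (s, y) * pd (d j) C (s, y))" if "(s, y) \<in> W" for i y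
          using gradC[OF that] by (simp add: outer_def R_def C_def)
      qed (intro ef.smooth_intros)
      have 3: "grad (\<lambda>y. lam (c s y) * divergence (u s) y) x $ j = pd (d j) (\<lambda>z. Lm z * ef.dv z) (s, x)"
        unfolding grad_nth by (rule sl[OF z]) (intro ef.smooth_intros, simp add: dvn Lm_def C_def)
      have 4: "grad (p s) x $ j = pd (d j) P (s, x)"
        unfolding grad_nth by (rule sl[OF z Ps]) (simp add: P_def)
      have "R (s, x) * z.MD (U j) = (\<rho> (c s x) *\<^sub>R mat_deriv_vec u u s x) $ j"
        unfolding z.MD_def by (simp add: matdu[OF z] R_def C_def)
      then show ?thesis
        unfolding momentum_eq[OF s x] by (simp add: 1 2 3 4)
    qed
    show ?thesis
      by (rule z.local_energy_balance[OF mass phase mom _ compr]) (simp add: pot_def)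
  qed

  \<comment> \<open>The bulk energy \<open>R z * ef.ed z\<close> is split as in the claim into the
    kinetic part \<open>F1\<close> and the mixing part \<open>F2\<close>; \<open>F3\<close> is the
    wall energy.\<close>
  define F1 where "F1 z = R z * ((1/2) * (\<Sum>j\<in>UNIV. U j z * U j z))" for z
  define F2 where "F2 z = R z * (lamc * (double_well (C z) + \<gamma>\<^sup>2 / 2 * (\<Sum>j\<in>UNIV. pd (d j) C z * pd (d j) C z)))" for z
  define F3 where "F3 z = fw (C z)" for z
  have F1s: "Cinf_on W F1" and F2s: "Cinf_on W F2"
    unfolding F1_def[abs_def] F2_def[abs_def] by (intro ef.smooth_intros)+
  have F3s: "Cinf_on W F3" unfolding F3_def[abs_def] by (rule fws)
  have F1e: "\<rho> (c s x) * (norm (u s x))\<^sup>2 / 2 = F1 (s, x)" for s x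
    unfolding norm_vec_square by (simp add: F1_def R_def C_def U_def Uv_def power2_eq_square)
  have F2e: "lamc * \<rho> (c s x) * (double_well (c s x) + \<gamma>\<^sup>2 / 2 * (norm (grad (c s) x))\<^sup>2) = F2 (s, x)"
    if "(s, x) \<in> W" for s x
    unfolding norm_vec_square gradC[OF that] by (simp add: F2_def R_def C_def power2_eq_square)
  have fin\<Omega>: "emeasure lborel \<Omega> < \<infinity>" using emeasure_bounded_finite[OF \<Omega>(2)] by simp
  have fin\<Gamma>: "emeasure S (frontier \<Omega>) < \<infinity>" by (rule emeasure_frontier_finite[OF \<Omega> S])
  \<comment> \<open>Serves bulk and wall alike: continuity is taken on the compact
    \<open>closure \<Omega>\<close>, which contains both \<open>\<Omega>\<close> and its
    boundary.\<close>
  have diff_int: "((\<lambda>s. LINT x:A|N. f s x) has_real_derivative (LINT x:A|N. pd e0 F (t, x))) (at t)"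
    if F: "Cinf_on W F" and N: "sets N = sets borel" "emeasure N A < \<infinity>" and A: "A \<in> sets borel" "A \<subseteq> closure \<Omega>"
      and f: "\<And>s x. s \<in> I \<Longrightarrow> x \<in> closure \<Omega> \<Longrightarrow> f s x = F (s, x)" for F f A and N :: "(real^'n) measure"
  proof -
    have "((\<lambda>s. LINT x:A|N. F (s, x)) has_real_derivative (LINT x:A|N. pd e0 F (t, x))) (at t)"
    proof (rule has_real_derivative_set_lebesgue_integral[OF N A kcl I(1) t])
      show "continuous_on (closure \<Omega>) (\<lambda>x. F (s, x))" if "s \<in> I" for s
        by (rule continuous_on_slice[OF F]) (rule inW[OF that])
      show "continuous_on (I \<times> closure \<Omega>) (\<lambda>(s, x). pd e0 F (s, x))"
      proof -
        have eq: "(\<lambda>(s, x). pd e0 F (s, x)) = (\<lambda>z. pd e0 F z)" by (simp add: fun_eq_iff)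
        show ?thesis
          unfolding eq by (rule continuous_on_subset[OF Cinf_on_continuous_on[OF Cinf_on_pd[OF F]]]) (use inW in auto)
      qed
      show "((\<lambda>s. F (s, x)) has_real_derivative pd e0 F (s, x)) (at s)" if "s \<in> I" "x \<in> A" for s x
        unfolding e0_def by (rule deriv_slice[OF W _ F refl]) (use inW that A in blast)
    qed
    then show ?thesis
    proof (rule has_field_derivative_transform_within_open[OF _ I(1) t])
      show "(LINT x:A|N. F (s, x)) = (LINT x:A|N. f s x)" if "s \<in> I" for s
        by (rule set_lebesgue_integral_cong) (use N A f[OF that] in auto)
    qed
  qed
  have energy_deriv: "((\<lambda>t. (LINT x:\<Omega>|lborel. \<rho> (c t x) * (norm (u t x))\<^sup>2 / 2)
            + (LINT x:\<Omega>|lborel. lamc * \<rho> (c t x) * (double_well (c t x) + \<gamma>\<^sup>2 / 2 * (norm (grad (c t) x))\<^sup>2))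
            + (LINT x:frontier \<Omega>|S. fw (c t x)))
     has_real_derivative (LINT x:\<Omega>|lborel. pd e0 F1 (t, x)) + (LINT x:\<Omega>|lborel. pd e0 F2 (t, x))
        + (LINT x:frontier \<Omega>|S. pd e0 F3 (t, x))) (at t)"
  proof (intro DERIV_add)
    show "((\<lambda>t. LINT x:\<Omega>|lborel. \<rho> (c t x) * (norm (u t x))\<^sup>2 / 2) has_real_derivative
        (LINT x:\<Omega>|lborel. pd e0 F1 (t, x))) (at t)"
      by (rule diff_int[OF F1s _ fin\<Omega>]) (use o\<Omega> \<Omega>cl F1e in auto)
    show "((\<lambda>t. LINT x:\<Omega>|lborel. lamc * \<rho> (c t x) * (double_well (c t x) + \<gamma>\<^sup>2 / 2 * (norm (grad (c t) x))\<^sup>2))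
        has_real_derivative (LINT x:\<Omega>|lborel. pd e0 F2 (t, x))) (at t)"
      by (rule diff_int[OF F2s _ fin\<Omega>]) (use o\<Omega> \<Omega>cl F2e inW in auto)
    show "((\<lambda>t. LINT x:frontier \<Omega>|S. fw (c t x)) has_real_derivative
        (LINT x:frontier \<Omega>|S. pd e0 F3 (t, x))) (at t)"
      by (rule diff_int[OF F3s sS fin\<Gamma>]) (use \<Gamma>cl frontier_closed in \<open>auto simp: F3_def C_def\<close>)
  qed
  have int\<Omega>: "set_integrable lborel \<Omega> (\<lambda>x. F (t, x))" if "Cinf_on W F" for F :: "real \<times> (real^'n) \<Rightarrow> real"
    by (rule set_integrable_continuous_compact[OF _ fin\<Omega> _ \<Omega>cl kcl])
       (use o\<Omega> continuous_on_slice[OF that] inW[OF t] in auto)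
  have int\<Gamma>: "set_integrable S (frontier \<Omega>) (\<lambda>x. F (t, x))" if "Cinf_on W F" for F :: "real \<times> (real^'n) \<Rightarrow> real"
    by (rule set_integrable_continuous_compact[OF sS fin\<Gamma> _ \<Gamma>cl kcl])
       (use frontier_closed continuous_on_slice[OF that] inW[OF t] in auto)
  \<comment> \<open>The flux at the fixed time \<open>t\<close>, continuously differentiable near
    \<open>closure \<Omega>\<close> and hence admissible in the divergence theorem.\<close>
  define B where "B x = (\<chi> i. ef.flux i (t, x))" for x
  define F4 where "F4 z = 2 * E z * (\<Sum>i\<in>UNIV. \<Sum>j\<in>UNIV. (ef.str i j z)\<^sup>2)" for z
  define F5 where "F5 z = Lm z * (ef.dv z)\<^sup>2" for z
  define F6 where "F6 z = Mf z * (\<Sum>i\<in>UNIV. (pd (d i) pot z)\<^sup>2)" for z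
  have F456: "Cinf_on W F4" "Cinf_on W F5" "Cinf_on W F6"
    unfolding F4_def[abs_def] F5_def[abs_def] F6_def[abs_def]
    by (intro ef.smooth_intros Cinf_on_power[OF W])+
  have Wt: "open {y. (t, y) \<in> W}" "closure \<Omega> \<subseteq> {y. (t, y) \<in> W}"
    using open_slice[OF W] inW[OF t] by auto
  have "Ck_on (Suc 0) {y. (t, y) \<in> W} (\<lambda>x. B x $ i)" for i
    unfolding B_def vec_lambda_beta by (rule Ck_on_slice[OF W ef.smooth_flux])
  note div = divergence_theorem[OF \<Omega> n S Wt this]
  have divB: "divergence B x = (\<Sum>i\<in>UNIV. pd (d i) (ef.flux i) (t, x))" if "(t, x) \<in> W" for x
    unfolding divergence_def grad_nth by (intro sum.cong refl sl[OF that ef.smooth_flux]) (simp add: B_def)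
  have bulk: "pd e0 F1 (t, x) + pd e0 F2 (t, x) = divergence B x - F4 (t, x) - F5 (t, x) - F6 (t, x)"
    if "x \<in> \<Omega>" for x
  proof -
    have z: "(t, x) \<in> W" using inW t that \<Omega>cl by blast
    have "(\<lambda>z. R z * ef.ed z) = (\<lambda>z. F1 z + F2 z)"
      by (simp add: fun_eq_iff F1_def F2_def ef.ed_def distrib_left)
    then have "pd e0 F1 (t, x) + pd e0 F2 (t, x) = pd e0 (\<lambda>z. R z * ef.ed z) (t, x)"
      using pd_add[OF W z F1s F2s] by simp
    then show ?thesis
      using balance[OF t that] by (simp add: divB[OF z] F4_def F5_def F6_def)
  qed
  have "(LINT x:\<Omega>|lborel. pd e0 F1 (t, x)) + (LINT x:\<Omega>|lborel. pd e0 F2 (t, x))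
      = (LINT x:\<Omega>|lborel. pd e0 F1 (t, x) + pd e0 F2 (t, x))"
    by (intro set_integral_add(2)[symmetric] int\<Omega> Cinf_on_pd F1s F2s)
  also have "\<dots> = (LINT x:\<Omega>|lborel. divergence B x - F4 (t, x) - F5 (t, x) - F6 (t, x))"
    by (rule set_lebesgue_integral_cong) (use o\<Omega> bulk in auto)
  also have "\<dots> = (LINT x:\<Omega>|lborel. divergence B x) - (LINT x:\<Omega>|lborel. F4 (t, x))
      - (LINT x:\<Omega>|lborel. F5 (t, x)) - (LINT x:\<Omega>|lborel. F6 (t, x))"
    by (simp add: set_integral_diff int\<Omega> F456 div(2))
  finally have vol: "(LINT x:\<Omega>|lborel. pd e0 F1 (t, x)) + (LINT x:\<Omega>|lborel. pd e0 F2 (t, x)) = \<dots>" .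
  have wall: "B x \<bullet> n x + pd e0 F3 (t, x) = - (M\<Gamma> t x * \<bar>L t x\<bar>\<^sup>2 + \<beta> (c t x) * (norm (us t x))\<^sup>2)"
    if x: "x \<in> frontier \<Omega>" for x
  proof -
    have z: "(t, x) \<in> W" using inW t x \<Gamma>cl by blast
    let ?z = "(t, x)" and ?g = "grad (c t) x" and ?v = "u t x"
    let ?A = "(2 * \<eta> (c t x)) *\<^sub>R strain (u t) x"
    have vn: "?v \<bullet> n x = 0" by (rule no_penetration[OF t x])
    have usv: "us t x = ?v" by (simp add: us vn)
    have n1: "norm (n x) = 1" by (rule norm_outward_unit_normal[OF \<Omega>(1) n x])
    have dtc: "deriv (\<lambda>s. c s x) t = pd e0 C ?z"
      unfolding e0_def by (intro DERIV_imp_deriv deriv_slice[OF W z Cs]) (simp add: C_def)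
    \<comment> \<open>Without penetration \<open>u\<close> is tangential, so its product with the
      surface gradient is that with the full gradient.\<close>
    have relax: "pd e0 C ?z = - M\<Gamma> t x * L t x - ?v \<bullet> ?g"
      using wall_relax[OF t x] vn unfolding surf_mat_deriv_def surf_grad_def dtc
      by (simp add: inner_diff_right)
    have traction: "n x \<bullet> (?A *v ?v) = L t x * (?v \<bullet> ?g) - \<beta> (c t x) * (norm ?v)\<^sup>2"
    proof (rule wall_traction_power[OF \<tau> x n1 vn])
      show "\<beta> (c t x) \<noteq> 0" using \<beta>_pos[OF t x] by simp
      show "?v \<bullet> \<tau> i x = inverse (\<beta> (c t x)) * (- (n x \<bullet> ((?A + (lam (c t x) * divergence (u t) x) *\<^sub>R mat 1
          - p t x *\<^sub>R mat 1) *v \<tau> i x)) + L t x * (\<tau> i x \<bullet> ?g))" if "i \<in> {1..<CARD('n)}" for i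
        using slip[OF t x that] unfolding usv \<sigma>\<eta> .
    qed
    have "B x \<bullet> n x = pot ?z * Mf ?z * (\<Sum>i\<in>UNIV. pd (d i) pot ?z * n x $ i)
        + lamc * \<gamma>\<^sup>2 * R ?z * pd e0 C ?z * (\<Sum>i\<in>UNIV. pd (d i) C ?z * n x $ i)
        + (\<Sum>i\<in>UNIV. (\<Sum>j\<in>UNIV. 2 * E ?z * ef.str i j ?z * U j ?z) * n x $ i)
        + (Lm ?z * ef.dv ?z - P ?z - R ?z * ef.ed ?z) * (\<Sum>i\<in>UNIV. U i ?z * n x $ i)"
    proof -
      have "B x $ i * n x $ i = pot ?z * Mf ?z * (pd (d i) pot ?z * n x $ i)
        + lamc * \<gamma>\<^sup>2 * R ?z * pd e0 C ?z * (pd (d i) C ?z * n x $ i)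
        + (\<Sum>j\<in>UNIV. 2 * E ?z * ef.str i j ?z * U j ?z) * n x $ i
        + (Lm ?z * ef.dv ?z - P ?z - R ?z * ef.ed ?z) * (U i ?z * n x $ i)" for i
        unfolding B_def ef.flux_def vec_lambda_beta by (simp add: algebra_simps)
      then show ?thesis
        unfolding inner_vec_def inner_real_def by (simp only: sum.distrib sum_distrib_left)
    qed
    \<comment> \<open>The no-flux condition removes diffusion; the vanishing normal velocity removes
      bulk viscosity, pressure and convection together.\<close>
    also have "(\<Sum>i\<in>UNIV. pd (d i) pot ?z * n x $ i) = grad (\<mu> t) x \<bullet> n x"
      by (simp add: inner_vec_def gradmu[OF z])
    also have "\<dots> = 0" by (rule no_flux[OF t x])
    also have "(\<Sum>i\<in>UNIV. pd (d i) C ?z * n x $ i) = n x \<bullet> ?g"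
      by (simp add: inner_vec_def gradC[OF z] mult.commute)
    also have "(\<Sum>i\<in>UNIV. U i ?z * n x $ i) = 0"
      using vn by (simp add: inner_vec_def U_def Uv_def)
    also have "(\<Sum>i\<in>UNIV. (\<Sum>j\<in>UNIV. 2 * E ?z * ef.str i j ?z * U j ?z) * n x $ i) = n x \<bullet> (?A *v ?v)"
      by (simp add: inner_vec_def matrix_vector_mult_def strn[OF z] U_def Uv_def E_def C_def mult_ac)
    finally have Bn: "B x \<bullet> n x = lamc * \<gamma>\<^sup>2 * R ?z * pd e0 C ?z * (n x \<bullet> ?g) + n x \<bullet> (?A *v ?v)" by simp
    have F3d: "pd e0 F3 ?z = deriv fw (c t x) * pd e0 C ?z"
    proof -
      have "(fw has_real_derivative deriv fw (C ?z)) (at (C ?z))"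
        unfolding fw using has_real_derivative_wall_energy DERIV_imp_deriv by metis
      then show ?thesis
        unfolding F3_def[abs_def] using pd_compose_real[OF W z Cs] by (simp add: C_def)
    qed
    \<comment> \<open>The normal capillary term and the derivative of the wall energy are both
      multiples of the time derivative of \<open>C\<close>; their factors add up to
      \<open>L\<close>.\<close>
    have "B x \<bullet> n x + pd e0 F3 ?z = L t x * pd e0 C ?z + n x \<bullet> (?A *v ?v)"
      unfolding Bn F3d L by (simp add: R_def C_def algebra_simps)
    \<comment> \<open>Through \<open>relax\<close> the product of \<open>L\<close> with the
      convection of \<open>c\<close> along the wall appears with a minus sign, through
      \<open>traction\<close> with a plus sign. This cancellation is why the slip law contains the
      tangential derivative of \<open>c\<close>.\<close>
    also have "\<dots> = - (M\<Gamma> t x * (L t x)\<^sup>2 + \<beta> (c t x) * (norm ?v)\<^sup>2)"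
      unfolding relax traction by (simp add: power2_eq_square algebra_simps)
    finally show ?thesis unfolding usv by simp
  qed
  \<comment> \<open>The normal flux is merged with the rate of the wall energy into one boundary
    integral, since only their sum has the dissipative form of \<open>wall\<close>.\<close>
  have "(LINT x:\<Omega>|lborel. divergence B x) + (LINT x:frontier \<Omega>|S. pd e0 F3 (t, x))
      = (LINT x:frontier \<Omega>|S. B x \<bullet> n x + pd e0 F3 (t, x))"
    unfolding div(1) by (intro set_integral_add(2)[symmetric] div(3) int\<Gamma> Cinf_on_pd F3s)
  also have "\<dots> = (LINT x:frontier \<Omega>|S. - (M\<Gamma> t x * \<bar>L t x\<bar>\<^sup>2 + \<beta> (c t x) * (norm (us t x))\<^sup>2))"
    by (rule set_lebesgue_integral_cong) (use wall sS frontier_closed in auto)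
  also have "\<dots> = - (LINT x:frontier \<Omega>|S. M\<Gamma> t x * \<bar>L t x\<bar>\<^sup>2 + \<beta> (c t x) * (norm (us t x))\<^sup>2)"
    unfolding set_lebesgue_integral_def scaleR_minus_right by (rule Bochner_Integration.integral_minus)
  finally have bdry: "(LINT x:\<Omega>|lborel. divergence B x) + (LINT x:frontier \<Omega>|S. pd e0 F3 (t, x)) = \<dots>" .
  have zO: "(t, x) \<in> W" if "x \<in> \<Omega>" for x using inW t that \<Omega>cl by blast
  have i4: "(LINT x:\<Omega>|lborel. F4 (t, x)) = (LINT x:\<Omega>|lborel. 2 * \<eta> (c t x) * (norm (strain (u t) x))\<^sup>2)"
    by (rule set_lebesgue_integral_cong)
       (use o\<Omega> zO in \<open>auto simp: F4_def norm_matrix_square strn E_def C_def\<close>)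
  have i5: "(LINT x:\<Omega>|lborel. F5 (t, x)) = (LINT x:\<Omega>|lborel. lam (c t x) * \<bar>divergence (u t) x\<bar>\<^sup>2)"
    by (rule set_lebesgue_integral_cong) (use o\<Omega> zO in \<open>auto simp: F5_def dvn Lm_def C_def\<close>)
  have i6: "(LINT x:\<Omega>|lborel. F6 (t, x)) = (LINT x:\<Omega>|lborel. M t x * (norm (grad (\<mu> t) x))\<^sup>2)"
    by (rule set_lebesgue_integral_cong)
       (use o\<Omega> zO in \<open>auto simp: F6_def norm_vec_square gradmu Mf_def\<close>)
  have "(LINT x:\<Omega>|lborel. pd e0 F1 (t, x)) + (LINT x:\<Omega>|lborel. pd e0 F2 (t, x))
        + (LINT x:frontier \<Omega>|S. pd e0 F3 (t, x))
    = - (LINT x:\<Omega>|lborel. 2 * \<eta> (c t x) * (norm (strain (u t) x))\<^sup>2)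
      - (LINT x:\<Omega>|lborel. lam (c t x) * \<bar>divergence (u t) x\<bar>\<^sup>2)
      - (LINT x:\<Omega>|lborel. M t x * (norm (grad (\<mu> t) x))\<^sup>2)
      - (LINT x:frontier \<Omega>|S. M\<Gamma> t x * \<bar>L t x\<bar>\<^sup>2 + \<beta> (c t x) * (norm (us t x))\<^sup>2)"
    using vol bdry unfolding i4 i5 i6 by linarith
  then show ?thesis using energy_deriv by (simp only:)
qed

end
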